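(* Let $\lambda_1,\dots,\lambda_\kappa$ be the pairwise distinct eigenvalues (finite or infinite) of the regular $n\times n$ matrix pencil $L(\lambda)$ which is skew-Hermitian, $*$-alternating (i.e. $*$-even or $*$-odd), $*$-palindromic, or $*$-anti-palindromic, with nonzero partial multiplicities $n_{i,1}\geq n_{i,2}\geq\cdots\geq n_{i,g_i}>0$ for $i=1,\dots,\kappa$, respectively. Let $r$ be a positive integer and, for each $0\leq s\leq\lfloor r/2\rfloor$, put $\ell=r-2s$ and let $\Phi_s$ be the map on $\mathbb R^{2\ell}\times\mathbb C^{(r+s)n}$ defined in the context for the structure of $L$. Then, for each such $s$, there is a generic set $\mathcal G_s$ in $\mathbb R^{2\ell}\times\mathbb C^{(r+s)n}$ such that, for all $E(\lambda)\in\Phi_s(\mathcal G_s)$, the perturbed pencil $(L+E)(\lambda)$ is regular and the partial multiplicities of $L+E$ at $\lambda_i$ are $n_{i,r+1}\geq\cdots\geq n_{i,g_i}$ for $i=1,\dots,\kappa$. In particular, if $g_i\leq r$ then $\lambda_i$ is not an eigenvalue of $L+E$. Furthermore, all eigenvalues of $L+E$ that are not eigenvalues of $L$ are simple.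
   Context: A matrix pencil $L(\lambda)=A+\lambda B$ with $A,B\in\mathbb C^{n\times n}$ is: skew-Hermitian if $A^*=-A$, $B^*=-B$; $*$-even if $A^*=A$, $B^*=-B$; $*$-odd if $A^*=-A$, $B^*=B$; $*$-palindromic if $A^*=B$; $*$-anti-palindromic if $A^*=-B$. It is regular if $\det L(\lambda)\not\equiv 0$. For a regular pencil, a finite eigenvalue is a root of $\det L(\lambda)$; $\infty$ is an eigenvalue if $0$ is an eigenvalue of the reversal $\operatorname{rev}L(\lambda)=B+\lambda A$. The partial multiplicities of a regular pencil at an eigenvalue are the sizes of the corresponding Jordan blocks in its Weierstrass canonical form (at $\infty$: the partial multiplicities of $\operatorname{rev}L$ at $0$); the algebraic multiplicity is their sum, and an eigenvalue is simple if its algebraic multiplicity is $1$. For $w(\lambda)=w_0+\lambda w_1$ with $w_0,w_1\in\mathbb C^n$: $w(\lambda)^*=w_0^*+\lambda w_1^*$ (conjugate transpose is applied to coefficients only, not to $\lambda$) and $\operatorname{rev}w(\lambda)=w_1+\lambda w_0$. The imaginary unit is $\mathfrak i$. The map $\Phi_s$: a point of $\mathbb R^{2\ell}\times\mathbb C^{(r+s)n}$ consists of real numbers $a_1,b_1,\dots,a_\ell,b_\ell$ and vectors $u_1,\dots,u_\ell,v_1,\dots,v_s,\gamma_1,\dots,\gamma_s,\delta_1,\dots,\delta_s\in\mathbb C^n$ (note $(\ell+3s)n=(r+s)n$). With $w_j(\lambda)=\gamma_j+\lambda\delta_j$, its image under $\Phi_s$ is - skew-Hermitian case: $\sum_{i=1}^\ell\mathfrak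 i(a_i+\lambda b_i)u_iu_i^*+\sum_{j=1}^s\big(v_jw_j^*-w_jv_j^*\big)$; - $*$-even case: $\sum_{i=1}^\ell(a_i+\lambda(b_i\mathfrak i))u_iu_i^*+\sum_{j=1}^s\big(v_jw_j(\lambda)^*+w_j(-\lambda)v_j^*\big)$; - $*$-odd case: $\sum_{i=1}^\ell(a_i\mathfrak i+\lambda b_i)u_iu_i^*+\sum_{j=1}^s\big(v_jw_j(\lambda)^*-w_j(-\lambda)v_j^*\big)$; - $*$-palindromic case: $\sum_{i=1}^\ell\big((a_i-b_i\mathfrak i)+\lambda(a_i+b_i\mathfrak i)\big)u_iu_i^*+\sum_{j=1}^s\big(v_jw_j^*+(\operatorname{rev}w_j)v_j^*\big)$; - $*$-anti-palindromic case: $\sum_{i=1}^\ell\big((a_i+b_i\mathfrak i)+\lambda(-a_i+b_i\mathfrak i)\big)u_iu_i^*+\sum_{j=1}^s\big(v_jw_j^*-(\operatorname{rev}w_j)v_j^*\big)$. Genericity: a subset of $\mathbb R^m$ is generic if its complement is contained in a proper algebraic set, i.e., in a set of common zeros of finitely many real polynomials in $m$ variables that is not all of $\mathbb R^m$. Here $\mathbb R^{2\ell}\times\mathbb C^{(r+s)n}$ is identified with $\mathbb R^{2\ell+2(r+s)n}$ by taking real and imaginary parts of the complex variables. *)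

theory Defs
  imports
    "Jordan_Normal_Form.Jordan_Normal_Form"
    "Jordan_Normal_Form.Schur_Decomposition"
    "HOL-Library.Poly_Mapping"
    "HOL-Library.Product_Plus"
begin

section \<open>Matrix pencils\<close>

text \<open>The pair \<open>(A, B)\<close> stands for the pencil \<open>A + \<lambda> B\<close>; sums and differences of pencils are
  the componentwise ones on pairs.\<close>

type_synonym pencil = "complex mat \<times> complex mat"

definition carrier_pencil :: "nat \<Rightarrow> pencil set" where
  "carrier_pencil n = carrier_mat n n \<times> carrier_mat n n"

fun pencil_at :: "pencil \<Rightarrow> complex \<Rightarrow> complex mat" where
  "pencil_at (A, B) z = A + z \<cdot>\<^sub>m B"

definition regular_pencil :: "pencil \<Rightarrow> bool" where
  "regular_pencil L \<longleftrightarrow> (\<exists>z. det (pencil_at L z) \<noteq> 0)"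

fun rev_pencil :: "pencil \<Rightarrow> pencil" where
  "rev_pencil (A, B) = (B, A)"

datatype ext_complex = Fin complex | Infty

fun pencil_eigenvalue :: "pencil \<Rightarrow> ext_complex \<Rightarrow> bool" where
  "pencil_eigenvalue L (Fin z) \<longleftrightarrow> det (pencil_at L z) = 0"
| "pencil_eigenvalue L Infty \<longleftrightarrow> det (pencil_at (rev_pencil L) 0) = 0"

text \<open>Weierstrass canonical form: \<open>L\<close> is strictly equivalent to \<open>diag(\<lambda>I - J, \<lambda>N - I)\<close>, where \<open>J\<close>
  consists of the Jordan blocks listed as (size, eigenvalue) in \<open>fs\<close>, and \<open>N\<close> of the nilpotent
  Jordan blocks with sizes \<open>ns\<close>.\<close>

definition weierstrass_form :: "pencil \<Rightarrow> (nat \<times> complex) list \<Rightarrow> nat list \<Rightarrow> bool" where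
  "weierstrass_form L fs ns \<longleftrightarrow>
     0 \<notin> fst ` set fs \<and> 0 \<notin> set ns \<and>
     (\<exists>n P Q. let J = jordan_matrix fs; N = jordan_matrix (map (\<lambda>k. (k, 0)) ns);
                 p = dim_row J; q = dim_row N
       in L \<in> carrier_pencil n \<and> P \<in> carrier_mat n n \<and> Q \<in> carrier_mat n n \<and>
          invertible_mat P \<and> invertible_mat Q \<and>
          P * fst L * Q = - four_block_mat J (0\<^sub>m p q) (0\<^sub>m q p) (1\<^sub>m q) \<and>
          P * snd L * Q = four_block_mat (1\<^sub>m p) (0\<^sub>m p q) (0\<^sub>m q p) N)"

text \<open>The partial multiplicities at \<open>\<mu>\<close>, in nonincreasing order. A regular pencil has a Weierstrass
  form that is unique up to the order of the blocks, so the description below is proper.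
  The list is empty if \<open>\<mu>\<close> is not an eigenvalue.\<close>

definition finite_partial_mults :: "pencil \<Rightarrow> complex \<Rightarrow> nat list" where
  "finite_partial_mults L z =
     (THE ms. \<exists>fs ns. weierstrass_form L fs ns \<and>
        ms = rev (sort (map fst (filter (\<lambda>(k, a). a = z) fs))))"

fun partial_mults :: "pencil \<Rightarrow> ext_complex \<Rightarrow> nat list" where
  "partial_mults L (Fin z) = finite_partial_mults L z"
| "partial_mults L Infty = finite_partial_mults (rev_pencil L) 0"

definition alg_mult :: "pencil \<Rightarrow> ext_complex \<Rightarrow> nat" where
  "alg_mult L \<mu> = sum_list (partial_mults L \<mu>)"

definition simple_eigenvalue :: "pencil \<Rightarrow> ext_complex \<Rightarrow> bool" where
  "simple_eigenvalue L \<mu> \<longleftrightarrow> pencil_eigenvalue L \<mu> \<and> alg_mult L \<mu> = 1"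


section \<open>Structured pencils\<close>

datatype pencil_structure =
  Skew_Hermitian | Star_Even | Star_Odd | Star_Palindromic | Star_Anti_Palindromic

fun has_structure :: "pencil_structure \<Rightarrow> pencil \<Rightarrow> bool" where
  "has_structure Skew_Hermitian (A, B) \<longleftrightarrow> mat_adjoint A = - A \<and> mat_adjoint B = - B"
| "has_structure Star_Even (A, B) \<longleftrightarrow> mat_adjoint A = A \<and> mat_adjoint B = - B"
| "has_structure Star_Odd (A, B) \<longleftrightarrow> mat_adjoint A = - A \<and> mat_adjoint B = B"
| "has_structure Star_Palindromic (A, B) \<longleftrightarrow> mat_adjoint A = B"
| "has_structure Star_Anti_Palindromic (A, B) \<longleftrightarrow> mat_adjoint A = - B"


section \<open>The parametrization of the perturbations\<close>

text \<open>\<open>u v\<^sup>*\<close>\<close>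
definition outer :: "complex vec \<Rightarrow> complex vec \<Rightarrow> complex mat" where
  "outer u v = mat (dim_vec u) (dim_vec v) (\<lambda>(i, j). u $ i * cnj (v $ j))"

text \<open>The pair \<open>(w\<^sub>0, w\<^sub>1)\<close> stands for \<open>w(\<lambda>) = w\<^sub>0 + \<lambda> w\<^sub>1\<close>.\<close>
type_synonym vec_pencil = "complex vec \<times> complex vec"

text \<open>\<open>v w(\<lambda>)\<^sup>*\<close> and \<open>w(\<lambda>) v\<^sup>*\<close>; the conjugate transpose does not act on \<open>\<lambda>\<close>.\<close>
fun outer_vp :: "complex vec \<Rightarrow> vec_pencil \<Rightarrow> pencil" where
  "outer_vp v (w0, w1) = (outer v w0, outer v w1)"

fun outer_pv :: "vec_pencil \<Rightarrow> complex vec \<Rightarrow> pencil" where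
  "outer_pv (w0, w1) v = (outer w0 v, outer w1 v)"

text \<open>\<open>w(-\<lambda>)\<close>\<close>
fun reflect_vp :: "vec_pencil \<Rightarrow> vec_pencil" where
  "reflect_vp (w0, w1) = (w0, - w1)"

fun rev_vp :: "vec_pencil \<Rightarrow> vec_pencil" where
  "rev_vp (w0, w1) = (w1, w0)"

text \<open>The coefficients \<open>(c, d)\<close> of the scalar factor \<open>c + \<lambda> d\<close> of \<open>u u\<^sup>*\<close>.\<close>
fun rank1_coeffs :: "pencil_structure \<Rightarrow> real \<Rightarrow> real \<Rightarrow> complex \<times> complex" where
  "rank1_coeffs Skew_Hermitian a b = (\<i> * of_real a, \<i> * of_real b)"
| "rank1_coeffs Star_Even a b = (of_real a, of_real b * \<i>)"
| "rank1_coeffs Star_Odd a b = (of_real a * \<i>, of_real b)"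
| "rank1_coeffs Star_Palindromic a b =
     (of_real a - of_real b * \<i>, of_real a + of_real b * \<i>)"
| "rank1_coeffs Star_Anti_Palindromic a b =
     (of_real a + of_real b * \<i>, - of_real a + of_real b * \<i>)"

definition rank1_term :: "pencil_structure \<Rightarrow> real \<Rightarrow> real \<Rightarrow> complex vec \<Rightarrow> pencil" where
  "rank1_term \<sigma> a b u =
     (case rank1_coeffs \<sigma> a b of (c, d) \<Rightarrow> (c \<cdot>\<^sub>m outer u u, d \<cdot>\<^sub>m outer u u))"

fun rank2_term :: "pencil_structure \<Rightarrow> complex vec \<Rightarrow> vec_pencil \<Rightarrow> pencil" where
  "rank2_term Skew_Hermitian v w = outer_vp v w - outer_pv w v"
| "rank2_term Star_Even v w = outer_vp v w + outer_pv (reflect_vp w) v"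
| "rank2_term Star_Odd v w = outer_vp v w - outer_pv (reflect_vp w) v"
| "rank2_term Star_Palindromic v w = outer_vp v w + outer_pv (rev_vp w) v"
| "rank2_term Star_Anti_Palindromic v w = outer_vp v w - outer_pv (rev_vp w) v"

definition pencil_sum :: "nat \<Rightarrow> (nat \<Rightarrow> pencil) \<Rightarrow> nat \<Rightarrow> pencil" where
  "pencil_sum n f k =
     (mat n n (\<lambda>ij. \<Sum>i<k. fst (f i) $$ ij), mat n n (\<lambda>ij. \<Sum>i<k. snd (f i) $$ ij))"

text \<open>A point of \<open>\<real>\<^sup>2\<^sup>l \<times> \<complex>\<^sup>N\<close>, with \<open>l = r - 2s\<close> and \<open>N = (r + s) n\<close>, is a pair \<open>(x, z)\<close>. The
  entries of \<open>x\<close> are \<open>a\<^sub>1, b\<^sub>1, \<dots>, a\<^sub>l, b\<^sub>l\<close>; \<open>z\<close> is the concatenation of the \<open>l + 3s = r + s\<close> vectors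
  \<open>u\<^sub>1, \<dots>, u\<^sub>l, v\<^sub>1, \<dots>, v\<^sub>s, \<gamma>\<^sub>1, \<dots>, \<gamma>\<^sub>s, \<delta>\<^sub>1, \<dots>, \<delta>\<^sub>s\<close>, each of length \<open>n\<close>. Indices start at \<open>0\<close> below.\<close>

type_synonym param = "real vec \<times> complex vec"

definition param_space :: "nat \<Rightarrow> nat \<Rightarrow> nat \<Rightarrow> param set" where
  "param_space n r s = carrier_vec (2 * (r - 2 * s)) \<times> carrier_vec ((r + s) * n)"

definition vec_block :: "nat \<Rightarrow> complex vec \<Rightarrow> nat \<Rightarrow> complex vec" where
  "vec_block n z k = vec n (\<lambda>i. z $ (k * n + i))"

fun Phi :: "pencil_structure \<Rightarrow> nat \<Rightarrow> nat \<Rightarrow> nat \<Rightarrow> param \<Rightarrow> pencil" where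
  "Phi \<sigma> n r s (x, z) =
     (let l = r - 2 * s;
          a = (\<lambda>i. x $ (2 * i));
          b = (\<lambda>i. x $ (2 * i + 1));
          u = (\<lambda>i. vec_block n z i);
          v = (\<lambda>j. vec_block n z (l + j));
          \<gamma> = (\<lambda>j. vec_block n z (l + s + j));
          \<delta> = (\<lambda>j. vec_block n z (l + 2 * s + j))
      in pencil_sum n (\<lambda>i. rank1_term \<sigma> (a i) (b i) (u i)) l
       + pencil_sum n (\<lambda>j. rank2_term \<sigma> (v j) (\<gamma> j, \<delta> j)) s)"


section \<open>Genericity\<close>

text \<open>Real polynomials in the variables \<open>X\<^sub>0, X\<^sub>1, \<dots>\<close>, as finitely supported maps from exponent
  vectors to coefficients.\<close>

type_synonym real_mpoly = "(nat \<Rightarrow>\<^sub>0 nat) \<Rightarrow>\<^sub>0 real"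

definition mpoly_in_vars :: "nat \<Rightarrow> real_mpoly \<Rightarrow> bool" where
  "mpoly_in_vars m p \<longleftrightarrow> (\<forall>e \<in> Poly_Mapping.keys p. Poly_Mapping.keys e \<subseteq> {..<m})"

definition eval_mpoly :: "real_mpoly \<Rightarrow> real vec \<Rightarrow> real" where
  "eval_mpoly p x = (\<Sum>e \<in> Poly_Mapping.keys p.
     Poly_Mapping.lookup p e *
     (\<Prod>i \<in> Poly_Mapping.keys e. x $ i ^ Poly_Mapping.lookup e i))"

definition zero_locus :: "nat \<Rightarrow> real_mpoly set \<Rightarrow> real vec set" where
  "zero_locus m F = {x \<in> carrier_vec m. \<forall>p \<in> F. eval_mpoly p x = 0}"

definition generic_in :: "nat \<Rightarrow> real vec set \<Rightarrow> bool" where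
  "generic_in m S \<longleftrightarrow> S \<subseteq> carrier_vec m \<and>
     (\<exists>F. finite F \<and> (\<forall>p \<in> F. mpoly_in_vars m p) \<and>
          zero_locus m F \<noteq> carrier_vec m \<and> carrier_vec m - S \<subseteq> zero_locus m F)"

fun realify :: "param \<Rightarrow> real vec" where
  "realify (x, z) = x @\<^sub>v map_vec Re z @\<^sub>v map_vec Im z"

definition generic_params :: "nat \<Rightarrow> nat \<Rightarrow> nat \<Rightarrow> param set \<Rightarrow> bool" where
  "generic_params n r s G \<longleftrightarrow> G \<subseteq> param_space n r s \<and>
     generic_in (2 * (r - 2 * s) + 2 * (r + s) * n) (realify ` G)"

end

theory Submission
  imports
    Defs
    "Jordan_Normal_Form.Jordan_Normal_Form_Existence"
    "Subresultants.Subresultant_Gcd"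
    "HOL-Computational_Algebra.Field_as_Ring"
begin

text \<open>For a polynomial matrix \<open>W\<close> let \<open>\<delta>\<^sub>j(W)\<close> be the least order of vanishing at \<open>z\<close> of a nonzero determinant
  \<open>det (W + X Y)\<close>, where \<open>X\<close> and \<open>Y\<close> are polynomial matrices with \<open>j\<close> columns and \<open>j\<close> rows (\<open>rank_order\<close>). The
  proof compares these numbers for \<open>L\<close> and for \<open>L + E\<close>.

  If \<open>n\<^sub>1 \<ge> n\<^sub>2 \<ge> \<dots>\<close> are the partial multiplicities of \<open>L\<close> at \<open>z\<close>, then \<open>\<delta>\<^sub>j(L) = n\<^sub>j\<^sub>+\<^sub>1 + n\<^sub>j\<^sub>+\<^sub>2 + \<dots>\<close>
  (\<open>rank_order_weierstrass\<close>), so the numbers \<open>\<delta>\<^sub>j\<close> determine the partial multiplicities. Therefore it suffices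
  to obtain \<open>\<delta>\<^sub>j(L + E) = \<delta>\<^sub>r\<^sub>+\<^sub>j(L)\<close> for all \<open>j\<close>. One inequality always holds: \<open>E\<close> is a product of polynomial
  matrices with inner dimension \<open>r\<close> (\<open>low_rank_PhiC\<close>), and so \<open>\<delta>\<^sub>j(L + E) \<ge> \<delta>\<^sub>r\<^sub>+\<^sub>j(L)\<close> (\<open>rank_order_add\<close>).

  The opposite inequality is a generic one: it holds as soon as one coefficient of the determinant of \<open>L + E\<close>,
  perturbed by a fixed matrix of rank \<open>j\<close>, does not vanish, and this coefficient is a polynomial in the real
  parameters. In the same way, the new eigenvalues are simple when a discriminant is nonzero. Finitely many
  such polynomials define the generic set, and what remains is to see that none of them vanishes identically.

  For this purpose the parameters may be complex, because a polynomial that vanishes at all real points vanishes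
  at all complex ones (\<open>polyfun_real_nonzero\<close>). With complex parameters the vectors \<open>u\<close> and \<open>u\<^sup>*\<close> become
  independent, and for each of the five structures the family contains all pencils \<open>(x - \<rho>) X Y\<close> with constant
  matrices \<open>X\<close> and \<open>Y\<close> of inner dimension \<open>r\<close> (\<open>scaled_pencil_in_range_PhiC\<close>). Among these a pencil with all the
  required properties is built from \<open>r\<close> rank-one perturbations (\<open>rank_one_step\<close>,
  \<open>exists_generic_scaled_pencil\<close>). The eigenvalue \<open>\<infinity>\<close> is treated as the eigenvalue \<open>0\<close> of the reversed pencil.\<close>

text \<open>Linear factors are kept in the form \<open>[:- z, 1:]\<close>.\<close>

declare coeff_lift_hom.hom_one [simp del]

section \<open>Polynomial functions of the parameters and genericity\<close>

text \<open>Polynomial functions of \<open>m\<close> complex variables with values in a ring; \<open>\<iota>\<close> embeds the scalars. With the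
  identity for \<open>\<iota>\<close> these are the polynomials in the parameters, and with the constants of \<open>\<complex>[x]\<close> the
  polynomials in the parameters and in \<open>x\<close>.\<close>

inductive polyfun :: "(complex \<Rightarrow> 'a :: comm_ring_1) \<Rightarrow> nat \<Rightarrow> ((nat \<Rightarrow> complex) \<Rightarrow> 'a) \<Rightarrow> bool"
  for \<iota> :: "complex \<Rightarrow> 'a" and m :: nat where
  const: "polyfun \<iota> m (\<lambda>_. a)"
| coord: "i < m \<Longrightarrow> polyfun \<iota> m (\<lambda>y. \<iota> (y i))"
| add: "polyfun \<iota> m f \<Longrightarrow> polyfun \<iota> m g \<Longrightarrow> polyfun \<iota> m (\<lambda>y. f y + g y)"
| mult: "polyfun \<iota> m f \<Longrightarrow> polyfun \<iota> m g \<Longrightarrow> polyfun \<iota> m (\<lambda>y. f y * g y)"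

abbreviation scalar_polyfun :: "nat \<Rightarrow> ((nat \<Rightarrow> complex) \<Rightarrow> complex) \<Rightarrow> bool" where
  "scalar_polyfun \<equiv> polyfun (\<lambda>c. c)"

abbreviation poly_polyfun :: "nat \<Rightarrow> ((nat \<Rightarrow> complex) \<Rightarrow> complex poly) \<Rightarrow> bool" where
  "poly_polyfun \<equiv> polyfun (\<lambda>c. [:c:])"

lemma polyfun_sum:
  assumes "\<And>i. i \<in> I \<Longrightarrow> polyfun \<iota> m (f i)"
  shows "polyfun \<iota> m (\<lambda>y. \<Sum>i\<in>I. f i y)"
  using assms by (induction I rule: infinite_finite_induct) (auto intro: polyfun.intros)

lemma polyfun_prod:
  assumes "\<And>i. i \<in> I \<Longrightarrow> polyfun \<iota> m (f i)"
  shows "polyfun \<iota> m (\<lambda>y. \<Prod>i\<in>I. f i y)"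
  using assms by (induction I rule: infinite_finite_induct) (auto intro: polyfun.intros)

lemma polyfun_uminus: "polyfun \<iota> m f \<Longrightarrow> polyfun \<iota> m (\<lambda>y. - f y)"
  using polyfun.mult[OF polyfun.const[of \<iota> m "-1"], of f] by simp

lemma polyfun_diff: "polyfun \<iota> m f \<Longrightarrow> polyfun \<iota> m g \<Longrightarrow> polyfun \<iota> m (\<lambda>y. f y - g y)"
  using polyfun.add[OF _ polyfun_uminus, of \<iota> m f g] by simp

lemma polyfun_det:
  assumes "\<And>y. A y \<in> carrier_mat n n"
    and "\<And>i j. i < n \<Longrightarrow> j < n \<Longrightarrow> polyfun \<iota> m (\<lambda>y. A y $$ (i, j))"
  shows "polyfun \<iota> m (\<lambda>y. det (A y))"
  unfolding det_def'[OF assms(1)]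
  by (intro polyfun_sum polyfun.mult polyfun.const polyfun_prod assms(2))
    (auto simp: permutes_in_image)

lemma polyfun_poly_const: "scalar_polyfun m f \<Longrightarrow> poly_polyfun m (\<lambda>y. [:f y:])"
proof (induction rule: polyfun.induct)
  case (const a) then show ?case by (rule polyfun.const)
next
  case (coord i) then show ?case by (rule polyfun.coord)
next
  case (add f g) then show ?case using polyfun.add[OF add.IH] by simp
next
  case (mult f g) then show ?case using polyfun.mult[OF mult.IH] by (simp add: mult.commute)
qed

lemma polyfun_coeff: "poly_polyfun m f \<Longrightarrow> scalar_polyfun m (\<lambda>y. coeff (f y) k)"
proof (induction arbitrary: k rule: polyfun.induct)
  case (const a) then show ?case by (rule polyfun.const)
next
  case (coord i) then show ?case
    by (cases k) (auto intro: polyfun.intros simp: coeff_pCons)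
next
  case (add f g) then show ?case by (auto intro: polyfun.intros)
next
  case (mult f g) then show ?case
    unfolding coeff_mult by (intro polyfun_sum polyfun.mult) auto
qed

lemma polyfun_pcompose: "poly_polyfun m f \<Longrightarrow> poly_polyfun m (\<lambda>y. pcompose (f y) q)"
proof (induction rule: polyfun.induct)
  case (coord i) then show ?case using polyfun.coord[of i m "\<lambda>c. [:c:]"] by (simp add: pcompose_pCons)
qed (auto intro: polyfun.intros simp: pcompose_add pcompose_mult)

text \<open>Restriction to a line reduces questions about zeros to polynomials in one variable, which have only
  finitely many of them.\<close>

lemma polyfun_on_line:
  "scalar_polyfun m f \<Longrightarrow> \<exists>q. \<forall>t. f (\<lambda>i. a i + t * b i) = poly q t"
proof (induction rule: polyfun.induct)
  case (const c) then show ?case by (intro exI[of _ "[:c:]"]) simp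
next
  case (coord i) then show ?case by (intro exI[of _ "[:a i, b i:]"]) simp
next
  case (add f g)
  then obtain p q where "\<forall>t. f (\<lambda>i. a i + t * b i) = poly p t" "\<forall>t. g (\<lambda>i. a i + t * b i) = poly q t"
    by blast
  then show ?case by (intro exI[of _ "p + q"]) simp
next
  case (mult f g)
  then obtain p q where "\<forall>t. f (\<lambda>i. a i + t * b i) = poly p t" "\<forall>t. g (\<lambda>i. a i + t * b i) = poly q t"
    by blast
  then show ?case by (intro exI[of _ "p * q"]) simp
qed

text \<open>On the line from a common nonzero of the earlier functions to a nonzero of the next one, no restricted
  function is the zero polynomial, hence neither is their product.\<close>

lemma polyfun_common_nonzero:
  assumes "finite I" and "\<And>k. k \<in> I \<Longrightarrow> scalar_polyfun m (f k) \<and> (\<exists>y. f k y \<noteq> 0)"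
  shows "\<exists>y. \<forall>k\<in>I. f k y \<noteq> 0"
  using assms
proof (induction I rule: finite_induct)
  case (insert k I)
  then obtain a b where a: "\<forall>k\<in>I. f k a \<noteq> 0" and b: "f k b \<noteq> 0" by blast
  define q where "q j = (SOME q. \<forall>t. f j (\<lambda>i. a i + t * (b i - a i)) = poly q t)" for j
  have q: "f j (\<lambda>i. a i + t * (b i - a i)) = poly (q j) t" if "j \<in> insert k I" for j t
    using someI_ex[OF polyfun_on_line[of m "f j" a "\<lambda>i. b i - a i"]] insert.prems that
    unfolding q_def by blast
  have "q j \<noteq> 0" if "j \<in> I" for j using bspec[OF a that] that q[of j 0] by auto
  moreover have "q k \<noteq> 0" using b q[of k 1] by auto
  ultimately have "(\<Prod>j\<in>insert k I. q j) \<noteq> 0" using insert.hyps by auto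
  then obtain t where "poly (\<Prod>j\<in>insert k I. q j) t \<noteq> 0"
    using poly_all_0_iff_0 by blast
  then have "\<forall>j\<in>insert k I. poly (q j) t \<noteq> 0" using insert.hyps by (simp add: poly_prod)
  then show ?case using q[of _ t] by (intro exI[of _ "\<lambda>i. a i + t * (b i - a i)"]) simp
qed simp

text \<open>A polynomial that is nonzero at \<open>a + \<i> b\<close> with real \<open>a, b\<close> is a nonzero polynomial in \<open>t\<close> along
  \<open>a + t b\<close>, hence nonzero for some real \<open>t\<close>.\<close>

lemma polyfun_real_nonzero:
  assumes f: "scalar_polyfun m f" and "f y \<noteq> 0"
  shows "\<exists>x. f (\<lambda>i. complex_of_real (x i)) \<noteq> 0"
proof -
  obtain q where q: "\<And>t. f (\<lambda>i. of_real (Re (y i)) + t * of_real (Im (y i))) = poly q t"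
    using polyfun_on_line[OF f] by metis
  have "y = (\<lambda>i. of_real (Re (y i)) + \<i> * of_real (Im (y i)))" by (rule ext) (rule complex_eq)
  then have "poly q \<i> \<noteq> 0" using q[of \<i>] assms(2) by metis
  then have "finite {t. poly q t = 0}" by (intro poly_roots_finite) auto
  moreover have "infinite (range complex_of_real)"
    by (meson finite_imageD infinite_UNIV_char_0 inj_of_real)
  ultimately obtain t :: real where "poly q (of_real t) \<noteq> 0"
    using finite_subset[of "range complex_of_real" "{t. poly q t = 0}"] by blast
  then show ?thesis
    using q[of "of_real t"] by (intro exI[of _ "\<lambda>i. Re (y i) + t * Im (y i)"]) simp
qed

lemma mpoly_monomial:
  assumes "mpoly_in_vars m p" "e \<in> Poly_Mapping.keys p"
  shows "(\<Prod>i\<in>Poly_Mapping.keys e. (x $ i :: real) ^ Poly_Mapping.lookup e i)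
    = (\<Prod>i<m. x $ i ^ Poly_Mapping.lookup e i)"
  by (rule prod.mono_neutral_left) (use assms in \<open>auto simp: mpoly_in_vars_def in_keys_iff\<close>)

lemma eval_mpoly_alt:
  assumes "mpoly_in_vars m p" "finite K" "Poly_Mapping.keys p \<subseteq> K"
  shows "eval_mpoly p x
    = (\<Sum>e\<in>K. Poly_Mapping.lookup p e * (\<Prod>i<m. x $ i ^ Poly_Mapping.lookup e i))"
proof -
  have "eval_mpoly p x = (\<Sum>e\<in>Poly_Mapping.keys p.
      Poly_Mapping.lookup p e * (\<Prod>i<m. x $ i ^ Poly_Mapping.lookup e i))"
    unfolding eval_mpoly_def using mpoly_monomial[OF assms(1)] by simp
  also have "\<dots> = (\<Sum>e\<in>K. Poly_Mapping.lookup p e * (\<Prod>i<m. x $ i ^ Poly_Mapping.lookup e i))"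
    by (rule sum.mono_neutral_left) (use assms in \<open>auto simp: in_keys_iff\<close>)
  finally show ?thesis .
qed

definition mpoly_function :: "nat \<Rightarrow> (real vec \<Rightarrow> real) \<Rightarrow> bool" where
  "mpoly_function m f \<longleftrightarrow> (\<exists>p. mpoly_in_vars m p \<and> f = eval_mpoly p)"

lemma mpoly_function_monomial:
  assumes "Poly_Mapping.keys e \<subseteq> {..<m}"
  shows "mpoly_function m (\<lambda>x. c * (\<Prod>i<m. x $ i ^ Poly_Mapping.lookup e i))"
proof -
  let ?p = "Poly_Mapping.single e c"
  have p: "mpoly_in_vars m ?p" using assms by (auto simp: mpoly_in_vars_def split: if_splits)
  have "eval_mpoly ?p = (\<lambda>x. c * (\<Prod>i<m. x $ i ^ Poly_Mapping.lookup e i))"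
    by (rule ext) (subst eval_mpoly_alt[OF p, of "{e}"], auto)
  then show ?thesis using p unfolding mpoly_function_def by metis
qed

lemma mpoly_function_add:
  assumes "mpoly_function m f" "mpoly_function m g"
  shows "mpoly_function m (\<lambda>x. f x + g x)"
proof -
  obtain p q where p: "mpoly_in_vars m p" "f = eval_mpoly p" and q: "mpoly_in_vars m q" "g = eval_mpoly q"
    using assms unfolding mpoly_function_def by blast
  let ?K = "Poly_Mapping.keys p \<union> Poly_Mapping.keys q"
  have sub: "Poly_Mapping.keys (p + q) \<subseteq> ?K" by (rule Poly_Mapping.keys_add)
  have pq: "mpoly_in_vars m (p + q)" using p q sub by (fastforce simp: mpoly_in_vars_def)
  have fin: "finite ?K" by simp
  have eval: "eval_mpoly (p + q) x = eval_mpoly p x + eval_mpoly q x" for x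
    unfolding eval_mpoly_alt[OF pq fin sub] eval_mpoly_alt[OF p(1) fin Un_upper1]
      eval_mpoly_alt[OF q(1) fin Un_upper2] lookup_add distrib_right sum.distrib ..
  then have "(\<lambda>x. f x + g x) = eval_mpoly (p + q)" unfolding p(2) q(2) by (intro ext) simp
  then show ?thesis using pq unfolding mpoly_function_def by blast
qed

lemma mpoly_function_sum:
  assumes "\<And>i. i \<in> I \<Longrightarrow> mpoly_function m (f i)"
  shows "mpoly_function m (\<lambda>x. \<Sum>i\<in>I. f i x)"
proof -
  have 0: "mpoly_function m (\<lambda>x. 0)" using mpoly_function_monomial[of 0 m 0] by simp
  show ?thesis
    using assms by (induction I rule: infinite_finite_induct) (auto intro: mpoly_function_add 0)
qed

text \<open>Expanding both factors reduces the product to monomials.\<close>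

lemma mpoly_function_mult:
  assumes "mpoly_function m f" "mpoly_function m g"
  shows "mpoly_function m (\<lambda>x. f x * g x)"
proof -
  obtain p q where p: "mpoly_in_vars m p" "f = eval_mpoly p" and q: "mpoly_in_vars m q" "g = eval_mpoly q"
    using assms unfolding mpoly_function_def by blast
  have "(\<lambda>x. f x * g x) = (\<lambda>x. \<Sum>d\<in>Poly_Mapping.keys p. \<Sum>e\<in>Poly_Mapping.keys q.
      (Poly_Mapping.lookup p d * Poly_Mapping.lookup q e)
        * (\<Prod>i<m. x $ i ^ Poly_Mapping.lookup (d + e) i))"
    unfolding p(2) q(2)
    by (simp add: eval_mpoly_alt[OF p(1) _ subset_refl] eval_mpoly_alt[OF q(1) _ subset_refl]
        sum_product lookup_add power_add prod.distrib algebra_simps)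
  moreover have "Poly_Mapping.keys (d + e) \<subseteq> {..<m}"
    if "d \<in> Poly_Mapping.keys p" "e \<in> Poly_Mapping.keys q" for d e
    using that p(1) q(1) Poly_Mapping.keys_add[of d e] by (fastforce simp: mpoly_in_vars_def)
  ultimately show ?thesis
    by (simp only:) (intro mpoly_function_sum mpoly_function_monomial)
qed

lemma mpoly_function_const: "mpoly_function m (\<lambda>x. c)"
  using mpoly_function_monomial[of 0 m c] by simp

lemma mpoly_function_coord: "i < m \<Longrightarrow> mpoly_function m (\<lambda>x. x $ i)"
proof -
  assume i: "i < m"
  have "(\<lambda>x. x $ i) = (\<lambda>x :: real vec. 1 * (\<Prod>j<m. x $ j ^ Poly_Mapping.lookup (Poly_Mapping.single i 1) j))"
  proof
    fix x :: "real vec"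
    have "(\<Prod>j<m. x $ j ^ Poly_Mapping.lookup (Poly_Mapping.single i 1) j) = (\<Prod>j<m. if j = i then x $ j else 1)"
      by (rule prod.cong) (auto simp: lookup_single)
    then show "x $ i = 1 * (\<Prod>j<m. x $ j ^ Poly_Mapping.lookup (Poly_Mapping.single i 1) j)" using i by simp
  qed
  then show ?thesis using mpoly_function_monomial[of "Poly_Mapping.single i 1" m 1] i by simp
qed

lemma polyfun_Re_Im:
  "scalar_polyfun m f \<Longrightarrow> mpoly_function m (\<lambda>x. Re (f (\<lambda>i. of_real (x $ i)))) \<and>
     mpoly_function m (\<lambda>x. Im (f (\<lambda>i. of_real (x $ i))))"
proof (induction rule: polyfun.induct)
  case (mult f g)
  then have "mpoly_function m (\<lambda>x. Re (f (\<lambda>i. of_real (x $ i))) * Re (g (\<lambda>i. of_real (x $ i)))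
      + (- 1) * (Im (f (\<lambda>i. of_real (x $ i))) * Im (g (\<lambda>i. of_real (x $ i)))))"
    by (intro mpoly_function_add mpoly_function_mult mpoly_function_const) auto
  then show ?case using mult.IH by (auto intro!: mpoly_function_add mpoly_function_mult)
qed (auto intro: mpoly_function_const mpoly_function_coord mpoly_function_add)

text \<open>The product of the given functions is again a polynomial that is not identically zero, and it keeps this
  property on real points. Its real and imaginary parts define the exceptional set.\<close>

lemma generic_in_polyfun:
  assumes "finite I" and "\<And>k. k \<in> I \<Longrightarrow> scalar_polyfun m (f k) \<and> (\<exists>y. f k y \<noteq> 0)"
  shows "generic_in m {x \<in> carrier_vec m. \<forall>k\<in>I. f k (\<lambda>i. of_real (x $ i)) \<noteq> 0}"
proof -
  define g where "g y = (\<Prod>k\<in>I. f k y)" for y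
  have g: "scalar_polyfun m g" unfolding g_def by (intro polyfun_prod) (use assms(2) in auto)
  obtain y where "\<forall>k\<in>I. f k y \<noteq> 0" using polyfun_common_nonzero[of I m f] assms by blast
  then have "g y \<noteq> 0" unfolding g_def using assms(1) by simp
  then obtain x where x: "g (\<lambda>i. of_real (x i)) \<noteq> 0" using polyfun_real_nonzero[OF g] by blast
  obtain p q where p: "mpoly_in_vars m p" "(\<lambda>x. Re (g (\<lambda>i. of_real (x $ i)))) = eval_mpoly p"
    and q: "mpoly_in_vars m q" "(\<lambda>x. Im (g (\<lambda>i. of_real (x $ i)))) = eval_mpoly q"
    using polyfun_Re_Im[OF g] unfolding mpoly_function_def by blast
  have eval: "eval_mpoly p x = 0 \<and> eval_mpoly q x = 0 \<longleftrightarrow> g (\<lambda>i. of_real (x $ i)) = 0" for x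
    using fun_cong[OF p(2), of x] fun_cong[OF q(2), of x] by (simp add: complex_eq_iff)
  have loc: "\<And>h. scalar_polyfun m h \<Longrightarrow> h (\<lambda>i. of_real (vec m x $ i)) = h (\<lambda>i. of_real (x i))"
  proof -
    fix h assume "scalar_polyfun m h"
    then show "h (\<lambda>i. of_real (vec m x $ i)) = h (\<lambda>i. of_real (x i))"
      by (induction rule: polyfun.induct) auto
  qed
  have "vec m x \<in> carrier_vec m" "vec m x \<notin> zero_locus m {p, q}"
    using eval[of "vec m x"] x loc[OF g] by (auto simp: zero_locus_def)
  then have "zero_locus m {p, q} \<noteq> carrier_vec m" by blast
  moreover have "carrier_vec m - {x \<in> carrier_vec m. \<forall>k\<in>I. f k (\<lambda>i. of_real (x $ i)) \<noteq> 0} \<subseteq> zero_locus m {p, q}"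
    using eval assms(1) by (auto simp: zero_locus_def g_def)
  ultimately show ?thesis
    unfolding generic_in_def using p(1) q(1) by (intro conjI exI[of _ "{p, q}"]) auto
qed

section \<open>Determinants under perturbations of low rank\<close>

lemma cofactor_cong_row:
  assumes "A \<in> carrier_mat n n" "B \<in> carrier_mat n n" "i < n"
    and "\<And>k j. k < n \<Longrightarrow> j < n \<Longrightarrow> k \<noteq> i \<Longrightarrow> A $$ (k, j) = B $$ (k, j)"
  shows "cofactor A i j = cofactor B i j"
proof -
  have "mat_delete A i j = mat_delete B i j"
    unfolding mat_delete_def using assms by (intro eq_matI) auto
  then show ?thesis unfolding cofactor_def by simp
qed

text \<open>The rows are changed one after the other. In the change of row \<open>m\<close> the new contribution has \<open>y\<close> as
  row \<open>m\<close>, and there the earlier changes, which added multiples of \<open>y\<close> to other rows, do not affect the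
  determinant.\<close>

lemma det_rank_one_update:
  fixes V :: "'a :: comm_ring_1 mat"
  assumes V: "V \<in> carrier_mat n n"
  shows "det (mat n n (\<lambda>(i, j). V $$ (i, j) + x i * y j))
    = det V + (\<Sum>i<n. \<Sum>j<n. x i * y j * cofactor V i j)"
proof -
  define A where "A m = mat n n (\<lambda>(i, j). V $$ (i, j) + (if i < m then x i * y j else 0))" for m
  define R where "R k m = mat n n (\<lambda>(i, j). if i = m then y j else A k $$ (i, j))" for k m
  have A: "A m \<in> carrier_mat n n" and R: "R k m \<in> carrier_mat n n" for k m
    by (auto simp: A_def R_def)
  have R_const: "det (R k m) = det (R 0 m)" if "k \<le> m" "m < n" for k m
    using that(1)
  proof (induction k)
    case (Suc k)
    have "R (Suc k) m = addrow (x k) k m (R k m)"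
      by (rule eq_matI) (use Suc.prems that(2) in \<open>auto simp: R_def A_def less_Suc_eq\<close>)
    then have "det (R (Suc k) m) = det (R k m)"
      using det_addrow[OF that(2) _ R, of k "x k" k] Suc.prems by simp
    then show ?case using Suc by simp
  qed simp
  have row: "det (R k m) = (\<Sum>j<n. y j * cofactor (A k) m j)" if "m < n" for k m
  proof -
    have "det (R k m) = (\<Sum>j<n. R k m $$ (m, j) * cofactor (R k m) m j)"
      by (rule laplace_expansion_row[OF R that])
    also have "\<dots> = (\<Sum>j<n. y j * cofactor (A k) m j)"
      using that cofactor_cong_row[OF R A that, of k m k]
      by (intro sum.cong) (auto simp: R_def)
    finally show ?thesis .
  qed
  have A0: "A 0 = V" using V by (intro eq_matI) (auto simp: A_def)
  have "det (A m) = det V + (\<Sum>i<m. \<Sum>j<n. x i * y j * cofactor V i j)" if "m \<le> n" for m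
    using that
  proof (induction m)
    case (Suc m)
    then have m: "m < n" by simp
    have "det (A (Suc m)) = (\<Sum>j<n. A (Suc m) $$ (m, j) * cofactor (A (Suc m)) m j)"
      by (rule laplace_expansion_row[OF A m])
    also have "\<dots> = (\<Sum>j<n. (A m $$ (m, j) + x m * y j) * cofactor (A m) m j)"
      using m cofactor_cong_row[OF A A m, of "Suc m" m]
      by (intro sum.cong) (auto simp: A_def)
    also have "\<dots> = det (A m) + x m * det (R m m)"
      unfolding row[OF m] laplace_expansion_row[OF A m]
      by (simp add: sum.distrib sum_distrib_left algebra_simps)
    also have "det (R m m) = (\<Sum>j<n. y j * cofactor V m j)"
      using R_const[of m m] row[OF m, of 0] m A0 by simp
    finally show ?case using Suc by (simp add: sum_distrib_left mult.assoc)
  qed (simp add: A0)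
  from this[OF order_refl] have "det (A n) = det V + (\<Sum>i<n. \<Sum>j<n. x i * y j * cofactor V i j)" .
  moreover have "A n = mat n n (\<lambda>(i, j). V $$ (i, j) + x i * y j)"
    by (rule eq_matI) (auto simp: A_def)
  ultimately show ?thesis by simp
qed

text \<open>Row \<open>i\<close> is \<open>p\<^sup>k\<^sup>i\<close> times a vector plus a combination of the \<open>r\<close> rows of \<open>Y\<close>. In the multilinear
  expansion of the determinant, a term that takes rows of \<open>Y\<close> in more than \<open>r\<close> places takes one of them
  twice and vanishes; every other term keeps the powers of \<open>p\<close> outside a set \<open>C\<close> of at most \<open>r\<close> places.\<close>

lemma dvd_det_rank_update:
  fixes p :: "'a :: comm_ring_1"
  assumes G: "G \<in> carrier_mat n n" and X: "X \<in> carrier_mat n r" and Y: "Y \<in> carrier_mat r n"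
    and e: "\<And>C. C \<subseteq> {..<n} \<Longrightarrow> card C \<le> r \<Longrightarrow> e \<le> (\<Sum>i\<in>{..<n} - C. k i)"
  shows "p ^ e dvd det (mat n n (\<lambda>(i, j). p ^ k i * G $$ (i, j)) + X * Y)"
proof -
  define c where "c i l = (if l = r then p ^ k i else X $$ (i, l))" for i l
  define w where "w l i = (if l = r then row G i else row Y l)" for l i
  let ?S = "{..r}"
  have w: "w l i \<in> carrier_vec n" if "i < n" "l \<le> r" for l i
    using that G Y by (auto simp: w_def)
  have "mat n n (\<lambda>(i, j). p ^ k i * G $$ (i, j)) + X * Y
      = mat\<^sub>r n n (\<lambda>i. finsum_vec TYPE('a) n (\<lambda>l. c i l \<cdot>\<^sub>v w l i) ?S)" (is "?M = _")
  proof (rule eq_matI)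
    fix i j assume ij: "i < dim_row (mat\<^sub>r n n (\<lambda>i. finsum_vec TYPE('a) n (\<lambda>l. c i l \<cdot>\<^sub>v w l i) ?S))"
      "j < dim_col (mat\<^sub>r n n (\<lambda>i. finsum_vec TYPE('a) n (\<lambda>l. c i l \<cdot>\<^sub>v w l i) ?S))"
    then have i: "i < n" and j: "j < n" by auto
    have "{..r} = insert r {..<r}" by auto
    then have "(\<Sum>l\<le>r. (c i l \<cdot>\<^sub>v w l i) $ j) = p ^ k i * G $$ (i, j) + (\<Sum>l<r. X $$ (i, l) * Y $$ (l, j))"
      using i j G X Y by (simp add: c_def w_def)
    moreover have "(X * Y) $$ (i, j) = (\<Sum>l<r. X $$ (i, l) * Y $$ (l, j))"
      using i j X Y by (simp add: scalar_prod_def atLeast0LessThan)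
    moreover have "mat\<^sub>r n n (\<lambda>i. finsum_vec TYPE('a) n (\<lambda>l. c i l \<cdot>\<^sub>v w l i) ?S) $$ (i, j)
        = (\<Sum>l\<le>r. (c i l \<cdot>\<^sub>v w l i) $ j)"
      using i j w by (simp add: mat_of_rows_def index_finsum_vec)
    ultimately show "?M $$ (i, j) = mat\<^sub>r n n (\<lambda>i. finsum_vec TYPE('a) n (\<lambda>l. c i l \<cdot>\<^sub>v w l i) ?S) $$ (i, j)"
      using i j X Y by simp
  qed (use X Y in auto)
  moreover have "p ^ e dvd det (mat\<^sub>r n n (\<lambda>i. c i (f i) \<cdot>\<^sub>v w (f i) i))"
    if f: "\<forall>i\<in>{0..<n}. f i \<in> ?S" for f
  proof -
    have "det (mat\<^sub>r n n (\<lambda>i. c i (f i) \<cdot>\<^sub>v w (f i) i))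
        = (\<Prod>i\<in>{0..<n}. c i (f i)) * det (mat\<^sub>r n n (\<lambda>i. w (f i) i))"
      by (rule det_rows_mul) (use f w in auto)
    moreover have "p ^ e dvd (\<Prod>i\<in>{0..<n}. c i (f i)) * det (mat\<^sub>r n n (\<lambda>i. w (f i) i))"
    proof (cases "card {i\<in>{..<n}. f i \<noteq> r} \<le> r")
      case True
      let ?C = "{i\<in>{..<n}. f i \<noteq> r}"
      have "p ^ e dvd p ^ (\<Sum>i\<in>{..<n} - ?C. k i)" by (intro le_imp_power_dvd e True) auto
      also have "\<dots> = (\<Prod>i\<in>{..<n} - ?C. c i (f i))"
        by (simp add: power_sum c_def)
      also have "\<dots> dvd (\<Prod>i\<in>{0..<n}. c i (f i))"
        by (rule prod_dvd_prod_subset) auto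
      finally show ?thesis by (rule dvd_mult2)
    next
      case False
      have "f ` {i\<in>{..<n}. f i \<noteq> r} \<subseteq> {..<r}" using f by force
      then have "card (f ` {i\<in>{..<n}. f i \<noteq> r}) \<le> r"
        using card_mono[of "{..<r}"] by fastforce
      then have "\<not> inj_on f {i\<in>{..<n}. f i \<noteq> r}" using False card_image by fastforce
      then obtain a b where ab: "a < n" "b < n" "a \<noteq> b" "f a = f b" "f a \<noteq> r"
        unfolding inj_on_def by auto
      have "det (mat\<^sub>r n n (\<lambda>i. w (f i) i)) = 0"
        by (rule det_identical_rows[OF _ ab(3,1,2)])
          (use ab f w in \<open>auto simp: w_def intro!: eq_vecI\<close>)
      then show ?thesis by simp
    qed
    ultimately show ?thesis by simp
  qed
  ultimately show ?thesis
    by (simp only:) (subst det_linear_rows_sum, use w in \<open>auto intro!: dvd_sum\<close>)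
qed

text \<open>The least order of vanishing at \<open>z\<close> that \<open>det W\<close> can be given by a perturbation of rank \<open>j\<close>. It turns
  out to be the sum of all partial multiplicities but the \<open>j\<close> largest. This description by determinants
  makes the effect of low-rank perturbations evident, and it makes upper bounds open conditions.\<close>

definition rank_order :: "complex poly mat \<Rightarrow> complex \<Rightarrow> nat \<Rightarrow> nat" where
  "rank_order W z j = (LEAST d. \<exists>X \<in> carrier_mat (dim_row W) j. \<exists>Y \<in> carrier_mat j (dim_row W).
     det (W + X * Y) \<noteq> 0 \<and> Polynomial.order z (det (W + X * Y)) = d)"

lemma rank_order_le:
  assumes "W \<in> carrier_mat n n" "X \<in> carrier_mat n j" "Y \<in> carrier_mat j n" "det (W + X * Y) \<noteq> 0"
  shows "rank_order W z j \<le> Polynomial.order z (det (W + X * Y))"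
  unfolding rank_order_def by (rule Least_le) (use assms in auto)

lemma rank_order_attained:
  assumes W: "W \<in> carrier_mat n n" and "det W \<noteq> 0"
  obtains X Y where "X \<in> carrier_mat n j" "Y \<in> carrier_mat j n" "det (W + X * Y) \<noteq> 0"
    "Polynomial.order z (det (W + X * Y)) = rank_order W z j"
proof -
  have "\<exists>X \<in> carrier_mat (dim_row W) j. \<exists>Y \<in> carrier_mat j (dim_row W).
     det (W + X * Y) \<noteq> 0 \<and> Polynomial.order z (det (W + X * Y)) = rank_order W z j"
    unfolding rank_order_def
    by (rule LeastI_ex, rule exI[of _ "Polynomial.order z (det W)"], rule bexI[of _ "0\<^sub>m n j"],
        rule bexI[of _ "0\<^sub>m j n"]) (use assms in auto)
  then show ?thesis using that W by auto
qed

lemma rank_order_0: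
  assumes "W \<in> carrier_mat n n" and "det W \<noteq> 0"
  shows "rank_order W z 0 = Polynomial.order z (det W)"
proof -
  obtain X Y where XY: "X \<in> carrier_mat n 0" "Y \<in> carrier_mat 0 n"
    "Polynomial.order z (det (W + X * Y)) = rank_order W z 0"
    using rank_order_attained[OF assms] by metis
  have "X * Y = 0\<^sub>m n n" using XY by (intro eq_matI) (auto simp: scalar_prod_def)
  then show ?thesis using XY(3) assms by simp
qed

lemma mult_append_cols_rows:
  assumes "X \<in> carrier_mat n r" "Y \<in> carrier_mat r n" "X' \<in> carrier_mat n j" "Y' \<in> carrier_mat j n"
  obtains X'' Y'' where "X'' \<in> carrier_mat n (r + j)" "Y'' \<in> carrier_mat (r + j) n"
    "X'' * Y'' = X * Y + X' * (Y' :: 'a :: comm_ring_1 mat)"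
proof
  let ?X = "mat n (r + j) (\<lambda>(i, k). if k < r then X $$ (i, k) else X' $$ (i, k - r))"
  let ?Y = "mat (r + j) n (\<lambda>(k, i). if k < r then Y $$ (k, i) else Y' $$ (k - r, i))"
  have split: "(\<Sum>k<r + j. f k) = (\<Sum>k<r. f k) + (\<Sum>k<j. f (r + k))" for f :: "nat \<Rightarrow> 'a"
    by (induction j) (auto simp: add.assoc)
  show "?X * ?Y = X * Y + X' * Y'"
  proof (rule eq_matI)
    fix a b assume "a < dim_row (X * Y + X' * Y')" "b < dim_col (X * Y + X' * Y')"
    then have ab: "a < n" "b < n" using assms by auto
    have "(?X * ?Y) $$ (a, b) = (\<Sum>k<r + j. (if k < r then X $$ (a, k) else X' $$ (a, k - r))
        * (if k < r then Y $$ (k, b) else Y' $$ (k - r, b)))"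
      using ab by (simp add: scalar_prod_def atLeast0LessThan)
    also have "\<dots> = (\<Sum>k<r. X $$ (a, k) * Y $$ (k, b)) + (\<Sum>k<j. X' $$ (a, k) * Y' $$ (k, b))"
      unfolding split by simp
    finally show "(?X * ?Y) $$ (a, b) = (X * Y + X' * Y') $$ (a, b)"
      using ab assms by (simp add: scalar_prod_def atLeast0LessThan)
  qed (use assms in auto)
qed auto

text \<open>A perturbation of rank \<open>j\<close> that follows one of rank \<open>r\<close> is one of rank \<open>r + j\<close> altogether.\<close>

lemma rank_order_add:
  assumes W: "W \<in> carrier_mat n n" and X: "X \<in> carrier_mat n r" and Y: "Y \<in> carrier_mat r n"
    and "det (W + X * Y) \<noteq> 0"
  shows "rank_order W z (r + j) \<le> rank_order (W + X * Y) z j"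
proof -
  have WX: "W + X * Y \<in> carrier_mat n n" using assms by simp
  obtain X' Y' where XY': "X' \<in> carrier_mat n j" "Y' \<in> carrier_mat j n"
    and det: "det (W + X * Y + X' * Y') \<noteq> 0"
    and ord: "Polynomial.order z (det (W + X * Y + X' * Y')) = rank_order (W + X * Y) z j"
    using rank_order_attained[OF WX assms(4)] by metis
  obtain X'' Y'' where XY'': "X'' \<in> carrier_mat n (r + j)" "Y'' \<in> carrier_mat (r + j) n"
    "X'' * Y'' = X * Y + X' * Y'"
    by (rule mult_append_cols_rows[OF X Y XY'])
  have "W + X'' * Y'' = W + X * Y + X' * Y'"
    unfolding XY''(3) using W X Y XY' by (intro assoc_add_mat[symmetric]) auto
  then show ?thesis using rank_order_le[OF W XY''(1,2), of z] det ord by simp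
qed

lemma rank_order_antimono:
  assumes "W \<in> carrier_mat n n" "det W \<noteq> 0" "i \<le> j"
  shows "rank_order W z j \<le> rank_order W z i"
  using rank_order_add[of W n "0\<^sub>m n (j - i)" "j - i" "0\<^sub>m (j - i) n" z i] assms by simp

text \<open>Perturbations of full rank reach the identity matrix.\<close>

lemma rank_order_dim:
  assumes W: "W \<in> carrier_mat n n"
  shows "rank_order W z n = 0"
proof -
  have "W + (1\<^sub>m n - W) * 1\<^sub>m n = 1\<^sub>m n" using W by (intro eq_matI) auto
  then show ?thesis using rank_order_le[of W n "1\<^sub>m n - W" n "1\<^sub>m n" z] W minus_carrier_mat[OF W] by simp
qed

section \<open>The local Smith form\<close>

text \<open>An element of the submultiset that is not the head of the list is at most the head, so it can be traded
  for it.\<close>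

lemma sum_mset_le_take:
  assumes "sorted_wrt (\<ge>) ms" "A \<subseteq># mset ms" "size A \<le> j"
  shows "sum_mset A \<le> sum_list (take j (ms :: nat list))"
  using assms
proof (induction ms arbitrary: A j)
  case (Cons m ms)
  show ?case
  proof (cases j)
    case (Suc i)
    show ?thesis
    proof (cases "m \<in># A")
      case True
      then obtain B where B: "A = add_mset m B" by (metis mset_add)
      then have "sum_mset B \<le> sum_list (take i ms)" using Cons Suc by (intro Cons.IH) auto
      then show ?thesis using B Suc by simp
    next
      case False
      have sub: "A \<subseteq># mset ms"
      proof (rule mset_subset_eqI)
        fix x show "count A x \<le> count (mset ms) x"
          using mset_subset_eq_count[OF Cons.prems(2), of x] False by (cases "x = m") (auto simp: not_in_iff)
      qed
      show ?thesis
      proof (cases "A = {#}")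
        case False
        then obtain a B where B: "A = add_mset a B" by (metis multiset_cases)
        then have "a \<in> set ms" using sub by (metis in_multiset_in_set mset_subset_eqD union_single_eq_member)
        then have "a \<le> m" using Cons.prems(1) by auto
        moreover have "sum_mset B \<le> sum_list (take i ms)"
          using Cons.prems(1,3) Suc B sub by (intro Cons.IH) (auto dest: mset_subset_eq_insertD simp: subset_mset.less_imp_le)
        ultimately show ?thesis using B Suc by simp
      qed simp
    qed
  qed (use Cons.prems in auto)
qed simp

abbreviation descending :: "nat list \<Rightarrow> nat list" where
  "descending ks \<equiv> rev (sort ks)"

lemma sorted_descending: "sorted_wrt (\<ge>) (descending ks)"
  by (simp add: sorted_wrt_rev)

lemma image_mset_nth: "image_mset ((!) ks) (mset_set {..<length ks}) = mset ks"
  by (metis map_nth mset_map mset_upt atLeast0LessThan)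

lemma subset_sum_le_take:
  assumes "C \<subseteq> {..<length ks}" "card C \<le> j"
  shows "(\<Sum>i\<in>C. ks ! i) \<le> sum_list (take j (descending (filter (\<lambda>k. k > 0) ks)))"
proof -
  have fin: "finite C" using assms(1) finite_subset by blast
  let ?A = "filter_mset (\<lambda>k. k > 0) (image_mset ((!) ks) (mset_set C))"
  have "mset_set C \<subseteq># mset_set {..<length ks}" using assms(1) by (simp add: subset_imp_msubset_mset_set)
  then have "image_mset ((!) ks) (mset_set C) \<subseteq># mset ks"
    using image_mset_subseteq_mono image_mset_nth by metis
  then have "?A \<subseteq># mset (descending (filter (\<lambda>k. k > 0) ks))"
    by (simp add: multiset_filter_mono)
  moreover have "size ?A \<le> j"
    using size_filter_mset_lesseq[of "\<lambda>k. k > 0" "image_mset ((!) ks) (mset_set C)"] assms(2) by simp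
  ultimately have "sum_mset ?A \<le> sum_list (take j (descending (filter (\<lambda>k. k > 0) ks)))"
    by (intro sum_mset_le_take sorted_descending)
  moreover have "sum_mset ?A = (\<Sum>i\<in>C. ks ! i)"
  proof -
    have "sum_mset (filter_mset (\<lambda>k. k > 0) M) = sum_mset M" for M :: "nat multiset"
      by (induction M) auto
    then show ?thesis using fin by (simp add: sum_unfold_sum_mset)
  qed
  ultimately show ?thesis by simp
qed

lemma take_eq_subset_sum:
  obtains C where "C \<subseteq> {..<length ks}" "card C \<le> j" "\<And>i. i \<in> C \<Longrightarrow> ks ! i > 0"
    "(\<Sum>i\<in>C. ks ! i) = sum_list (take j (descending (filter (\<lambda>k. k > 0) ks)))"
proof -
  let ?ms = "descending (filter (\<lambda>k. k > 0) ks)"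
  have "mset ?ms = mset (take j ?ms) + mset (drop j ?ms)" by (metis append_take_drop_id mset_append)
  then have "image_mset ((!) ks) (mset_set {..<length ks})
      = mset (take j ?ms) + (mset (drop j ?ms) + filter_mset (\<lambda>k. \<not> k > 0) (mset ks))"
    unfolding image_mset_nth
    by (metis add.assoc mset_filter mset_rev mset_sort multiset_partition)
  then obtain B B' where B: "mset_set {..<length ks} = B + B'" "image_mset ((!) ks) B = mset (take j ?ms)"
    by (metis image_mset_eq_plusD)
  have "B \<subseteq># mset_set {..<length ks}" using B(1) by simp
  then have BC: "B = mset_set (set_mset B)"
  proof (intro multiset_eqI)
    fix i
    have "count B i \<le> 1"
      using mset_subset_eq_count[OF \<open>B \<subseteq># mset_set {..<length ks}\<close>, of i]
      by (cases "i < length ks") (auto simp: count_mset_set')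
    then show "count B i = count (mset_set (set_mset B)) i"
      by (cases "i \<in># B") (auto simp: not_in_iff order_antisym)
  qed
  show ?thesis
  proof (rule that[of "set_mset B"])
    show "set_mset B \<subseteq> {..<length ks}"
      by (metis B(1) Un_upper1 finite_lessThan finite_set_mset_mset_set set_mset_union)
    have "size B = length (take j ?ms)" by (metis B(2) size_image_mset size_mset)
    then show "card (set_mset B) \<le> j" by (metis BC length_take min.cobounded2 size_mset_set)
    show "ks ! i > 0" if "i \<in> set_mset B" for i
    proof -
      have "ks ! i \<in># mset (take j ?ms)" using that by (simp flip: B(2))
      then show ?thesis by (auto dest: in_set_takeD)
    qed
    have "(\<Sum>i\<in>set_mset B. ks ! i) = sum_mset (image_mset ((!) ks) B)"
      by (metis BC sum_unfold_sum_mset)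
    then show "(\<Sum>i\<in>set_mset B. ks ! i) = sum_list (take j ?ms)"
      unfolding B(2) by (simp add: sum_mset_sum_list)
  qed
qed

text \<open>The entries are differences of consecutive tail sums, and since they are positive the tail sums also
  show where the list ends.\<close>

lemma tail_sums_eq_imp_eq:
  assumes "0 \<notin> set xs" "0 \<notin> set ys" "\<And>j. sum_list (drop j xs) = sum_list (drop j (ys :: nat list))"
  shows "xs = ys"
  using assms
proof (induction xs arbitrary: ys)
  case Nil
  then show ?case using Nil.prems(3)[of 0] by (cases ys) auto
next
  case (Cons x xs)
  show ?case
  proof (cases ys)
    case Nil
    then show ?thesis using Cons.prems(1) Cons.prems(3)[of 0] by auto
  next
    case (Cons y ys')
    have tl: "sum_list (drop j xs) = sum_list (drop j ys')" for j
      using Cons.prems(3)[of "Suc j"] Cons by simp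
    then have "xs = ys'" using Cons.prems(1,2) Cons by (intro Cons.IH) auto
    then show ?thesis using Cons Cons.prems(3)[of 0] by simp
  qed
qed

lemma det_scale_rows:
  assumes G: "G \<in> carrier_mat n n"
  shows "det (mat n n (\<lambda>(i, j). d i * G $$ (i, j))) = (\<Prod>i<n. d i) * det (G :: 'a :: comm_ring_1 mat)"
proof -
  have "mat n n (\<lambda>(i, j). d i * G $$ (i, j)) = mat\<^sub>r n n (\<lambda>i. d i \<cdot>\<^sub>v row G i)"
    using G by (intro eq_matI) auto
  moreover have "mat\<^sub>r n n (row G) = G" using G by (intro eq_matI) auto
  ultimately show ?thesis
    using det_rows_mul[of "row G" n d] G by (simp add: atLeast0LessThan Pi_def)
qed

text \<open>Smith form at the point \<open>z\<close>: up to factors \<open>T\<close> and \<open>G\<close> invertible at \<open>z\<close>, the matrix is the diagonal of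
  the powers \<open>(x - z)\<^sup>k\<close>. The list contains the zero exponents too and is in no particular order.\<close>

definition local_smith :: "complex poly mat \<Rightarrow> complex \<Rightarrow> nat list \<Rightarrow> bool" where
  "local_smith W z ks \<longleftrightarrow> (let n = length ks in W \<in> carrier_mat n n \<and>
     (\<exists>T \<in> carrier_mat n n. \<exists>G \<in> carrier_mat n n. poly (det T) z \<noteq> 0 \<and> poly (det G) z \<noteq> 0 \<and>
        T * W = mat n n (\<lambda>(i, j). [:- z, 1:] ^ (ks ! i) * G $$ (i, j))))"

lemma local_smithI:
  assumes "W \<in> carrier_mat n n" "T \<in> carrier_mat n n" "G \<in> carrier_mat n n" "length ks = n"
    "poly (det T) z \<noteq> 0" "poly (det G) z \<noteq> 0"
    "T * W = mat n n (\<lambda>(i, j). [:- z, 1:] ^ (ks ! i) * G $$ (i, j))"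
  shows "local_smith W z ks"
  unfolding local_smith_def Let_def using assms by blast

lemma local_smithE:
  assumes "local_smith W z ks"
  obtains n T G where "length ks = n" "W \<in> carrier_mat n n" "T \<in> carrier_mat n n" "G \<in> carrier_mat n n"
    "poly (det T) z \<noteq> 0" "poly (det G) z \<noteq> 0"
    "T * W = mat n n (\<lambda>(i, j). [:- z, 1:] ^ (ks ! i) * G $$ (i, j))"
  using assms unfolding local_smith_def Let_def by blast

lemma local_smith_det_nonzero:
  assumes "local_smith W z ks"
  shows "det W \<noteq> 0"
proof -
  obtain n T G where *: "length ks = n" "W \<in> carrier_mat n n" "T \<in> carrier_mat n n" "G \<in> carrier_mat n n"
    "poly (det T) z \<noteq> 0" "poly (det G) z \<noteq> 0"
    "T * W = mat n n (\<lambda>(i, j). [:- z, 1:] ^ (ks ! i) * G $$ (i, j))"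
    by (rule local_smithE[OF assms])
  have "det T * det W = (\<Prod>i<n. [:- z, 1:] ^ (ks ! i)) * det G"
    unfolding det_mult[OF *(3,2), symmetric] *(7) by (rule det_scale_rows[OF *(4)])
  moreover have "det G \<noteq> 0" using *(6) by auto
  ultimately show ?thesis by auto
qed

lemma sum_diff_take:
  assumes "finite A" "C \<subseteq> A"
  shows "(\<Sum>i\<in>A - C. k i) = (\<Sum>i\<in>A. k i) - (\<Sum>i\<in>C. (k i :: nat))"
  using sum_diff_nat[of C A k] assms finite_subset by blast

text \<open>The lower bound is \<open>dvd_det_rank_update\<close>. It is attained by adding \<open>det T\<close> to the diagonal entries with
  the \<open>j\<close> largest exponents, which makes these entries nonzero at \<open>z\<close>; the factor \<open>det T\<close> allows this
  perturbation of the diagonal form to be pulled back to \<open>W\<close> through the adjugate of \<open>T\<close>.\<close>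

lemma rank_order_local_smith:
  assumes "local_smith W z ks"
  shows "rank_order W z j = sum_list (drop j (descending (filter (\<lambda>k. k > 0) ks)))"
proof -
  let ?ms = "descending (filter (\<lambda>k. k > 0) ks)" and ?p = "[:- z, 1:]"
  obtain n T G where len: "length ks = n" and W: "W \<in> carrier_mat n n" and T: "T \<in> carrier_mat n n"
    and G: "G \<in> carrier_mat n n" and T0: "poly (det T) z \<noteq> 0" and G0: "poly (det G) z \<noteq> 0"
    and TW: "T * W = mat n n (\<lambda>(i, j). ?p ^ (ks ! i) * G $$ (i, j))"
    by (rule local_smithE[OF assms])
  have det0: "det W \<noteq> 0" by (rule local_smith_det_nonzero[OF assms])
  have det_nz: "det T \<noteq> 0" "det G \<noteq> 0" using T0 G0 by auto
  have sum_pos: "sum_list (filter (\<lambda>k. k > 0) ks) = sum_list ks" for ks :: "nat list"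
    by (induction ks) auto
  have "sum_list (take j ?ms) + sum_list (drop j ?ms) = sum_list ?ms"
    by (metis append_take_drop_id sum_list_append)
  also have "\<dots> = sum_list (filter (\<lambda>k. k > 0) ks)"
    by (metis mset_rev mset_sort sum_mset_sum_list)
  also have "\<dots> = (\<Sum>i<n. ks ! i)"
    unfolding sum_pos using len by (simp add: sum_list_sum_nth atLeast0LessThan)
  finally have total: "sum_list (drop j ?ms) = (\<Sum>i<n. ks ! i) - sum_list (take j ?ms)" by simp
  show ?thesis
  proof (rule antisym)
    obtain X Y where X: "X \<in> carrier_mat n j" and Y: "Y \<in> carrier_mat j n"
      and d: "det (W + X * Y) \<noteq> 0" and ord: "Polynomial.order z (det (W + X * Y)) = rank_order W z j"
      by (rule rank_order_attained[OF W det0])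
    have "?p ^ sum_list (drop j ?ms) dvd det (mat n n (\<lambda>(i, k). ?p ^ (ks ! i) * G $$ (i, k)) + T * X * Y)"
    proof (rule dvd_det_rank_update[OF G _ Y])
      fix C assume C: "C \<subseteq> {..<n}" "card C \<le> j"
      then have "(\<Sum>i\<in>C. ks ! i) \<le> sum_list (take j ?ms)" using subset_sum_le_take len by blast
      then show "sum_list (drop j ?ms) \<le> (\<Sum>i\<in>{..<n} - C. ks ! i)"
        using C by (simp add: total sum_diff_take)
    qed (use T X in auto)
    also have "mat n n (\<lambda>(i, k). ?p ^ (ks ! i) * G $$ (i, k)) + T * X * Y = T * (W + X * Y)"
      using T W X Y by (simp add: TW[symmetric] mult_add_distrib_mat[of _ n n] assoc_mult_mat[of _ n n])
    also have "det (T * (W + X * Y)) = det T * det (W + X * Y)"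
      by (rule det_mult[OF T]) (use W X Y in auto)
    finally have "sum_list (drop j ?ms) \<le> Polynomial.order z (det T * det (W + X * Y))"
      using d det_nz by (simp add: order_divides)
    also have "\<dots> = rank_order W z j"
      using d det_nz T0 ord by (simp add: order_mult order_0I)
    finally show "sum_list (drop j ?ms) \<le> rank_order W z j" .
  next
    obtain C where C: "C \<subseteq> {..<length ks}" "card C \<le> j" and pos: "\<And>i. i \<in> C \<Longrightarrow> ks ! i > 0"
      and sumC: "(\<Sum>i\<in>C. ks ! i) = sum_list (take j ?ms)"
      by (rule take_eq_subset_sum[of ks j]) blast
    have fin: "finite C" using C(1) finite_subset by blast
    define cs where "cs = sorted_list_of_set C"
    define c where "c = card C"
    have cs: "set cs = C" "distinct cs" "length cs = c" unfolding cs_def c_def using fin by auto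
    let ?X = "mat n c (\<lambda>(i, l). if cs ! l = i then 1 else 0) :: complex poly mat"
    let ?Y = "mat c n (\<lambda>(l, i). if cs ! l = i then 1 else 0) :: complex poly mat"
    let ?I = "mat n n (\<lambda>(a, b). if a = b \<and> a \<in> C then 1 else 0) :: complex poly mat"
    have XY: "?X * ?Y = ?I"
    proof (rule eq_matI)
      fix a b assume "a < dim_row ?I" "b < dim_col ?I"
      then have ab: "a < n" "b < n" by auto
      have "(?X * ?Y) $$ (a, b)
          = (\<Sum>l<length cs. (\<lambda>x. if x = a \<and> a = b then 1 else 0) (cs ! l))"
        using ab cs(3) by (auto simp: scalar_prod_def atLeast0LessThan intro!: sum.cong)
      also have "\<dots> = (\<Sum>x\<in>C. if x = a \<and> a = b then 1 else 0)"
        unfolding cs(1)[symmetric] sum.distinct_set_conv_list[OF cs(2)]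
        by (simp add: sum_list_sum_nth atLeast0LessThan)
      also have "\<dots> = ?I $$ (a, b)" using ab fin by (cases "a = b") auto
      finally show "(?X * ?Y) $$ (a, b) = ?I $$ (a, b)" .
    qed auto
    define X where "X = adj_mat T * ?X"
    define Y where "Y = ?Y * G"
    have X: "X \<in> carrier_mat n c" and Y: "Y \<in> carrier_mat c n"
      using adj_mat(1)[OF T] G by (auto simp: X_def Y_def)
    define d where "d i = ?p ^ (ks ! i) + (if i \<in> C then det T else 0)" for i
    have I: "?I * G \<in> carrier_mat n n" by (rule mult_carrier_mat[OF _ G]) simp
    have "X * Y = adj_mat T * (?X * (?Y * G))"
      unfolding X_def Y_def by (rule assoc_mult_mat[OF adj_mat(1)[OF T]]) (use G in auto)
    also have "?X * (?Y * G) = ?I * G"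
      unfolding XY[symmetric] by (rule assoc_mult_mat[symmetric]) (use G in auto)
    finally have "T * (X * Y) = T * adj_mat T * (?I * G)"
      using assoc_mult_mat[OF T adj_mat(1)[OF T] I] by simp
    then have TXY: "T * (X * Y) = det T \<cdot>\<^sub>m (?I * G)"
      unfolding adj_mat(2)[OF T] using mult_smult_assoc_mat[OF one_carrier_mat I] left_mult_one_mat[OF I] by simp
    have IG: "(?I * G) $$ (a, b) = (if a \<in> C then G $$ (a, b) else 0)" if "a < n" "b < n" for a b
    proof -
      have "(?I * G) $$ (a, b) = (\<Sum>l<n. if l = a then if a \<in> C then G $$ (l, b) else 0 else 0)"
        using that G
        by (simp add: scalar_prod_def atLeast0LessThan del: sum.delta sum.delta')
          (intro sum.cong refl, auto)
      then show ?thesis using that by simp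
    qed
    have "T * (W + X * Y) = T * W + T * (X * Y)"
      using T W X Y by (simp add: mult_add_distrib_mat[of _ n n])
    also have "\<dots> = mat n n (\<lambda>(i, k). d i * G $$ (i, k))"
      unfolding TW TXY using IG G by (intro eq_matI) (auto simp: d_def algebra_simps)
    finally have "det T * det (W + X * Y) = (\<Prod>i<n. d i) * det G"
      using det_mult[OF T, of "W + X * Y"] det_scale_rows[OF G] W X Y by simp
    moreover have d0: "d i \<noteq> 0" and ord_d: "Polynomial.order z (d i) = (if i \<in> C then 0 else ks ! i)" for i
    proof -
      show "d i \<noteq> 0"
      proof (cases "i \<in> C")
        case True
        then have "poly (d i) z \<noteq> 0" using T0 pos[of i] by (simp add: d_def zero_power)
        then show ?thesis by auto
      qed (simp add: d_def)
      show "Polynomial.order z (d i) = (if i \<in> C then 0 else ks ! i)"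
        using T0 pos[of i] by (auto simp: d_def order_power_n_n zero_power intro!: order_0I)
    qed
    ultimately have nz: "det (W + X * Y) \<noteq> 0" using det_nz by auto
    have ord_prod: "Polynomial.order z (\<Prod>i\<in>I. d i) = (\<Sum>i\<in>I. Polynomial.order z (d i))" if "finite I" for I
      using that d0 by (induction I rule: finite_induct) (auto simp: order_mult)
    have "Polynomial.order z (det T * det (W + X * Y)) = Polynomial.order z ((\<Prod>i<n. d i) * det G)"
      using \<open>det T * det (W + X * Y) = _\<close> by simp
    then have "Polynomial.order z (det (W + X * Y)) = (\<Sum>i<n. Polynomial.order z (d i))"
      using nz det_nz d0 T0 G0 ord_prod[of "{..<n}"] by (simp add: order_mult order_0I)
    also have "\<dots> = (\<Sum>i\<in>{..<n} - C. ks ! i)"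
      unfolding ord_d by (simp add: sum.If_cases Diff_eq)
    also have "\<dots> = sum_list (drop j ?ms)" using C len by (simp add: total sum_diff_take sumC)
    finally have "rank_order W z c \<le> sum_list (drop j ?ms)" using rank_order_le[OF W X Y nz, of z] by simp
    moreover have "rank_order W z j \<le> rank_order W z c"
      using rank_order_antimono[OF W det0] C(2) c_def by blast
    ultimately show "rank_order W z j \<le> sum_list (drop j ?ms)" by simp
  qed
qed

lemma local_smith_unit:
  assumes "W \<in> carrier_mat n n" "poly (det W) z \<noteq> 0"
  shows "local_smith W z (replicate n 0)"
  by (rule local_smithI[of _ n "1\<^sub>m n" W]) (use assms in \<open>auto intro!: eq_matI\<close>)

lemma local_smith_diag:
  assumes "local_smith W1 z ks1" "local_smith W2 z ks2"
  shows "local_smith (four_block_mat W1 (0\<^sub>m (length ks1) (length ks2)) (0\<^sub>m (length ks2) (length ks1)) W2)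
    z (ks1 @ ks2)"
proof -
  obtain n T1 G1 where 1: "length ks1 = n" "W1 \<in> carrier_mat n n" "T1 \<in> carrier_mat n n" "G1 \<in> carrier_mat n n"
    "poly (det T1) z \<noteq> 0" "poly (det G1) z \<noteq> 0"
    "T1 * W1 = mat n n (\<lambda>(i, j). [:- z, 1:] ^ (ks1 ! i) * G1 $$ (i, j))"
    by (rule local_smithE[OF assms(1)])
  obtain m T2 G2 where 2: "length ks2 = m" "W2 \<in> carrier_mat m m" "T2 \<in> carrier_mat m m" "G2 \<in> carrier_mat m m"
    "poly (det T2) z \<noteq> 0" "poly (det G2) z \<noteq> 0"
    "T2 * W2 = mat m m (\<lambda>(i, j). [:- z, 1:] ^ (ks2 ! i) * G2 $$ (i, j))"
    by (rule local_smithE[OF assms(2)])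
  let ?D = "\<lambda>A B. four_block_mat A (0\<^sub>m n m) (0\<^sub>m m n) B :: complex poly mat"
  have det: "det (?D A B) = det A * det B" if "A \<in> carrier_mat n n" "B \<in> carrier_mat m m" for A B
    by (rule det_four_block_mat_lower_left_zero[OF that(1) _ refl that(2)]) simp
  have "?D T1 T2 * ?D W1 W2 = ?D (T1 * W1) (T2 * W2)"
    using 1 2 by (subst mult_four_block_mat) auto
  also have "\<dots> = mat (n + m) (n + m) (\<lambda>(i, j). [:- z, 1:] ^ ((ks1 @ ks2) ! i) * ?D G1 G2 $$ (i, j))"
    unfolding 1(7) 2(7) using 1 2 by (intro eq_matI) (auto simp: nth_append)
  finally show ?thesis
    unfolding 1(1) 2(1) using 1 2
    by (intro local_smithI[of _ "n + m" "?D T1 T2" "?D G1 G2"]) (auto simp: det)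
qed

text \<open>Moving \<open>Q\<close> to the right-hand side with its adjugate instead of its inverse keeps all entries polynomial,
  at the price of the factor \<open>det Q\<close>, which does not vanish at \<open>z\<close>.\<close>

lemma local_smith_equivalent:
  assumes P: "P \<in> carrier_mat n n" "poly (det P) z \<noteq> 0" and Q: "Q \<in> carrier_mat n n" "poly (det Q) z \<noteq> 0"
    and W: "W \<in> carrier_mat n n" and PWQ: "local_smith (P * W * Q) z ks"
  shows "local_smith W z ks"
proof -
  obtain m T G where *: "length ks = m" "P * W * Q \<in> carrier_mat m m" "T \<in> carrier_mat m m" "G \<in> carrier_mat m m"
    "poly (det T) z \<noteq> 0" "poly (det G) z \<noteq> 0"
    "T * (P * W * Q) = mat m m (\<lambda>(i, j). [:- z, 1:] ^ (ks ! i) * G $$ (i, j))"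
    by (rule local_smithE[OF PWQ])
  have "m = n" using *(2) P Q W by auto
  note * = *[unfolded this]
  define A where "A = adj_mat Q"
  have A: "A \<in> carrier_mat n n" and QA: "Q * A = det Q \<cdot>\<^sub>m 1\<^sub>m n"
    using adj_mat[OF Q(1)] unfolding A_def by auto
  have "det Q * det A = det Q ^ n"
    using det_mult[OF Q(1) A] Q(1) by (simp add: QA)
  then have A0: "poly (det A) z \<noteq> 0"
    using Q(2) by (metis mult_eq_0_iff poly_mult poly_power power_eq_0_iff)
  define D where "D = mat n n (\<lambda>(i, j). if i = j then [:- z, 1:] ^ (ks ! i) else 0)"
  have scale: "mat n n (\<lambda>(i, j). [:- z, 1:] ^ (ks ! i) * M $$ (i, j)) = D * M" if "M \<in> carrier_mat n n" for M
  proof (rule eq_matI)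
    fix i j assume ij: "i < dim_row (D * M)" "j < dim_col (D * M)"
    then have ij': "i < n" "j < n" using that by (auto simp: D_def)
    have "(D * M) $$ (i, j) = (\<Sum>l<n. if l = i then [:- z, 1:] ^ (ks ! i) * M $$ (l, j) else 0)"
      using ij' that unfolding D_def
      by (simp add: scalar_prod_def atLeast0LessThan del: sum.delta sum.delta')
        (intro sum.cong refl, auto)
    then show "mat n n (\<lambda>(i, j). [:- z, 1:] ^ (ks ! i) * M $$ (i, j)) $$ (i, j) = (D * M) $$ (i, j)"
      using ij' by simp
  qed (use that in \<open>auto simp: D_def\<close>)
  have D: "D \<in> carrier_mat n n" by (simp add: D_def)
  let ?T = "det Q \<cdot>\<^sub>m (T * P)" and ?G = "G * A"
  have TP: "T * P \<in> carrier_mat n n" "T * P * W \<in> carrier_mat n n" using * P W by auto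
  have PW: "P * W \<in> carrier_mat n n" using P W by auto
  have "?T * W = det Q \<cdot>\<^sub>m (T * P * W)" using TP W by (simp add: mult_smult_assoc_mat[of _ n n])
  also have "\<dots> = T * P * W * (Q * A)"
    unfolding QA mult_smult_distrib[OF TP(2) one_carrier_mat] right_mult_one_mat[OF TP(2)] ..
  also have "\<dots> = T * P * W * Q * A" by (rule assoc_mult_mat[OF TP(2) Q(1) A, symmetric])
  also have "T * P * W * Q = T * (P * W * Q)"
    unfolding assoc_mult_mat[OF *(3) P(1) W] by (rule assoc_mult_mat[OF *(3) PW Q(1)])
  also have "\<dots> * A = D * ?G" unfolding *(7) scale[OF *(4)] by (rule assoc_mult_mat[OF D *(4) A])
  finally have "?T * W = mat n n (\<lambda>(i, j). [:- z, 1:] ^ (ks ! i) * ?G $$ (i, j))"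
    using *(4) A by (simp add: scale)
  moreover have "poly (det ?T) z \<noteq> 0"
    using TP(1) * P Q by (simp add: det_mult[of _ n])
  moreover have "poly (det ?G) z \<noteq> 0" using * A A0 by (simp add: det_mult[of _ n])
  ultimately show ?thesis
    using * TP A W by (intro local_smithI[of _ n ?T ?G]) auto
qed

text \<open>Combining the rows with the coefficients \<open>(x - z)\<^sup>k\<^sup>-\<^sup>1, \<dots>, 1\<close> telescopes to \<open>(x - z)\<^sup>k\<close> in the first column,
  so one row operation suffices. That \<open>G\<close> has determinant \<open>1\<close> follows by comparing determinants.\<close>

lemma local_smith_jordan_block:
  fixes z :: complex
  assumes "k > 0"
  defines "W \<equiv> mat k k (\<lambda>(i, j). if i = j then [:- z, 1:] else if Suc i = j then - 1 else 0)"
  shows "local_smith W z (replicate (k - 1) 0 @ [k])"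
proof -
  let ?p = "[:- z, 1:]"
  define T :: "complex poly mat" where
    "T = mat k k (\<lambda>(i, j). if i = k - 1 then ?p ^ (k - 1 - j) else if i = j then 1 else 0)"
  define G where "G = mat k k (\<lambda>(i, j). if i = k - 1 then if j = 0 then 1 else 0 else W $$ (i, j))"
  have c: "T \<in> carrier_mat k k" "G \<in> carrier_mat k k" "W \<in> carrier_mat k k"
    by (auto simp: T_def G_def W_def)
  have ks: "(replicate (k - 1) 0 @ [k]) ! i = (if i = k - 1 then k else 0)" if "i < k" for i
    using that by (auto simp: nth_append)
  have TW: "T * W = mat k k (\<lambda>(i, j). ?p ^ ((replicate (k - 1) 0 @ [k]) ! i) * G $$ (i, j))"
  proof (rule eq_matI)
    fix i j
    assume "i < dim_row (mat k k (\<lambda>(i, j). ?p ^ ((replicate (k - 1) 0 @ [k]) ! i) * G $$ (i, j)))"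
      "j < dim_col (mat k k (\<lambda>(i, j). ?p ^ ((replicate (k - 1) 0 @ [k]) ! i) * G $$ (i, j)))"
    then have ij: "i < k" "j < k" by auto
    have sum: "(T * W) $$ (i, j) = (\<Sum>l<k. T $$ (i, l) * W $$ (l, j))"
      using ij c by (simp add: scalar_prod_def atLeast0LessThan)
    show "(T * W) $$ (i, j)
        = mat k k (\<lambda>(i, j). ?p ^ ((replicate (k - 1) 0 @ [k]) ! i) * G $$ (i, j)) $$ (i, j)"
    proof (cases "i = k - 1")
      case False
      have "(\<Sum>l<k. T $$ (i, l) * W $$ (l, j)) = (\<Sum>l<k. if l = i then W $$ (i, j) else 0)"
        using False ij by (intro sum.cong refl) (auto simp: T_def)
      then show ?thesis using False ij ks by (simp add: sum G_def)
    next
      case True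
      have "(\<Sum>l<k. T $$ (i, l) * W $$ (l, j))
          = (\<Sum>l<k. (if l = j then ?p ^ (k - 1 - j) * ?p else 0) + (if Suc l = j then - (?p ^ (k - 1 - l)) else 0))"
        using True ij by (intro sum.cong refl) (auto simp: T_def W_def)
      also have "\<dots> = ?p ^ (k - 1 - j) * ?p + (\<Sum>l<k. if Suc l = j then - (?p ^ (k - 1 - l)) else 0)"
        using ij by (simp add: sum.distrib)
      also have "(\<Sum>l<k. if Suc l = j then - (?p ^ (k - 1 - l)) else 0) = (if j = 0 then 0 else - (?p ^ (k - j)))"
        using ij by (cases j) auto
      also have "?p ^ (k - 1 - j) * ?p = ?p ^ (k - j)"
        using ij by (metis Suc_diff_Suc diff_Suc_eq_diff_pred power_Suc2)
      finally show ?thesis using True ij ks[OF ij(1)] sum by (cases "j = 0") (simp_all add: G_def del: One_nat_def)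
    qed
  qed (use c in auto)
  have "det T = prod_list (diag_mat T)"
    by (rule det_lower_triangular[OF _ c(1)]) (auto simp: T_def)
  also have "diag_mat T = replicate k 1"
    using c(1) by (intro nth_equalityI) (auto simp: diag_mat_def T_def)
  finally have T1: "det T = 1" by simp
  have "det W = prod_list (diag_mat W)"
    by (rule det_upper_triangular[OF _ c(3)]) (auto simp: W_def upper_triangular_def)
  also have "diag_mat W = replicate k ?p"
    using c(3) by (intro nth_equalityI) (auto simp: diag_mat_def W_def)
  finally have W1: "det W = ?p ^ k" by simp
  have "(\<Prod>i<k. ?p ^ ((replicate (k - 1) 0 @ [k]) ! i)) = (\<Prod>i<k. if i = k - 1 then ?p ^ k else 1)"
    by (rule prod.cong) (auto simp: ks simp del: One_nat_def)
  also have "\<dots> = ?p ^ k" using assms(1) by simp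
  finally have "?p ^ k * 1 = ?p ^ k * det G"
    using det_mult[OF c(1,3)] unfolding TW det_scale_rows[OF c(2)] T1 W1 by simp
  then have "det G = 1" by (metis mult_cancel_left pCons_eq_0_iff power_not_zero zero_neq_one)
  then show ?thesis using T1 c TW assms(1) by (intro local_smithI[of _ k T G]) auto
qed

section \<open>Partial multiplicities of a Weierstrass form\<close>

definition pencil_mat :: "pencil \<Rightarrow> complex poly mat" where
  "pencil_mat L = mat (dim_row (fst L)) (dim_col (fst L)) (\<lambda>ij. [:fst L $$ ij, snd L $$ ij:])"

abbreviation const_mat :: "complex mat \<Rightarrow> complex poly mat" where
  "const_mat \<equiv> map_mat (\<lambda>a. [:a:])"

lemma pencil_mat_carrier: "L \<in> carrier_pencil n \<Longrightarrow> pencil_mat L \<in> carrier_mat n n"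
  by (auto simp: pencil_mat_def carrier_pencil_def)

lemma pencil_mat_index:
  "L \<in> carrier_pencil n \<Longrightarrow> i < n \<Longrightarrow> j < n \<Longrightarrow> pencil_mat L $$ (i, j) = [:fst L $$ (i, j), snd L $$ (i, j):]"
  by (auto simp: pencil_mat_def carrier_pencil_def)

lemma add_carrier_pencil: "L \<in> carrier_pencil n \<Longrightarrow> E \<in> carrier_pencil n \<Longrightarrow> L + E \<in> carrier_pencil n"
  by (auto simp: carrier_pencil_def plus_prod_def)

lemma pencil_mat_add:
  assumes "L \<in> carrier_pencil n" "E \<in> carrier_pencil n"
  shows "pencil_mat (L + E) = pencil_mat L + pencil_mat E"
  by (rule eq_matI) (use assms in \<open>auto simp: pencil_mat_def carrier_pencil_def\<close>)

lemma rev_pencil_carrier: "L \<in> carrier_pencil n \<Longrightarrow> rev_pencil L \<in> carrier_pencil n"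
  by (cases L) (auto simp: carrier_pencil_def)

lemma poly_det_pencil_mat:
  assumes "L \<in> carrier_pencil n"
  shows "poly (det (pencil_mat L)) z = det (pencil_at L z)"
proof -
  have ev: "comm_ring_hom (\<lambda>p :: complex poly. poly p z)" by (unfold_locales) auto
  obtain A B where L: "L = (A, B)" by (cases L)
  have "map_mat (\<lambda>p. poly p z) (pencil_mat L) = pencil_at L z"
    by (rule eq_matI) (use assms in \<open>auto simp: L pencil_mat_def carrier_pencil_def\<close>)
  then show ?thesis using comm_ring_hom.hom_det[OF ev, of "pencil_mat L"] by simp
qed

lemma regular_pencil_iff: "L \<in> carrier_pencil n \<Longrightarrow> regular_pencil L \<longleftrightarrow> det (pencil_mat L) \<noteq> 0"
  unfolding regular_pencil_def poly_det_pencil_mat[symmetric] using poly_all_0_iff_0 by blast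

lemma pencil_eigenvalue_Fin_iff:
  "L \<in> carrier_pencil n \<Longrightarrow> pencil_eigenvalue L (Fin z) \<longleftrightarrow> poly (det (pencil_mat L)) z = 0"
  by (simp add: poly_det_pencil_mat)

lemma pencil_eigenvalue_Infty_iff:
  "L \<in> carrier_pencil n \<Longrightarrow> pencil_eigenvalue L Infty \<longleftrightarrow> poly (det (pencil_mat (rev_pencil L))) 0 = 0"
  by (simp add: poly_det_pencil_mat[OF rev_pencil_carrier])

lemma det_const_mat: "det (const_mat P) = [:det P:]"
proof -
  have hom: "comm_ring_hom (\<lambda>a :: complex. [:a:])" by (unfold_locales) (auto simp: one_pCons)
  show ?thesis by (rule comm_ring_hom.hom_det[OF hom])
qed

lemma pencil_mat_equivalence:
  assumes P: "P \<in> carrier_mat n n" and Q: "Q \<in> carrier_mat n n" and A: "A \<in> carrier_mat n n" and B: "B \<in> carrier_mat n n"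
  shows "pencil_mat (P * A * Q, P * B * Q) = const_mat P * pencil_mat (A, B) * const_mat Q"
proof -
  have hom: "semiring_hom (\<lambda>a :: complex. [:a:])" by (unfold_locales) (auto simp: one_pCons)
  have split: "pencil_mat (A, B) = const_mat A + [:0, 1:] \<cdot>\<^sub>m const_mat B"
    if "A \<in> carrier_mat n n" "B \<in> carrier_mat n n" for A B
    using that by (intro eq_matI) (auto simp: pencil_mat_def)
  have hom_mult: "const_mat (P * A * Q) = const_mat P * const_mat A * const_mat Q" if A: "A \<in> carrier_mat n n" for A
  proof -
    have PA: "P * A \<in> carrier_mat n n" using P A by simp
    show ?thesis unfolding semiring_hom.mat_hom_mult[OF hom PA Q] semiring_hom.mat_hom_mult[OF hom P A] ..
  qed
  let ?P = "const_mat P" and ?Q = "const_mat Q" and ?A = "const_mat A" and ?B = "const_mat B"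
  have c: "?P \<in> carrier_mat n n" "?Q \<in> carrier_mat n n" "?A \<in> carrier_mat n n" "?B \<in> carrier_mat n n"
    using assms by auto
  have xB: "[:0, 1:] \<cdot>\<^sub>m ?B \<in> carrier_mat n n" using c by simp
  have PA: "?P * ?A \<in> carrier_mat n n" "?P * ?B \<in> carrier_mat n n" using c by (meson mult_carrier_mat)+
  have "?P * (?A + [:0, 1:] \<cdot>\<^sub>m ?B) * ?Q = (?P * ?A + [:0, 1:] \<cdot>\<^sub>m (?P * ?B)) * ?Q"
    unfolding mult_add_distrib_mat[OF c(1,3) xB] mult_smult_distrib[OF c(1,4)] ..
  also have "\<dots> = ?P * ?A * ?Q + [:0, 1:] \<cdot>\<^sub>m (?P * ?B * ?Q)"
    using PA c by (subst add_mult_distrib_mat[of _ n n]) (auto simp: mult_smult_assoc_mat[of _ n n])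
  finally have "?P * (?A + [:0, 1:] \<cdot>\<^sub>m ?B) * ?Q = ?P * ?A * ?Q + [:0, 1:] \<cdot>\<^sub>m (?P * ?B * ?Q)" .
  moreover have "P * A * Q \<in> carrier_mat n n" "P * B * Q \<in> carrier_mat n n" using assms by simp_all
  ultimately show ?thesis unfolding split[OF A B] by (simp only: split hom_mult[OF A] hom_mult[OF B])
qed

lemma local_smith_jordan_matrix:
  assumes "0 \<notin> fst ` set fs"
  shows "\<exists>ks. local_smith (pencil_mat (- jordan_matrix fs, 1\<^sub>m (sum_list (map fst fs)))) z ks \<and>
    length ks = sum_list (map fst fs) \<and>
    filter (\<lambda>k. k > 0) ks = map fst (filter (\<lambda>(k, a). a = z) fs)"
  using assms
proof (induction fs)
  case Nil
  have "local_smith (pencil_mat (- jordan_matrix [], 1\<^sub>m 0)) z (replicate 0 0)"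
    by (rule local_smith_unit) (auto simp: pencil_mat_def)
  then show ?case by auto
next
  case (Cons ka fs)
  obtain k a where ka: "ka = (k, a)" by fastforce
  have k: "k > 0" using Cons.prems ka by auto
  define m where "m = sum_list (map fst fs)"
  obtain ks where ks: "local_smith (pencil_mat (- jordan_matrix fs, 1\<^sub>m m)) z ks" "length ks = m"
    "filter (\<lambda>k. k > 0) ks = map fst (filter (\<lambda>(k, a). a = z) fs)"
    using Cons unfolding m_def by auto
  define B where "B = mat k k (\<lambda>(i, j). if i = j then [:- a, 1:] else if Suc i = j then - 1 else 0)"
  have "\<exists>ks. local_smith B z ks \<and> length ks = k \<and> filter (\<lambda>k. k > 0) ks = (if a = z then [k] else [])"
  proof (cases "a = z")
    case True
    then show ?thesis
      using local_smith_jordan_block[OF k, of z] k unfolding B_def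
      by (intro exI[of _ "replicate (k - 1) 0 @ [k]"]) auto
  next
    case False
    have B: "B \<in> carrier_mat k k" by (simp add: B_def)
    have "det B = prod_list (diag_mat B)"
      by (rule det_upper_triangular[OF _ B]) (auto simp: B_def upper_triangular_def)
    also have "diag_mat B = replicate k [:- a, 1:]"
      by (intro nth_equalityI) (auto simp: diag_mat_def B_def)
    finally have "poly (det B) z \<noteq> 0" using False by simp
    then show ?thesis
      using local_smith_unit[OF B] False by (intro exI[of _ "replicate k 0"]) auto
  qed
  then obtain ks1 where ks1: "local_smith B z ks1" "length ks1 = k"
    "filter (\<lambda>k. k > 0) ks1 = (if a = z then [k] else [])" by blast
  have "pencil_mat (- jordan_matrix (ka # fs), 1\<^sub>m (sum_list (map fst (ka # fs))))
      = four_block_mat B (0\<^sub>m k m) (0\<^sub>m m k) (pencil_mat (- jordan_matrix fs, 1\<^sub>m m))"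
    unfolding ka jordan_matrix_Cons
    by (rule eq_matI) (auto simp: pencil_mat_def B_def m_def)
  then show ?case
    using local_smith_diag[OF ks1(1) ks(1)] ks1 ks ka
    by (intro exI[of _ "ks1 @ ks"]) (auto simp: m_def)
qed

text \<open>The determinant of \<open>x N - I\<close> is \<open>1\<close> up to sign, so this part is invisible at finite points.\<close>

lemma local_smith_infinite_part:
  "local_smith (pencil_mat (- 1\<^sub>m (sum_list ns), jordan_matrix (map (\<lambda>k. (k, 0)) ns))) z
    (replicate (sum_list ns) 0)"
proof (induction ns)
  case Nil
  have "local_smith (pencil_mat (- 1\<^sub>m 0, jordan_matrix [])) z (replicate 0 0)"
    by (rule local_smith_unit) (auto simp: pencil_mat_def)
  then show ?case by simp
next
  case (Cons k ns)
  define m where "m = sum_list ns"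
  define B :: "complex poly mat" where
    "B = mat k k (\<lambda>(i, j). if i = j then - 1 else if Suc i = j then [:0, 1:] else 0)"
  have B: "B \<in> carrier_mat k k" by (simp add: B_def)
  have "det B = prod_list (diag_mat B)"
    by (rule det_upper_triangular[OF _ B]) (auto simp: B_def upper_triangular_def)
  also have "diag_mat B = replicate k (- 1)"
    by (intro nth_equalityI) (auto simp: diag_mat_def B_def)
  finally have "poly (det B) z \<noteq> 0" by simp
  then have "local_smith B z (replicate k 0)" by (rule local_smith_unit[OF B])
  moreover have "local_smith (pencil_mat (- 1\<^sub>m m, jordan_matrix (map (\<lambda>k. (k, 0)) ns))) z (replicate m 0)"
    using Cons unfolding m_def by simp
  moreover have dim: "sum_list (map (fst \<circ> (\<lambda>k. (k, 0 :: complex))) ns) = m"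
    unfolding m_def by (induction ns) auto
  have "pencil_mat (- 1\<^sub>m (sum_list (k # ns)), jordan_matrix (map (\<lambda>k. (k, 0)) (k # ns)))
      = four_block_mat B (0\<^sub>m k m) (0\<^sub>m m k)
          (pencil_mat (- 1\<^sub>m m, jordan_matrix (map (\<lambda>k. (k, 0)) ns)))"
    unfolding list.map jordan_matrix_Cons
    by (rule eq_matI) (auto simp: pencil_mat_def B_def m_def[symmetric] dim one_pCons)
  ultimately show ?case
    using local_smith_diag[of B z "replicate k 0" _ "replicate m 0"]
    by (simp add: replicate_add m_def)
qed

lemma invertible_mat_det_nonzero:
  assumes "P \<in> carrier_mat n n" "invertible_mat P"
  shows "det (P :: complex mat) \<noteq> 0"
proof -
  obtain R where R: "P * R = 1\<^sub>m n" "R * P = 1\<^sub>m (dim_row R)"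
    using assms unfolding invertible_mat_def inverts_mat_def by auto
  have "R \<in> carrier_mat n n"
    using arg_cong[OF R(1), of dim_col] arg_cong[OF R(2), of dim_col] assms(1) by auto
  then show ?thesis using det_mult[OF assms(1), of R] R(1) by auto
qed

text \<open>Since the left-hand side does not mention the canonical form, this also shows that the partial
  multiplicities are well defined.\<close>

theorem rank_order_weierstrass:
  assumes form: "weierstrass_form L fs ns"
  shows "rank_order (pencil_mat L) z j
    = sum_list (drop j (descending (map fst (filter (\<lambda>(k, a). a = z) fs))))"
proof -
  define J where "J = jordan_matrix fs"
  define N where "N = jordan_matrix (map (\<lambda>k. (k, 0 :: complex)) ns)"
  define p where "p = sum_list (map fst fs)"
  define q where "q = sum_list ns"
  have dim0: "sum_list (map (fst \<circ> (\<lambda>k. (k, 0 :: complex))) ns) = q"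
    unfolding q_def by (induction ns) auto
  have J: "J \<in> carrier_mat p p" and N: "N \<in> carrier_mat q q" and dims: "dim_row J = p" "dim_row N = q"
    unfolding J_def N_def p_def using dim0 by auto
  obtain n P Q where L: "L \<in> carrier_pencil n" and P: "P \<in> carrier_mat n n" and Q: "Q \<in> carrier_mat n n"
    and inv: "invertible_mat P" "invertible_mat Q"
    and A: "P * fst L * Q = - four_block_mat J (0\<^sub>m p q) (0\<^sub>m q p) (1\<^sub>m q)"
    and B: "P * snd L * Q = four_block_mat (1\<^sub>m p) (0\<^sub>m p q) (0\<^sub>m q p) N"
    and nz: "0 \<notin> fst ` set fs"
    using form unfolding weierstrass_form_def Let_def J_def[symmetric] N_def[symmetric] dims by blast
  have AB: "fst L \<in> carrier_mat n n" "snd L \<in> carrier_mat n n" using L by (auto simp: carrier_pencil_def)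
  obtain ks where ks: "local_smith (pencil_mat (- J, 1\<^sub>m p)) z ks" "length ks = p"
    "filter (\<lambda>k. k > 0) ks = map fst (filter (\<lambda>(k, a). a = z) fs)"
    using local_smith_jordan_matrix[OF nz, of z] unfolding J_def p_def by blast
  have N': "local_smith (pencil_mat (- 1\<^sub>m q, N)) z (replicate q 0)"
    using local_smith_infinite_part unfolding q_def N_def .
  have "const_mat P * pencil_mat L * const_mat Q = pencil_mat (P * fst L * Q, P * snd L * Q)"
    using pencil_mat_equivalence[OF P Q AB] by simp
  also have "\<dots> = four_block_mat (pencil_mat (- J, 1\<^sub>m p)) (0\<^sub>m p q) (0\<^sub>m q p) (pencil_mat (- 1\<^sub>m q, N))"
    unfolding A B using J N by (intro eq_matI) (auto simp: pencil_mat_def one_pCons)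
  finally have "local_smith (const_mat P * pencil_mat L * const_mat Q) z (ks @ replicate q 0)"
    using local_smith_diag[OF ks(1) N'] ks(2) by simp
  then have "local_smith (pencil_mat L) z (ks @ replicate q 0)"
    by (rule local_smith_equivalent[of "const_mat P" n z "const_mat Q", rotated -1])
      (use P Q inv L in \<open>auto simp: det_const_mat invertible_mat_det_nonzero intro: pencil_mat_carrier\<close>)
  from rank_order_local_smith[OF this] show ?thesis using ks(3) by simp
qed

section \<open>Existence of the Weierstrass form\<close>

lemma det_nonzero_inverse:
  assumes A: "A \<in> carrier_mat n n" and "det A \<noteq> (0 :: complex)"
  obtains R where "R \<in> carrier_mat n n" "A * R = 1\<^sub>m n" "R * A = 1\<^sub>m n"
proof
  let ?R = "(1 / det A) \<cdot>\<^sub>m adj_mat A"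
  show "?R \<in> carrier_mat n n" using adj_mat(1)[OF A] by simp
  show "A * ?R = 1\<^sub>m n"
    unfolding mult_smult_distrib[OF A adj_mat(1)[OF A]] adj_mat(2)[OF A]
    using assms(2) by (intro eq_matI) auto
  show "?R * A = 1\<^sub>m n"
    unfolding mult_smult_assoc_mat[OF adj_mat(1)[OF A] A] adj_mat(3)[OF A]
    using assms(2) by (intro eq_matI) auto
qed

lemma det_nonzero_of_inverse:
  assumes "A \<in> carrier_mat n n" "R \<in> carrier_mat n n" "A * R = 1\<^sub>m n"
  shows "det A \<noteq> (0 :: complex)"
  using det_mult[OF assms(1,2)] assms(3) by auto

lemma det_nonzero_invertible_mat:
  assumes "A \<in> carrier_mat n n" and "det A \<noteq> (0 :: complex)"
  shows "invertible_mat A"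
proof -
  obtain R where "R \<in> carrier_mat n n" "A * R = 1\<^sub>m n" "R * A = 1\<^sub>m n"
    using det_nonzero_inverse[OF assms] .
  then show ?thesis using assms(1) unfolding invertible_mat_def inverts_mat_def by auto
qed

text \<open>Similarity of \<open>X\<close> acts on all matrices \<open>c I + d X\<close> at once, so it acts on pencils whose two
  coefficients are of this form.\<close>

definition lin :: "complex \<Rightarrow> complex \<Rightarrow> complex mat \<Rightarrow> complex mat" where
  "lin c d X = c \<cdot>\<^sub>m 1\<^sub>m (dim_row X) + d \<cdot>\<^sub>m X"

lemma lin_carrier: "X \<in> carrier_mat n n \<Longrightarrow> lin c d X \<in> carrier_mat n n"
  by (simp add: lin_def)

abbreviation diag2 :: "complex mat \<Rightarrow> complex mat \<Rightarrow> complex mat" where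
  "diag2 A B \<equiv> four_block_mat A (0\<^sub>m (dim_row A) (dim_col B)) (0\<^sub>m (dim_row B) (dim_col A)) B"

lemma diag2_mult:
  assumes "A \<in> carrier_mat p p" "A' \<in> carrier_mat p p" "B \<in> carrier_mat q q" "B' \<in> carrier_mat q q"
  shows "diag2 A B * diag2 A' B' = diag2 (A * A') (B * B')"
  using assms by (subst mult_four_block_mat) auto

lemma det_diag2:
  assumes "A \<in> carrier_mat p p" "B \<in> carrier_mat q q"
  shows "det (diag2 A B) = det A * det B"
  by (rule det_four_block_mat_lower_left_zero) (use assms in auto)

lemma lin_diag2:
  assumes "A \<in> carrier_mat p p" "B \<in> carrier_mat q q"
  shows "lin c d (diag2 A B) = diag2 (lin c d A) (lin c d B)"
  by (rule eq_matI) (use assms in \<open>auto simp: lin_def\<close>)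

lemma jordan_matrix_Cons_diag2: "jordan_matrix ((k, a) # fs) = diag2 (jordan_block k a) (jordan_matrix fs)"
  by (simp add: jordan_matrix_Cons)

lemma det_lin_jordan_matrix:
  "det (lin c d (jordan_matrix fs)) = (\<Prod>(k, a) \<leftarrow> fs. (c + d * a) ^ k)"
proof (induction fs)
  case Nil
  have "lin c d (jordan_matrix []) \<in> carrier_mat 0 0" by (rule lin_carrier) (use jordan_matrix_carrier[of "[]"] in simp)
  then show ?case by simp
next
  case (Cons ka fs)
  obtain k a where ka: "ka = (k, a)" by fastforce
  have B: "lin c d (jordan_block k a) \<in> carrier_mat k k" by (intro lin_carrier) simp
  have "det (lin c d (jordan_block k a)) = prod_list (diag_mat (lin c d (jordan_block k a)))"
    by (rule det_upper_triangular[OF _ B]) (auto simp: lin_def upper_triangular_def)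
  also have "diag_mat (lin c d (jordan_block k a)) = replicate k (c + d * a)"
    using B by (intro nth_equalityI) (auto simp: diag_mat_def lin_def)
  finally have 1: "det (lin c d (jordan_block k a)) = (c + d * a) ^ k" by simp
  have J: "jordan_matrix fs \<in> carrier_mat (sum_list (map fst fs)) (sum_list (map fst fs))" by simp
  show ?case
    unfolding ka jordan_matrix_Cons_diag2 lin_diag2[OF jordan_block_carrier J]
      det_diag2[OF B lin_carrier[OF J]] 1 Cons by simp
qed

lemma similar_mat_carrier:
  assumes "similar_mat A B" "A \<in> carrier_mat n n"
  shows "B \<in> carrier_mat n n"
proof -
  obtain m P Q where "{A, B, P, Q} \<subseteq> carrier_mat m m" using similar_matD[OF assms(1)] by blast
  moreover from this have "m = n" using assms(2) by auto
  ultimately show ?thesis by simp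
qed

lemma similar_diag2_swap:
  assumes A: "A \<in> carrier_mat p p" and B: "B \<in> carrier_mat q q"
  shows "similar_mat (diag2 A B) (diag2 B A)"
proof -
  let ?P = "four_block_mat (0\<^sub>m p q) (1\<^sub>m p) (1\<^sub>m q) (0\<^sub>m q p) :: complex mat"
  let ?Q = "four_block_mat (0\<^sub>m q p) (1\<^sub>m q) (1\<^sub>m p) (0\<^sub>m p q) :: complex mat"
  have 1: "?P * ?Q = 1\<^sub>m (p + q)" by (subst mult_four_block_mat) auto
  have 2: "?Q * ?P = 1\<^sub>m (p + q)"
    by (subst mult_four_block_mat) (auto simp: add.commute)
  have PB: "?P * diag2 B A = four_block_mat (0\<^sub>m p q) A B (0\<^sub>m q p)"
    using A B by (subst mult_four_block_mat) auto
  have 3: "diag2 A B = ?P * diag2 B A * ?Q"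
    unfolding PB using A B by (subst mult_four_block_mat) auto
  show ?thesis
    by (rule similar_matI[OF _ 1 2 3]) (use A B in \<open>auto simp: add.commute\<close>)
qed

lemma similar_diag2:
  assumes "similar_mat A A'" "similar_mat B B'" "A \<in> carrier_mat p p" "B \<in> carrier_mat q q"
  shows "similar_mat (diag2 A B) (diag2 A' B')"
proof -
  have "A' \<in> carrier_mat p p" "B' \<in> carrier_mat q q"
    using similar_mat_carrier assms by blast+
  then show ?thesis using similar_mat_four_block_0_0[OF assms] assms(3,4) by auto
qed

text \<open>Neighbouring diagonal blocks can be exchanged by a similarity. This will collect the Jordan blocks with
  nonzero eigenvalue in front.\<close>

lemma similar_jordan_matrix_partition:
  "similar_mat (jordan_matrix fs)
    (diag2 (jordan_matrix (filter (\<lambda>x. P x) fs)) (jordan_matrix (filter (\<lambda>x. \<not> P x) fs)))"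
proof (induction fs)
  case Nil
  have J: "jordan_matrix [] \<in> carrier_mat 0 0" using jordan_matrix_carrier[of "[]"] by simp
  have eq: "diag2 (jordan_matrix []) (jordan_matrix []) = jordan_matrix []"
    by (rule eq_matI) auto
  show ?case unfolding filter.simps eq by (rule similar_mat_refl[OF J])
next
  case (Cons ka fs)
  obtain k a where ka: "ka = (k, a)" by fastforce
  let ?J = "\<lambda>fs. jordan_matrix fs :: complex mat"
  let ?n = "\<lambda>fs :: (nat \<times> complex) list. sum_list (map fst fs)"
  let ?B = "jordan_block k a" and ?F1 = "filter (\<lambda>x. P x) fs" and ?F2 = "filter (\<lambda>x. \<not> P x) fs"
  have c: "?J fs \<in> carrier_mat (?n fs) (?n fs)" for fs by simp
  have B: "?B \<in> carrier_mat k k" by simp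
  have D: "diag2 X Y \<in> carrier_mat (p + q) (p + q)" if "X \<in> carrier_mat p p" "Y \<in> carrier_mat q q" for X Y p q
    using that by auto
  have "similar_mat (?J (ka # fs)) (diag2 ?B (diag2 (?J ?F1) (?J ?F2)))"
    unfolding ka jordan_matrix_Cons_diag2 by (rule similar_diag2[OF similar_mat_refl[OF B] Cons B c])
  also have "diag2 ?B (diag2 (?J ?F1) (?J ?F2)) = diag2 (diag2 ?B (?J ?F1)) (?J ?F2)"
    by (rule assoc_four_block_mat)
  finally have 1: "similar_mat (?J (ka # fs)) (diag2 (diag2 ?B (?J ?F1)) (?J ?F2))" .
  show ?case
  proof (cases "P ka")
    case True
    then show ?thesis using 1 by (simp add: ka jordan_matrix_Cons_diag2)
  next
    case False
    have "similar_mat (diag2 (diag2 ?B (?J ?F1)) (?J ?F2)) (diag2 (diag2 (?J ?F1) ?B) (?J ?F2))"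
      by (rule similar_diag2[OF similar_diag2_swap[OF B c] similar_mat_refl[OF c] D[OF B c] c])
    also have "diag2 (diag2 (?J ?F1) ?B) (?J ?F2) = diag2 (?J ?F1) (diag2 ?B (?J ?F2))"
      by (rule assoc_four_block_mat[symmetric])
    also have "diag2 ?B (?J ?F2) = ?J (filter (\<lambda>x. \<not> P x) (ka # fs))"
      using False by (simp add: ka jordan_matrix_Cons_diag2)
    finally show ?thesis using False similar_mat_trans[OF 1] by simp
  qed
qed

definition strictly_equivalent :: "nat \<Rightarrow> pencil \<Rightarrow> pencil \<Rightarrow> bool" where
  "strictly_equivalent n L L' \<longleftrightarrow> L \<in> carrier_pencil n \<and> (\<exists>P \<in> carrier_mat n n. \<exists>Q \<in> carrier_mat n n.
     det P \<noteq> 0 \<and> det Q \<noteq> 0 \<and> P * fst L * Q = fst L' \<and> P * snd L * Q = snd L')"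

lemma strictly_equivalentI:
  assumes "A \<in> carrier_mat n n" "B \<in> carrier_mat n n" "P \<in> carrier_mat n n" "Q \<in> carrier_mat n n"
    "det P \<noteq> 0" "det Q \<noteq> 0" "P * A * Q = A'" "P * B * Q = B'"
  shows "strictly_equivalent n (A, B) (A', B')"
  unfolding strictly_equivalent_def using assms by (auto simp: carrier_pencil_def)

lemma strictly_equivalentE:
  assumes "strictly_equivalent n (A, B) (A', B')"
  obtains P Q where "A \<in> carrier_mat n n" "B \<in> carrier_mat n n" "P \<in> carrier_mat n n" "Q \<in> carrier_mat n n"
    "det P \<noteq> 0" "det Q \<noteq> 0" "P * A * Q = A'" "P * B * Q = B'"
  using assms unfolding strictly_equivalent_def by (auto simp: carrier_pencil_def)

lemma strictly_equivalent_trans: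
  assumes "strictly_equivalent n (A, B) (A', B')" "strictly_equivalent n (A', B') (A'', B'')"
  shows "strictly_equivalent n (A, B) (A'', B'')"
proof -
  obtain P Q where 1: "A \<in> carrier_mat n n" "B \<in> carrier_mat n n" "P \<in> carrier_mat n n" "Q \<in> carrier_mat n n"
    "det P \<noteq> 0" "det Q \<noteq> 0" "P * A * Q = A'" "P * B * Q = B'"
    by (rule strictly_equivalentE[OF assms(1)])
  obtain P' Q' where 2: "A' \<in> carrier_mat n n" "B' \<in> carrier_mat n n" "P' \<in> carrier_mat n n" "Q' \<in> carrier_mat n n"
    "det P' \<noteq> 0" "det Q' \<noteq> 0" "P' * A' * Q' = A''" "P' * B' * Q' = B''"
    by (rule strictly_equivalentE[OF assms(2)])
  have "P' * P * X * (Q * Q') = P' * (P * X * Q) * Q'" if X: "X \<in> carrier_mat n n" for X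
  proof -
    have c: "P * X \<in> carrier_mat n n" "P' * (P * X) \<in> carrier_mat n n" using 1 2 X by auto
    have "P' * P * X * (Q * Q') = P' * (P * X) * (Q * Q')" by (simp only: assoc_mult_mat[OF 2(3) 1(3) X])
    also have "\<dots> = P' * (P * X) * Q * Q'" by (rule assoc_mult_mat[OF c(2) 1(4) 2(4), symmetric])
    also have "P' * (P * X) * Q = P' * (P * X * Q)" by (rule assoc_mult_mat[OF 2(3) c(1) 1(4)])
    finally show ?thesis .
  qed
  then have "P' * P * A * (Q * Q') = A''" "P' * P * B * (Q * Q') = B''"
    using 1 2 by simp_all
  then show ?thesis
    using 1 2 by (intro strictly_equivalentI[of _ n _ "P' * P" "Q * Q'"]) (auto simp: det_mult[of _ n])
qed

lemma strictly_equivalent_mult_left: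
  assumes "A \<in> carrier_mat n n" "B \<in> carrier_mat n n" "P \<in> carrier_mat n n" "det P \<noteq> 0"
  shows "strictly_equivalent n (A, B) (P * A, P * B)"
  by (rule strictly_equivalentI[of _ n _ P "1\<^sub>m n"]) (use assms in auto)

lemma strictly_equivalent_lin_similar:
  assumes X: "X \<in> carrier_mat n n" and sim: "similar_mat X Y"
  shows "strictly_equivalent n (lin c d X, lin e f X) (lin c d Y, lin e f Y)"
proof -
  obtain P Q where PQ: "P \<in> carrier_mat n n" "Q \<in> carrier_mat n n" "P * Q = 1\<^sub>m n" "Q * P = 1\<^sub>m n"
    and Y: "Y = P * X * Q"
    using similar_matD[OF similar_mat_sym[OF sim]] X by auto
  have PX: "P * X \<in> carrier_mat n n" and YC: "Y \<in> carrier_mat n n" using PQ X Y by auto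
  have "P * lin c d X * Q = lin c d Y" for c d
  proof -
    have c1: "c \<cdot>\<^sub>m 1\<^sub>m n \<in> carrier_mat n n" "d \<cdot>\<^sub>m X \<in> carrier_mat n n" "c \<cdot>\<^sub>m P \<in> carrier_mat n n" "d \<cdot>\<^sub>m (P * X) \<in> carrier_mat n n"
      using X PQ PX by auto
    have "P * (c \<cdot>\<^sub>m 1\<^sub>m n + d \<cdot>\<^sub>m X) = c \<cdot>\<^sub>m P + d \<cdot>\<^sub>m (P * X)"
      unfolding mult_add_distrib_mat[OF PQ(1) c1(1,2)] mult_smult_distrib[OF PQ(1) one_carrier_mat]
        mult_smult_distrib[OF PQ(1) X] right_mult_one_mat[OF PQ(1)] ..
    then have "P * (c \<cdot>\<^sub>m 1\<^sub>m n + d \<cdot>\<^sub>m X) * Q = c \<cdot>\<^sub>m (P * Q) + d \<cdot>\<^sub>m (P * X * Q)"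
      unfolding mult_smult_assoc_mat[OF PQ(1,2), symmetric] mult_smult_assoc_mat[OF PX PQ(2), symmetric]
      by (simp only: add_mult_distrib_mat[OF c1(3,4) PQ(2)])
    then show ?thesis unfolding lin_def PQ(3) using X YC Y by auto
  qed
  moreover have "det P \<noteq> 0" "det Q \<noteq> 0"
    using det_nonzero_of_inverse PQ by blast+
  ultimately show ?thesis using lin_carrier[OF X] PQ by (intro strictly_equivalentI[of _ n _ P Q]) auto
qed

lemma strictly_equivalent_diag2:
  assumes "strictly_equivalent p (A1, B1) (A1', B1')" "strictly_equivalent q (A2, B2) (A2', B2')"
  shows "strictly_equivalent (p + q) (diag2 A1 A2, diag2 B1 B2) (diag2 A1' A2', diag2 B1' B2')"
proof -
  obtain P Q where 1: "A1 \<in> carrier_mat p p" "B1 \<in> carrier_mat p p" "P \<in> carrier_mat p p" "Q \<in> carrier_mat p p"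
    "det P \<noteq> 0" "det Q \<noteq> 0" "P * A1 * Q = A1'" "P * B1 * Q = B1'"
    by (rule strictly_equivalentE[OF assms(1)])
  obtain P' Q' where 2: "A2 \<in> carrier_mat q q" "B2 \<in> carrier_mat q q" "P' \<in> carrier_mat q q" "Q' \<in> carrier_mat q q"
    "det P' \<noteq> 0" "det Q' \<noteq> 0" "P' * A2 * Q' = A2'" "P' * B2 * Q' = B2'"
    by (rule strictly_equivalentE[OF assms(2)])
  have PA: "P * A1 \<in> carrier_mat p p" "P * B1 \<in> carrier_mat p p" "P' * A2 \<in> carrier_mat q q" "P' * B2 \<in> carrier_mat q q"
    using 1 2 by auto
  have c: "diag2 X Y \<in> carrier_mat (p + q) (p + q)" if "X \<in> carrier_mat p p" "Y \<in> carrier_mat q q" for X Y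
    using that by auto
  show ?thesis
  proof (rule strictly_equivalentI)
    show "diag2 P P' * diag2 A1 A2 * diag2 Q Q' = diag2 A1' A2'"
      by (simp only: diag2_mult[OF 1(3,1) 2(3,1)] diag2_mult[OF PA(1) 1(4) PA(3) 2(4)] 1 2)
    show "diag2 P P' * diag2 B1 B2 * diag2 Q Q' = diag2 B1' B2'"
      by (simp only: diag2_mult[OF 1(3,2) 2(3,2)] diag2_mult[OF PA(2) 1(4) PA(4) 2(4)] 1 2)
    show "det (diag2 P P') \<noteq> 0" "det (diag2 Q Q') \<noteq> 0"
      unfolding det_diag2[OF 1(3) 2(3)] det_diag2[OF 1(4) 2(4)] using 1 2 by auto
  qed (rule c; fact)+
qed

lemma jordan_nf_exists_complex:
  assumes "A \<in> carrier_mat n n"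
  obtains fs where "0 \<notin> fst ` set fs" "similar_mat A (jordan_matrix fs :: complex mat)"
  using char_poly_factorized[OF assms] jordan_nf_exists[OF assms] unfolding jordan_nf_def by blast

text \<open>Here \<open>J\<close> has an inverse \<open>R\<close>, and multiplication by \<open>R\<close> turns \<open>I + (x - \<rho>) J\<close> into \<open>x I - (\<rho> I - R)\<close>. It
  remains to take the Jordan form of \<open>\<rho> I - R\<close>.\<close>

lemma finite_part_strictly_equivalent:
  assumes nz: "\<And>k a. (k, a) \<in> set fs \<Longrightarrow> a \<noteq> 0"
  defines "J \<equiv> jordan_matrix fs" and "p \<equiv> sum_list (map fst fs)"
  shows "\<exists>fs'. 0 \<notin> fst ` set fs' \<and> sum_list (map fst fs') = p \<and>
    strictly_equivalent p (lin 1 (- \<rho>) J, J) (- jordan_matrix fs', 1\<^sub>m p)"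
proof -
  have J: "J \<in> carrier_mat p p" by (simp add: J_def p_def)
  have J_lin: "J = lin 0 1 J" using J by (intro eq_matI) (auto simp: lin_def)
  have "det J = (\<Prod>(k, a) \<leftarrow> fs. a ^ k)"
    using J_lin det_lin_jordan_matrix[of 0 1 fs] by (simp add: J_def)
  also have "\<dots> \<noteq> 0" using nz by (force simp: prod_list_zero_iff)
  finally have "det J \<noteq> 0" .
  then obtain R where R: "R \<in> carrier_mat p p" "J * R = 1\<^sub>m p" "R * J = 1\<^sub>m p"
    using det_nonzero_inverse[OF J] by blast
  define K where "K = lin \<rho> (- 1) R"
  have K: "K \<in> carrier_mat p p" using lin_carrier[OF R(1)] by (simp add: K_def)
  obtain fs' where fs': "0 \<notin> fst ` set fs'" "similar_mat K (jordan_matrix fs')"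
    by (rule jordan_nf_exists_complex[OF K])
  have dim: "sum_list (map fst fs') = p"
    using carrier_matD(1)[OF similar_mat_carrier[OF fs'(2) K]] by simp
  have RA: "R * lin 1 (- \<rho>) J = lin 0 (- 1) K"
  proof -
    have c: "1 \<cdot>\<^sub>m 1\<^sub>m p \<in> carrier_mat p p" "(- \<rho>) \<cdot>\<^sub>m J \<in> carrier_mat p p" using J by auto
    have "R * lin 1 (- \<rho>) J = 1 \<cdot>\<^sub>m R + (- \<rho>) \<cdot>\<^sub>m 1\<^sub>m p"
      unfolding lin_def carrier_matD(1)[OF J] mult_add_distrib_mat[OF R(1) c]
        mult_smult_distrib[OF R(1) one_carrier_mat] mult_smult_distrib[OF R(1) J] R(3) right_mult_one_mat[OF R(1)] ..
    then show ?thesis using R(1) K unfolding K_def by (auto simp: lin_def intro!: eq_matI)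
  qed
  have RB: "R * J = lin 1 0 K" unfolding R(3) using K by (auto simp: lin_def intro!: eq_matI)
  have "det R \<noteq> 0" by (rule det_nonzero_of_inverse[OF R(1) J R(3)])
  then have e1: "strictly_equivalent p (lin 1 (- \<rho>) J, J) (lin 0 (- 1) K, lin 1 0 K)"
    using strictly_equivalent_mult_left[OF lin_carrier[OF J] J R(1), of 1 "- \<rho>"] unfolding RA RB by blast
  have "lin 0 (- 1) (jordan_matrix fs') = - jordan_matrix fs'" "lin 1 0 (jordan_matrix fs') = 1\<^sub>m p"
    using dim by (auto simp: lin_def intro!: eq_matI)
  then have "strictly_equivalent p (lin 0 (- 1) K, lin 1 0 K) (- jordan_matrix fs', 1\<^sub>m p)"
    using strictly_equivalent_lin_similar[OF K fs'(2), of 0 "- 1" 1 0] by simp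
  from strictly_equivalent_trans[OF e1 this] show ?thesis using fs'(1) dim by blast
qed

text \<open>Here \<open>J\<close> is nilpotent, so \<open>I - \<rho> J\<close> has an inverse \<open>R\<close>, and multiplication by \<open>- R\<close> turns
  \<open>I + (x - \<rho>) J\<close> into \<open>x N - I\<close> with \<open>N = - R J\<close>. It remains to take the Jordan form of \<open>N\<close>.\<close>

lemma infinite_part_strictly_equivalent:
  assumes zero: "\<And>k a. (k, a) \<in> set fs \<Longrightarrow> a = 0"
  defines "J \<equiv> jordan_matrix fs" and "q \<equiv> sum_list (map fst fs)"
  shows "\<exists>ns. 0 \<notin> set ns \<and> sum_list ns = q \<and>
    strictly_equivalent q (lin 1 (- \<rho>) J, J) (- 1\<^sub>m q, jordan_matrix (map (\<lambda>k. (k, 0)) ns))"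
proof -
  have J: "J \<in> carrier_mat q q" by (simp add: J_def q_def)
  have det_lin: "det (lin c d J) = c ^ q" for c d
  proof -
    have "\<forall>x\<in>set fs. snd x = 0" using zero by auto
    then show ?thesis
      unfolding J_def q_def det_lin_jordan_matrix by (induction fs) (auto simp: power_add case_prod_beta)
  qed
  define V where "V = lin 1 (- \<rho>) J"
  have V: "V \<in> carrier_mat q q" using lin_carrier[OF J] by (simp add: V_def)
  have "det V \<noteq> 0" by (simp add: V_def det_lin)
  then obtain R where R: "R \<in> carrier_mat q q" "V * R = 1\<^sub>m q" "R * V = 1\<^sub>m q"
    using det_nonzero_inverse[OF V] by blast
  define R' where "R' = - 1 \<cdot>\<^sub>m R"
  have R': "R' \<in> carrier_mat q q" using R by (simp add: R'_def)
  define N where "N = R' * J"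
  have N: "N \<in> carrier_mat q q" using R' J by (simp add: N_def)
  have RV: "R' * V = - 1\<^sub>m q"
    unfolding R'_def mult_smult_assoc_mat[OF R(1) V] R(3) by (intro eq_matI) auto
  have "det R \<noteq> 0" by (rule det_nonzero_of_inverse[OF R(1) V R(3)])
  then have detR': "det R' \<noteq> 0" by (simp add: R'_def)
  obtain fs' where fs': "0 \<notin> fst ` set fs'" "similar_mat N (jordan_matrix fs')"
    by (rule jordan_nf_exists_complex[OF N])
  have dim: "sum_list (map fst fs') = q"
    using carrier_matD(1)[OF similar_mat_carrier[OF fs'(2) N]] by simp
  \<comment> \<open>\<open>N\<close> is nilpotent: \<open>z - N = R (z + (1 - \<rho> z) J)\<close>, whose determinant is a multiple of \<open>z\<^sup>q\<close>.\<close>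
  have "a = 0" if ka: "(k, a) \<in> set fs'" for k a
  proof (rule ccontr)
    assume a: "a \<noteq> 0"
    have "k \<noteq> 0" using ka fs'(1) by force
    then have "det (lin a (- 1) (jordan_matrix fs')) = 0"
      unfolding det_lin_jordan_matrix prod_list_zero_iff using ka by force
    moreover have "strictly_equivalent q (lin a (- 1) N, lin 0 0 N)
        (lin a (- 1) (jordan_matrix fs'), lin 0 0 (jordan_matrix fs'))"
      by (rule strictly_equivalent_lin_similar[OF N fs'(2)])
    then obtain P Q where PQ: "P \<in> carrier_mat q q" "Q \<in> carrier_mat q q" "det P \<noteq> 0" "det Q \<noteq> 0"
      "P * lin a (- 1) N * Q = lin a (- 1) (jordan_matrix fs')"
      by (rule strictly_equivalentE)
    then have "det (lin a (- 1) (jordan_matrix fs')) = det P * det (lin a (- 1) N) * det Q"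
      unfolding PQ(5)[symmetric] det_mult[OF mult_carrier_mat[OF PQ(1) lin_carrier[OF N]] PQ(2)]
        det_mult[OF PQ(1) lin_carrier[OF N]] by simp
    moreover have "lin a (- 1) N = R * lin a (1 - \<rho> * a) J"
    proof -
      have c: "a \<cdot>\<^sub>m V \<in> carrier_mat q q" using V by simp
      have "R * (a \<cdot>\<^sub>m V + J) = a \<cdot>\<^sub>m 1\<^sub>m q + R * J"
        unfolding mult_add_distrib_mat[OF R(1) c J] mult_smult_distrib[OF R(1) V] R(3) ..
      moreover have "a \<cdot>\<^sub>m V + J = lin a (1 - \<rho> * a) J"
        using J unfolding V_def by (intro eq_matI) (auto simp: lin_def algebra_simps)
      moreover have "a \<cdot>\<^sub>m 1\<^sub>m q + R * J = lin a (- 1) N"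
        using R J unfolding N_def R'_def mult_smult_assoc_mat[OF R(1) J]
        by (intro eq_matI) (auto simp: lin_def)
      ultimately show ?thesis by simp
    qed
    then have "det (lin a (- 1) N) = det R * a ^ q"
      using det_mult[OF R(1) lin_carrier[OF J]] det_lin by simp
    ultimately show False using \<open>det P \<noteq> 0\<close> \<open>det Q \<noteq> 0\<close> \<open>det R \<noteq> 0\<close> a by simp
  qed
  then have fs'_eq: "map (\<lambda>k. (k, 0)) (map fst fs') = fs'" by (auto intro!: map_idI simp: comp_def)
  have e1: "strictly_equivalent q (V, J) (- 1\<^sub>m q, N)"
    using strictly_equivalent_mult_left[OF V J R' detR'] unfolding RV N_def .
  have lins: "lin (- 1) 0 X = - 1\<^sub>m q" "lin 0 1 X = X" if "X \<in> carrier_mat q q" for X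
    using that by (auto simp: lin_def intro!: eq_matI)
  have J': "jordan_matrix fs' \<in> carrier_mat q q" using dim by auto
  have "strictly_equivalent q (- 1\<^sub>m q, N) (- 1\<^sub>m q, jordan_matrix fs')"
    using strictly_equivalent_lin_similar[OF N fs'(2), of "- 1" 0 0 1] unfolding lins[OF N] lins[OF J'] .
  from strictly_equivalent_trans[OF e1 this]
  have "strictly_equivalent q (V, J) (- 1\<^sub>m q, jordan_matrix (map (\<lambda>k. (k, 0)) (map fst fs')))"
    unfolding fs'_eq .
  moreover have "0 \<notin> set (map fst fs')" using fs'(1) by simp
  ultimately show ?thesis using dim unfolding V_def by blast
qed

text \<open>Let \<open>\<rho>\<close> be a point that is not an eigenvalue and \<open>R\<close> the inverse of \<open>L(\<rho>)\<close>. Then \<open>R L(x) = I + (x - \<rho>) M\<close>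
  with \<open>M = R B\<close>. Jordan blocks of \<open>M\<close> with nonzero eigenvalue give the finite part and those with
  eigenvalue zero the infinite part.\<close>

theorem weierstrass_form_exists:
  assumes L: "L \<in> carrier_pencil n" and reg: "regular_pencil L"
  shows "\<exists>fs ns. weierstrass_form L fs ns"
proof -
  obtain A B where AB: "L = (A, B)" by (cases L)
  have A: "A \<in> carrier_mat n n" and B: "B \<in> carrier_mat n n" using L by (auto simp: AB carrier_pencil_def)
  obtain \<rho> where "det (A + \<rho> \<cdot>\<^sub>m B) \<noteq> 0" using reg by (auto simp: regular_pencil_def AB)
  then obtain R where R: "R \<in> carrier_mat n n" "(A + \<rho> \<cdot>\<^sub>m B) * R = 1\<^sub>m n" "R * (A + \<rho> \<cdot>\<^sub>m B) = 1\<^sub>m n"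
    using det_nonzero_inverse[of "A + \<rho> \<cdot>\<^sub>m B" n] A B by auto
  have Lc: "A + \<rho> \<cdot>\<^sub>m B \<in> carrier_mat n n" using A B by simp
  have detR: "det R \<noteq> 0" by (rule det_nonzero_of_inverse[OF R(1) Lc R(3)])
  define M where "M = R * B"
  have M: "M \<in> carrier_mat n n" using R B by (simp add: M_def)
  have "R * A + \<rho> \<cdot>\<^sub>m M = 1\<^sub>m n"
    using R(3) A B R(1) unfolding M_def
    by (simp add: mult_add_distrib_mat[of _ n n] mult_smult_distrib[of _ n n])
  then have "R * A = lin 1 (- \<rho>) M"
  proof (intro eq_matI)
    fix i j assume "i < dim_row (lin 1 (- \<rho>) M)" "j < dim_col (lin 1 (- \<rho>) M)"
    then have ij: "i < n" "j < n" using M by (auto simp: lin_def)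
    have "(R * A) $$ (i, j) + \<rho> * M $$ (i, j) = (1\<^sub>m n) $$ (i, j)"
      using arg_cong[OF \<open>R * A + \<rho> \<cdot>\<^sub>m M = 1\<^sub>m n\<close>, of "\<lambda>X. X $$ (i, j)"] ij M R(1) A
      by (simp del: index_mult_mat(1))
    then show "(R * A) $$ (i, j) = lin 1 (- \<rho>) M $$ (i, j)"
      using ij M by (simp add: lin_def eq_diff_eq del: index_mult_mat(1))
  qed (use M R(1) A in \<open>auto simp: lin_def\<close>)
  moreover have "R * B = lin 0 1 M" using M unfolding M_def[symmetric] by (intro eq_matI) (auto simp: lin_def)
  ultimately have e1: "strictly_equivalent n (A, B) (lin 1 (- \<rho>) M, lin 0 1 M)"
    using strictly_equivalent_mult_left[OF A B R(1) detR] by simp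
  obtain bl where bl: "similar_mat M (jordan_matrix bl)" by (rule jordan_nf_exists_complex[OF M])
  define F where "F = filter (\<lambda>(k, a). a \<noteq> 0) bl"
  define Z where "Z = filter (\<lambda>x. \<not> (case x of (k, a) \<Rightarrow> a \<noteq> 0)) bl"
  define p where "p = sum_list (map fst F)"
  define q where "q = sum_list (map fst Z)"
  let ?J1 = "jordan_matrix F" and ?J0 = "jordan_matrix Z"
  have c: "?J1 \<in> carrier_mat p p" "?J0 \<in> carrier_mat q q" by (simp_all add: p_def q_def)
  have sim: "similar_mat M (diag2 ?J1 ?J0)"
    using similar_mat_trans[OF bl similar_jordan_matrix_partition] unfolding F_def Z_def .
  then have n: "n = p + q" using carrier_matD(1)[OF similar_mat_carrier[OF sim M]] by (simp add: p_def q_def)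
  have e2: "strictly_equivalent n (lin 1 (- \<rho>) M, lin 0 1 M)
      (diag2 (lin 1 (- \<rho>) ?J1) (lin 1 (- \<rho>) ?J0), diag2 (lin 0 1 ?J1) (lin 0 1 ?J0))"
    using strictly_equivalent_lin_similar[OF M sim, of 1 "- \<rho>" 0 1] unfolding lin_diag2[OF c] .
  have lin01: "lin 0 1 ?J1 = ?J1" "lin 0 1 ?J0 = ?J0" using c by (auto simp: lin_def intro!: eq_matI)
  obtain fs where fs: "0 \<notin> fst ` set fs" "sum_list (map fst fs) = p"
    "strictly_equivalent p (lin 1 (- \<rho>) ?J1, ?J1) (- jordan_matrix fs, 1\<^sub>m p)"
    using finite_part_strictly_equivalent[of F \<rho>] unfolding F_def[symmetric] p_def[symmetric]
    by (fastforce simp: F_def)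
  obtain ns where ns: "0 \<notin> set ns" "sum_list ns = q"
    "strictly_equivalent q (lin 1 (- \<rho>) ?J0, ?J0) (- 1\<^sub>m q, jordan_matrix (map (\<lambda>k. (k, 0)) ns))"
    using infinite_part_strictly_equivalent[of Z \<rho>] unfolding Z_def[symmetric] q_def[symmetric]
    by (fastforce simp: Z_def)
  define N where "N = jordan_matrix (map (\<lambda>k. (k, 0 :: complex)) ns)"
  have dim0: "sum_list (map (fst \<circ> (\<lambda>k. (k, 0 :: complex))) ns) = q"
    unfolding ns(2)[symmetric] by (induction ns) auto
  have dims: "dim_row (jordan_matrix fs) = p" "dim_row N = q" "N \<in> carrier_mat q q" "jordan_matrix fs \<in> carrier_mat p p"
    using fs(2) dim0 by (auto simp: N_def)
  have "strictly_equivalent n (A, B) (diag2 (- jordan_matrix fs) (- 1\<^sub>m q), diag2 (1\<^sub>m p) N)"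
    using strictly_equivalent_trans[OF strictly_equivalent_trans[OF e1 e2]]
      strictly_equivalent_diag2[OF fs(3) ns(3)] unfolding n lin01 N_def by blast
  then obtain P Q where PQ: "P \<in> carrier_mat n n" "Q \<in> carrier_mat n n" "det P \<noteq> 0" "det Q \<noteq> 0"
    "P * A * Q = diag2 (- jordan_matrix fs) (- 1\<^sub>m q)" "P * B * Q = diag2 (1\<^sub>m p) N"
    by (rule strictly_equivalentE)
  have AQ: "P * fst L * Q = - four_block_mat (jordan_matrix fs) (0\<^sub>m p q) (0\<^sub>m q p) (1\<^sub>m q)"
    unfolding AB fst_conv PQ(5) using dims by (intro eq_matI) auto
  have BQ: "P * snd L * Q = four_block_mat (1\<^sub>m p) (0\<^sub>m p q) (0\<^sub>m q p) N"
    unfolding AB snd_conv PQ(6) using dims by auto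
  have "weierstrass_form L fs ns"
    unfolding weierstrass_form_def Let_def N_def[symmetric] dims(1,2)
    using fs(1) ns(1) L PQ(1,2) det_nonzero_invertible_mat[OF PQ(1,3)] det_nonzero_invertible_mat[OF PQ(2,4)] AQ BQ
    by blast
  then show ?thesis by blast
qed

section \<open>The point at infinity\<close>

text \<open>Reversing the pencil reverses its determinant, read as a polynomial of formal degree \<open>n\<close>. So the order
  at \<open>0\<close> of the reversed determinant is the gap between the degree and \<open>n\<close>.\<close>

lemma det_rev_pencil:
  assumes L: "L \<in> carrier_pencil n" and det: "det (pencil_mat L) \<noteq> 0"
  shows "degree (det (pencil_mat L)) \<le> n"
    and "det (pencil_mat (rev_pencil L))
      = monom 1 (n - degree (det (pencil_mat L))) * reflect_poly (det (pencil_mat L))"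
proof -
  let ?p = "det (pencil_mat L)" and ?q = "det (pencil_mat (rev_pencil L))"
  show deg: "degree ?p \<le> n"
    using degree_det_le[of n "pencil_mat L" 1] pencil_mat_carrier[OF L] by (simp add: pencil_mat_index[OF L])
  obtain A B where AB: "L = (A, B)" by (cases L)
  have A: "A \<in> carrier_mat n n" and B: "B \<in> carrier_mat n n" using L by (auto simp: AB carrier_pencil_def)
  have *: "poly ?q x = poly (monom 1 (n - degree ?p) * reflect_poly ?p) x" if x: "x \<noteq> 0" for x
  proof -
    have "pencil_at (rev_pencil L) x = x \<cdot>\<^sub>m pencil_at L (inverse x)"
      using A B x unfolding AB by (intro eq_matI) (auto simp: distrib_left mult.assoc[symmetric])
    then have "poly ?q x = x ^ n * poly ?p (inverse x)"
      using A B unfolding poly_det_pencil_mat[OF rev_pencil_carrier[OF L]] poly_det_pencil_mat[OF L]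
      by (simp add: AB)
    also have "x ^ n = x ^ (n - degree ?p) * x ^ degree ?p" using deg by (simp flip: power_add)
    finally show ?thesis using x by (simp add: poly_monom poly_reflect_poly_nz)
  qed
  show "?q = monom 1 (n - degree ?p) * reflect_poly ?p" (is "_ = ?r")
  proof (rule ccontr)
    assume "?q \<noteq> ?r"
    then have "finite {x. poly (?q - ?r) x = 0}" by (intro poly_roots_finite) simp
    moreover have "- {0} \<subseteq> {x. poly (?q - ?r) x = 0}" using * by auto
    ultimately have "finite (- {0} :: complex set)" using finite_subset by blast
    then show False using infinite_UNIV_char_0[where ?'a = complex] by (simp add: finite_compl)
  qed
qed

lemma order_0_det_rev_pencil:
  assumes L: "L \<in> carrier_pencil n" and det: "det (pencil_mat L) \<noteq> 0"
  shows "det (pencil_mat (rev_pencil L)) \<noteq> 0"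
    and "Polynomial.order 0 (det (pencil_mat (rev_pencil L))) = n - degree (det (pencil_mat L))"
proof -
  have nz: "monom 1 (n - degree (det (pencil_mat L))) * reflect_poly (det (pencil_mat L)) \<noteq> 0"
    using det by (simp add: monom_eq_0_iff)
  then show "det (pencil_mat (rev_pencil L)) \<noteq> 0" using det_rev_pencil(2)[OF assms] by simp
  have "Polynomial.order 0 (reflect_poly (det (pencil_mat L))) = 0"
    using det by (intro order_0I) simp
  then show "Polynomial.order 0 (det (pencil_mat (rev_pencil L))) = n - degree (det (pencil_mat L))"
    unfolding det_rev_pencil(2)[OF assms] order_mult[OF nz] by simp
qed

text \<open>Statements about the point \<open>\<infinity>\<close> are statements about the reversed pencil at \<open>0\<close>. With \<open>chart\<close> and \<open>chart_point\<close>
  finite and infinite eigenvalues are treated alike.\<close>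

fun chart :: "ext_complex \<Rightarrow> pencil \<Rightarrow> pencil" where
  "chart (Fin z) L = L"
| "chart Infty L = rev_pencil L"

fun chart_point :: "ext_complex \<Rightarrow> complex" where
  "chart_point (Fin z) = z"
| "chart_point Infty = 0"

lemma chart_carrier: "L \<in> carrier_pencil n \<Longrightarrow> chart \<mu> L \<in> carrier_pencil n"
  by (cases \<mu>) (auto intro: rev_pencil_carrier)

lemma chart_add: "chart \<mu> (L + E) = chart \<mu> L + chart \<mu> E"
  by (cases \<mu>; cases L; cases E) auto

lemma det_chart_nonzero:
  assumes "L \<in> carrier_pencil n" "regular_pencil L"
  shows "det (pencil_mat (chart \<mu> L)) \<noteq> 0"
  using assms order_0_det_rev_pencil(1) by (cases \<mu>) (auto simp: regular_pencil_iff)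

lemma regular_pencil_of_chart:
  assumes L: "L \<in> carrier_pencil n" and det: "det (pencil_mat (chart \<mu> L)) \<noteq> 0"
  shows "regular_pencil L"
proof (cases \<mu>)
  case (Fin z)
  then show ?thesis using det regular_pencil_iff[OF L] by simp
next
  case Infty
  have "rev_pencil (rev_pencil L) = L" by (cases L) simp
  then show ?thesis
    using order_0_det_rev_pencil(1)[OF rev_pencil_carrier[OF L]] det Infty regular_pencil_iff[OF L] by simp
qed

lemma pencil_eigenvalue_chart:
  "L \<in> carrier_pencil n \<Longrightarrow>
    pencil_eigenvalue L \<mu> \<longleftrightarrow> poly (det (pencil_mat (chart \<mu> L))) (chart_point \<mu>) = 0"
  using pencil_eigenvalue_Fin_iff pencil_eigenvalue_Infty_iff by (cases \<mu>) auto

lemma finite_partial_mults_tail_sums: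
  assumes L: "L \<in> carrier_pencil n" and reg: "regular_pencil L"
  shows "0 \<notin> set (finite_partial_mults L z)"
    and "sum_list (drop j (finite_partial_mults L z)) = rank_order (pencil_mat L) z j"
proof -
  let ?ms = "\<lambda>fs. descending (map fst (filter (\<lambda>(k, a). a = z) fs))"
  obtain fs ns where form: "weierstrass_form L fs ns" using weierstrass_form_exists[OF assms] by blast
  have nz: "0 \<notin> set (?ms fs)" if "weierstrass_form L fs ns" for fs ns
    using that unfolding weierstrass_form_def by force
  have "finite_partial_mults L z = ?ms fs"
    unfolding finite_partial_mults_def
  proof (rule the_equality)
    show "\<exists>fs' ns. weierstrass_form L fs' ns \<and> ?ms fs = ?ms fs'" using form by blast
    fix ms assume "\<exists>fs' ns. weierstrass_form L fs' ns \<and> ms = ?ms fs'"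
    then obtain fs' ns' where form': "weierstrass_form L fs' ns'" and ms: "ms = ?ms fs'" by blast
    show "ms = ?ms fs"
      unfolding ms by (rule tail_sums_eq_imp_eq[OF nz[OF form'] nz[OF form]])
        (simp only: rank_order_weierstrass[OF form', symmetric] rank_order_weierstrass[OF form, symmetric])
  qed
  then show "0 \<notin> set (finite_partial_mults L z)"
    "sum_list (drop j (finite_partial_mults L z)) = rank_order (pencil_mat L) z j"
    using nz[OF form] rank_order_weierstrass[OF form] by simp_all
qed

lemma partial_mults_tail_sums:
  assumes L: "L \<in> carrier_pencil n" and reg: "regular_pencil L"
  shows "0 \<notin> set (partial_mults L \<mu>)"
    and "sum_list (drop j (partial_mults L \<mu>)) = rank_order (pencil_mat (chart \<mu> L)) (chart_point \<mu>) j"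
proof -
  have "regular_pencil (chart \<mu> L)"
    using det_chart_nonzero[OF assms] regular_pencil_iff[OF chart_carrier[OF L]] by blast
  moreover have "partial_mults L \<mu> = finite_partial_mults (chart \<mu> L) (chart_point \<mu>)" by (cases \<mu>) auto
  ultimately show "0 \<notin> set (partial_mults L \<mu>)"
    "sum_list (drop j (partial_mults L \<mu>)) = rank_order (pencil_mat (chart \<mu> L)) (chart_point \<mu>) j"
    using finite_partial_mults_tail_sums[OF chart_carrier[OF L]] by simp_all
qed

text \<open>The coefficient of \<open>(x - z)\<^sup>d\<close> in the expansion of \<open>f\<close> at \<open>z\<close>. An order of vanishing of at most \<open>d\<close> is
  forced by \<open>taylor_coeff z d f \<noteq> 0\<close>, a condition that is polynomial in the coefficients of \<open>f\<close>.\<close>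

abbreviation taylor_coeff :: "complex \<Rightarrow> nat \<Rightarrow> complex poly \<Rightarrow> complex" where
  "taylor_coeff z d f \<equiv> coeff (f \<circ>\<^sub>p [:z, 1:]) d"

section \<open>Generic perturbations of rank one and their sums\<close>

lemma pcompose_power: "(f ^ k) \<circ>\<^sub>p q = (f \<circ>\<^sub>p q) ^ k" for f q :: "complex poly"
  by (induction k) (simp_all add: pcompose_mult)

lemma taylor_coeff_dvd:
  assumes "[:- z, 1:] ^ Suc d dvd f"
  shows "taylor_coeff z d f = 0"
proof -
  obtain g where f: "f = [:- z, 1:] ^ Suc d * g" using assms by (elim dvdE)
  have "f \<circ>\<^sub>p [:z, 1:] = monom 1 (Suc d) * (g \<circ>\<^sub>p [:z, 1:])"
    unfolding f pcompose_mult pcompose_power by (simp add: pcompose_pCons monom_altdef)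
  then show ?thesis by (simp only: coeff_monom_mult) simp
qed

lemma taylor_coeff_order:
  assumes "f \<noteq> 0"
  shows "taylor_coeff z (Polynomial.order z f) f \<noteq> 0"
proof -
  define d where "d = Polynomial.order z f"
  obtain g where f: "f = [:- z, 1:] ^ d * g" and g: "\<not> [:- z, 1:] dvd g"
    using order_decomp[OF assms, of z] unfolding d_def by blast
  have "f \<circ>\<^sub>p [:z, 1:] = monom 1 d * (g \<circ>\<^sub>p [:z, 1:])"
    unfolding f pcompose_mult pcompose_power by (simp add: pcompose_pCons monom_altdef)
  then have "taylor_coeff z d f = poly (g \<circ>\<^sub>p [:z, 1:]) 0"
    by (simp only: coeff_monom_mult poly_0_coeff_0) simp
  then show ?thesis using g unfolding d_def[symmetric] by (simp add: poly_pcompose poly_eq_0_iff_dvd)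
qed

lemma taylor_coeff_nonzero:
  assumes "taylor_coeff z d f \<noteq> 0"
  shows "f \<noteq> 0" and "Polynomial.order z f \<le> d"
proof -
  show nz: "f \<noteq> 0" using assms by auto
  show "Polynomial.order z f \<le> d"
  proof (rule ccontr)
    assume "\<not> Polynomial.order z f \<le> d"
    then have "[:- z, 1:] ^ Suc d dvd f" using nz by (simp only: order_divides) simp
    then show False using taylor_coeff_dvd assms by blast
  qed
qed

lemma taylor_coeff_zero_dvd:
  assumes "[:- z, 1:] ^ d dvd f" "taylor_coeff z d f = 0"
  shows "[:- z, 1:] ^ Suc d dvd f"
  using assms taylor_coeff_order[of f z] unfolding order_divides by (metis le_antisym not_less_eq_eq)

lemma rank_order_dvd:
  assumes "W \<in> carrier_mat n n" "X \<in> carrier_mat n j" "Y \<in> carrier_mat j n"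
  shows "[:- z, 1:] ^ rank_order W z j dvd det (W + X * Y)"
  using rank_order_le[OF assms, of z] unfolding order_divides by blast

definition place_order :: "pencil \<Rightarrow> ext_complex \<Rightarrow> nat \<Rightarrow> nat" where
  "place_order L \<mu> j = rank_order (pencil_mat (chart \<mu> L)) (chart_point \<mu>) j"

text \<open>The scalar factor \<open>\<alpha> + x \<beta>\<close> of a perturbation, as it appears in the chart of a point.\<close>

fun chart_scalar :: "complex \<Rightarrow> complex \<Rightarrow> ext_complex \<Rightarrow> complex poly" where
  "chart_scalar \<alpha> \<beta> (Fin z) = [:\<alpha>, \<beta>:]"
| "chart_scalar \<alpha> \<beta> Infty = [:\<beta>, \<alpha>:]"

text \<open>The pencil \<open>(\<alpha> + x \<beta>) M\<close>, where \<open>M\<close> is the constant matrix of rank at most \<open>r\<close> with the columns \<open>X k\<close> and the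
  rows \<open>Y k\<close> as factors.\<close>

definition scaled_pencil ::
    "nat \<Rightarrow> complex \<Rightarrow> complex \<Rightarrow> nat \<Rightarrow> (nat \<Rightarrow> nat \<Rightarrow> complex) \<Rightarrow> (nat \<Rightarrow> nat \<Rightarrow> complex) \<Rightarrow> pencil" where
  "scaled_pencil n \<alpha> \<beta> r X Y = (mat n n (\<lambda>(i, j). \<alpha> * (\<Sum>k<r. X k i * Y k j)),
     mat n n (\<lambda>(i, j). \<beta> * (\<Sum>k<r. X k i * Y k j)))"

lemma scaled_pencil_carrier: "scaled_pencil n \<alpha> \<beta> r X Y \<in> carrier_pencil n"
  by (simp add: scaled_pencil_def carrier_pencil_def)

lemma pencil_mat_chart_scaled:
  assumes L: "L \<in> carrier_pencil n"
  shows "pencil_mat (chart \<mu> (L + scaled_pencil n \<alpha> \<beta> r X Y))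
    = mat n n (\<lambda>(i, j). pencil_mat (chart \<mu> L) $$ (i, j)
        + chart_scalar \<alpha> \<beta> \<mu> * (\<Sum>k<r. [:X k i:] * [:Y k j:]))" (is "?A = ?B")
proof (rule eq_matI)
  have E: "scaled_pencil n \<alpha> \<beta> r X Y \<in> carrier_pencil n" by (rule scaled_pencil_carrier)
  have sum: "(\<Sum>k<r. [:X k i:] * [:Y k j:]) = [:\<Sum>k<r. X k i * Y k j:]" for i j
    by (induction r) (auto simp: mult.commute)
  fix i j assume "i < dim_row ?B" "j < dim_col ?B"
  then have ij: "i < n" "j < n" by auto
  have "pencil_mat (chart \<mu> (scaled_pencil n \<alpha> \<beta> r X Y)) $$ (i, j)
      = chart_scalar \<alpha> \<beta> \<mu> * (\<Sum>k<r. [:X k i:] * [:Y k j:])"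
    unfolding sum using ij by (cases \<mu>) (auto simp: pencil_mat_def scaled_pencil_def)
  then show "?A $$ (i, j) = ?B $$ (i, j)"
    using ij pencil_mat_carrier[OF chart_carrier[OF E], of \<mu>] pencil_mat_carrier[OF chart_carrier[OF L], of \<mu>]
    by (simp add: chart_add pencil_mat_add[OF chart_carrier[OF L] chart_carrier[OF E]])
next
  have "?A \<in> carrier_mat n n"
    by (intro pencil_mat_carrier chart_carrier add_carrier_pencil L scaled_pencil_carrier)
  then show "dim_row ?A = dim_row ?B" "dim_col ?A = dim_col ?B" by auto
qed

text \<open>Let \<open>V + x y\<^sup>T\<close> be a perturbation of rank \<open>j + 1\<close> with the minimal order \<open>d\<close>, split into a part of rank \<open>j\<close> and
  one last term. By \<open>det_rank_one_update\<close> its determinant is a combination of \<open>det V\<close> and the cofactors of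
  \<open>V\<close>. If no constant \<open>u, v\<close> would do, then \<open>u = v = 0\<close> and the unit vectors would show that \<open>det V\<close> and all
  cofactors are divisible by \<open>(x - z)\<^sup>d\<^sup>+\<^sup>1\<close>, contrary to the choice of \<open>x, y\<close>.\<close>

lemma exists_rank_one_lowering:
  assumes W: "W \<in> carrier_mat n n" and det: "det W \<noteq> 0" and g: "poly g z \<noteq> 0"
  obtains V where "V \<in> carrier_mat n n"
    "\<exists>X \<in> carrier_mat n j. \<exists>Y \<in> carrier_mat j n. V = W + X * Y"
    "\<exists>u v. taylor_coeff z (rank_order W z (Suc j))
      (det (mat n n (\<lambda>(i, k). V $$ (i, k) + g * [:u i:] * [:v k:]))) \<noteq> 0"
proof -
  define d where "d = rank_order W z (Suc j)"
  let ?p = "[:- z, 1:]"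
  obtain X Y where X: "X \<in> carrier_mat n (Suc j)" and Y: "Y \<in> carrier_mat (Suc j) n"
    and nz: "det (W + X * Y) \<noteq> 0" and ord: "Polynomial.order z (det (W + X * Y)) = d"
    using rank_order_attained[OF W det] unfolding d_def by metis
  define X' where "X' = mat n j (\<lambda>(i, k). X $$ (i, k))"
  define Y' where "Y' = mat j n (\<lambda>(k, i). Y $$ (k, i))"
  define V where "V = W + X' * Y'"
  have X': "X' \<in> carrier_mat n j" and Y': "Y' \<in> carrier_mat j n" by (auto simp: X'_def Y'_def)
  have V: "V \<in> carrier_mat n n" using W X' Y' by (simp add: V_def)
  let ?U = "\<lambda>x y. mat n n (\<lambda>(i, k). V $$ (i, k) + x i * y k)"
  have XY: "W + X * Y = ?U (\<lambda>i. X $$ (i, j)) (\<lambda>k. Y $$ (j, k))"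
  proof (rule eq_matI)
    fix i k assume "i < dim_row (?U (\<lambda>i. X $$ (i, j)) (\<lambda>k. Y $$ (j, k)))"
      "k < dim_col (?U (\<lambda>i. X $$ (i, j)) (\<lambda>k. Y $$ (j, k)))"
    then have ik: "i < n" "k < n" by auto
    then show "(W + X * Y) $$ (i, k) = ?U (\<lambda>i. X $$ (i, j)) (\<lambda>k. Y $$ (j, k)) $$ (i, k)"
      using W X Y X' Y' unfolding V_def
      by (simp add: scalar_prod_def X'_def Y'_def algebra_simps)
  qed (use W X Y in auto)
  have dvdU: "?p ^ d dvd det (?U x y)" for x y
  proof -
    have "X'' \<in> carrier_mat n 1 \<Longrightarrow> Y'' \<in> carrier_mat 1 n \<Longrightarrow> ?p ^ d dvd det (V + X'' * Y'')" for X'' Y''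
    proof -
      assume c: "X'' \<in> carrier_mat n 1" "Y'' \<in> carrier_mat 1 n"
      obtain A B where AB: "A \<in> carrier_mat n (j + 1)" "B \<in> carrier_mat (j + 1) n" "A * B = X' * Y' + X'' * Y''"
        by (rule mult_append_cols_rows[OF X' Y' c])
      have "V + X'' * Y'' = W + A * B" unfolding V_def AB(3) using W X' Y' c by (intro assoc_add_mat) auto
      then show ?thesis using rank_order_dvd[OF W AB(1,2), of z] unfolding d_def by simp
    qed
    from this[of "mat n 1 (\<lambda>(i, _). x i)" "mat 1 n (\<lambda>(_, k). y k)"]
    have "?p ^ d dvd det (V + mat n 1 (\<lambda>(i, _). x i) * mat 1 n (\<lambda>(_, k). y k))" by simp
    also have "V + mat n 1 (\<lambda>(i, _). x i) * mat 1 n (\<lambda>(_, k). y k) = ?U x y"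
      using V by (intro eq_matI) (auto simp: scalar_prod_def)
    finally show ?thesis .
  qed
  have "\<exists>u v. taylor_coeff z d (det (?U (\<lambda>i. g * [:u i:]) (\<lambda>k. [:v k:]))) \<noteq> 0"
  proof (rule ccontr)
    assume "\<not> ?thesis"
    then have dvd: "?p ^ Suc d dvd det (?U (\<lambda>i. g * [:u i:]) (\<lambda>k. [:v k:]))" for u v
      using taylor_coeff_zero_dvd[OF dvdU[of "\<lambda>i. g * [:u i:]" "\<lambda>k. [:v k:]"]] by blast
    have 0: "?p ^ Suc d dvd det V"
      using dvd[of "\<lambda>_. 0" "\<lambda>_. 0"] unfolding det_rank_one_update[OF V] by simp
    have cof: "?p ^ Suc d dvd cofactor V a b" if ab: "a < n" "b < n" for a b
    proof -
      have "det (?U (\<lambda>i. g * [:if i = a then 1 else 0:]) (\<lambda>k. [:if k = b then 1 else 0:]))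
          = det V + (\<Sum>i<n. \<Sum>k<n. if k = b then if i = a then g * cofactor V i k else 0 else 0)"
        unfolding det_rank_one_update[OF V] by (intro arg_cong2[where f = plus] refl sum.cong) (auto simp: one_pCons[symmetric])
      also have "\<dots> = det V + g * cofactor V a b" using ab by simp
      finally have "?p ^ Suc d dvd det V + g * cofactor V a b"
        using dvd[of "\<lambda>i. if i = a then 1 else 0" "\<lambda>k. if k = b then 1 else 0"] by simp
      then have "?p ^ Suc d dvd g * cofactor V a b" using 0 dvd_add_right_iff by blast
      moreover have "g \<noteq> 0" "Polynomial.order z g = 0" using g by (auto intro: order_0I)
      ultimately show ?thesis unfolding order_divides
        by (cases "cofactor V a b = 0") (auto simp: order_mult)
    qed
    have "?p ^ Suc d dvd det (W + X * Y)"
      unfolding XY det_rank_one_update[OF V]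
      by (intro dvd_add 0 dvd_sum dvd_mult cof) auto
    then show False using nz ord unfolding order_divides by simp
  qed
  then show ?thesis
    using that[OF V] X' Y' unfolding V_def[symmetric] d_def by (auto simp: V_def)
qed

text \<open>At a multiple root \<open>x\<close> of \<open>p + t Q\<close> the Wronskian of \<open>p\<close> and \<open>Q\<close> vanishes, and if \<open>p x \<noteq> 0\<close> then \<open>x\<close> determines
  \<open>t\<close>. If the Wronskian is the zero polynomial, all roots of a nonzero \<open>p + t Q\<close> are roots of \<open>p\<close>.\<close>

lemma simple_roots_cofinite:
  fixes p Q :: "complex poly"
  assumes p: "p \<noteq> 0"
  shows "finite {t. p + Polynomial.smult t Q \<noteq> 0 \<and>
    (\<exists>x. poly p x \<noteq> 0 \<and> Polynomial.order x (p + Polynomial.smult t Q) > 1)}" (is "finite ?B")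
proof -
  define w where "w = p * pderiv Q - pderiv p * Q"
  have dbl: "poly w x = 0 \<and> w \<noteq> 0 \<and> poly Q x \<noteq> 0 \<and> t = - poly p x / poly Q x"
    if nz: "p + Polynomial.smult t Q \<noteq> 0" and px: "poly p x \<noteq> 0" and ord: "Polynomial.order x (p + Polynomial.smult t Q) > 1" for t x
  proof -
    let ?f = "p + Polynomial.smult t Q"
    have root: "poly ?f x = 0" using nz ord order_root[of ?f x] by simp
    have pd: "pderiv ?f \<noteq> 0" using root nz pderiv_iszero by fastforce
    have ord': "Polynomial.order x ?f = Suc (Polynomial.order x (pderiv ?f))"
      by (rule order_pderiv[OF nz root])
    then have root': "poly (pderiv ?f) x = 0" using ord pd order_root[of "pderiv ?f" x] by simp
    have Qx: "poly Q x \<noteq> 0" using root px by auto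
    have t: "t = - poly p x / poly Q x" using root Qx by (simp add: field_simps eq_neg_iff_add_eq_0)
    have wf: "Polynomial.smult t w = p * pderiv ?f - pderiv p * ?f"
      by (simp add: w_def pderiv_add pderiv_smult algebra_simps smult_diff_right)
    have "t \<noteq> 0" using t px Qx by simp
    moreover have "poly (Polynomial.smult t w) x = 0" unfolding wf using root root' by simp
    ultimately have wx: "poly w x = 0" by simp
    have "w \<noteq> 0"
    proof
      assume "w = 0"
      then have eq: "p * pderiv ?f = pderiv p * ?f" using wf by simp
      have "[:- x, 1:] ^ Polynomial.order x ?f dvd p * pderiv ?f" unfolding eq by (simp add: order_1 dvd_mult)
      then have "Polynomial.order x ?f \<le> Polynomial.order x p + Polynomial.order x (pderiv ?f)"
        using p pd unfolding order_divides by (auto simp: order_mult)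
      then show False using px ord' by (simp add: order_0I)
    qed
    then show ?thesis using wx Qx t by blast
  qed
  show ?thesis
  proof (cases "w = 0")
    case True
    then have "?B = {}" using dbl by blast
    then show ?thesis by (rule ssubst) (rule finite.emptyI)
  next
    case False
    then have "finite ((\<lambda>x. - poly p x / poly Q x) ` {x. poly w x = 0})"
      by (intro finite_imageI poly_roots_finite)
    moreover have "?B \<subseteq> (\<lambda>x. - poly p x / poly Q x) ` {x. poly w x = 0}" using dbl by blast
    ultimately show ?thesis by (rule finite_subset[rotated])
  qed
qed

lemma place_order_beyond:
  assumes "L \<in> carrier_pencil n" "regular_pencil L" "j \<ge> n"
  shows "place_order L \<mu> j = 0"
  using rank_order_antimono[OF pencil_mat_carrier[OF chart_carrier[OF assms(1)]] det_chart_nonzero[OF assms(1,2)] assms(3)]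
    rank_order_dim[OF pencil_mat_carrier[OF chart_carrier[OF assms(1)]]]
  unfolding place_order_def by (metis le_zero_eq)

lemma place_order_Suc_le:
  assumes L: "L \<in> carrier_pencil n" and "regular_pencil (L + scaled_pencil n \<alpha> \<beta> 1 X Y)"
  shows "place_order L \<mu> (Suc j) \<le> place_order (L + scaled_pencil n \<alpha> \<beta> 1 X Y) \<mu> j"
proof -
  let ?L = "L + scaled_pencil n \<alpha> \<beta> 1 X Y" and ?W = "pencil_mat (chart \<mu> L)"
  let ?x = "mat n 1 (\<lambda>(i, _). chart_scalar \<alpha> \<beta> \<mu> * [:X 0 i:])" and ?y = "mat 1 n (\<lambda>(_, j). [:Y 0 j:])"
  have W: "?W \<in> carrier_mat n n" by (intro pencil_mat_carrier chart_carrier L)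
  have eq: "pencil_mat (chart \<mu> ?L) = ?W + ?x * ?y"
    unfolding pencil_mat_chart_scaled[OF L] using W by (intro eq_matI) (auto simp: scalar_prod_def mult.assoc)
  have "det (?W + ?x * ?y) \<noteq> 0"
    using det_chart_nonzero[OF add_carrier_pencil[OF L scaled_pencil_carrier] assms(2), of \<mu>] unfolding eq .
  from rank_order_add[OF W _ _ this, of 1 "chart_point \<mu>" j] show ?thesis
    unfolding place_order_def eq by simp
qed

text \<open>Each condition on \<open>u\<close> and \<open>v\<close> is the nonvanishing of a polynomial and can be satisfied by itself, so all
  of them can be satisfied together. Replacing \<open>u\<close> by \<open>t u\<close> preserves them for almost all \<open>t\<close>, and for almost
  all \<open>t\<close> the determinant, which is affine in \<open>t\<close>, has only simple roots outside \<open>Z\<close>.\<close>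

lemma rank_one_step:
  assumes L: "L \<in> carrier_pencil n" and reg: "regular_pencil L"
    and Z: "finite Z" "Infty \<in> Z" "\<And>z. poly (det (pencil_mat L)) z = 0 \<Longrightarrow> Fin z \<in> Z"
    and c: "\<And>\<mu>. \<mu> \<in> Z \<Longrightarrow> poly (chart_scalar \<alpha> \<beta> \<mu>) (chart_point \<mu>) \<noteq> 0"
  obtains X Y where "regular_pencil (L + scaled_pencil n \<alpha> \<beta> 1 X Y)"
    "\<And>\<mu> j. \<mu> \<in> Z \<Longrightarrow> place_order (L + scaled_pencil n \<alpha> \<beta> 1 X Y) \<mu> j = place_order L \<mu> (Suc j)"
    "\<And>z. Fin z \<notin> Z \<Longrightarrow> Polynomial.order z (det (pencil_mat (L + scaled_pencil n \<alpha> \<beta> 1 X Y))) \<le> 1"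
proof -
  let ?W = "\<lambda>\<mu>. pencil_mat (chart \<mu> L)" and ?g = "chart_scalar \<alpha> \<beta>"
  have W: "?W \<mu> \<in> carrier_mat n n" for \<mu> by (intro pencil_mat_carrier chart_carrier L)
  define good where "good \<mu> j V \<longleftrightarrow> V \<in> carrier_mat n n \<and>
      (\<exists>X \<in> carrier_mat n j. \<exists>Y \<in> carrier_mat j n. V = ?W \<mu> + X * Y) \<and>
      (\<exists>u v. taylor_coeff (chart_point \<mu>) (place_order L \<mu> (Suc j))
        (det (mat n n (\<lambda>(i, k). V $$ (i, k) + ?g \<mu> * [:u i:] * [:v k:]))) \<noteq> 0)" for \<mu> j V
  define V where "V \<mu> j = (SOME V. good \<mu> j V)" for \<mu> j
  have good: "good \<mu> j (V \<mu> j)" if "\<mu> \<in> Z" for \<mu> j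
    unfolding V_def
  proof (rule someI_ex)
    show "\<exists>V. good \<mu> j V"
    proof (rule exists_rank_one_lowering[OF W det_chart_nonzero[OF L reg] c[OF that], of j])
      fix V assume "V \<in> carrier_mat n n" "\<exists>X \<in> carrier_mat n j. \<exists>Y \<in> carrier_mat j n. V = ?W \<mu> + X * Y"
        "\<exists>u v. taylor_coeff (chart_point \<mu>) (rank_order (?W \<mu>) (chart_point \<mu>) (Suc j))
          (det (mat n n (\<lambda>(i, k). V $$ (i, k) + ?g \<mu> * [:u i:] * [:v k:]))) \<noteq> 0"
      then show ?thesis unfolding good_def place_order_def by (intro exI[of _ V] conjI)
    qed
  qed
  have VXY: "\<exists>X \<in> carrier_mat n j. \<exists>Y \<in> carrier_mat j n. V \<mu> j = ?W \<mu> + X * Y" if "\<mu> \<in> Z" for \<mu> j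
    by (rule conjunct1[OF conjunct2[OF good[OF that, of j, unfolded good_def]]])
  have Vuv: "\<exists>u v. taylor_coeff (chart_point \<mu>) (place_order L \<mu> (Suc j))
      (det (mat n n (\<lambda>(i, k). V \<mu> j $$ (i, k) + ?g \<mu> * [:u i:] * [:v k:]))) \<noteq> 0" if "\<mu> \<in> Z" for \<mu> j
    by (rule conjunct2[OF conjunct2[OF good[OF that, of j, unfolded good_def]]])
  define D where "D \<mu> j y = det (mat n n (\<lambda>(i, k). V \<mu> j $$ (i, k) + ?g \<mu> * [:y i:] * [:y (n + k):]))"
    for \<mu> j and y :: "nat \<Rightarrow> complex"
  define f where "f = (\<lambda>(\<mu>, j) y. taylor_coeff (chart_point \<mu>) (place_order L \<mu> (Suc j)) (D \<mu> j y))"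
  have poly_D: "poly_polyfun (n + n) (D \<mu> j)" for \<mu> j
    unfolding D_def
    by (rule polyfun_det) (auto intro!: polyfun.intros simp del: mult_pCons_left mult_pCons_right)
  have poly_f: "scalar_polyfun (n + n) (f k)" for k
    unfolding f_def by (cases k) (simp add: polyfun_coeff polyfun_pcompose poly_D)
  have "\<exists>y. \<forall>k \<in> Z \<times> {..n}. f k y \<noteq> 0"
  proof (rule polyfun_common_nonzero)
    fix k assume "k \<in> Z \<times> {..n}"
    then obtain \<mu> j where k: "k = (\<mu>, j)" "\<mu> \<in> Z" by auto
    obtain u v where uv: "taylor_coeff (chart_point \<mu>) (place_order L \<mu> (Suc j))
        (det (mat n n (\<lambda>(i, k). V \<mu> j $$ (i, k) + ?g \<mu> * [:u i:] * [:v k:]))) \<noteq> 0"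
      using Vuv[OF k(2)] by blast
    let ?y = "\<lambda>i. if i < n then u i else v (i - n)"
    have "D \<mu> j ?y = det (mat n n (\<lambda>(i, k). V \<mu> j $$ (i, k) + ?g \<mu> * [:u i:] * [:v k:]))"
      unfolding D_def by (intro arg_cong[of _ _ det] eq_matI) auto
    then show "scalar_polyfun (n + n) (f k) \<and> (\<exists>y. f k y \<noteq> 0)"
      using poly_f uv by (auto simp: f_def k(1) intro!: exI[of _ ?y])
  qed (use Z in simp)
  then obtain y where y: "\<And>k. k \<in> Z \<times> {..n} \<Longrightarrow> f k y \<noteq> 0" by blast
  \<comment> \<open>The line along which \<open>u\<close> is scaled by \<open>t\<close> while \<open>v\<close> stays fixed.\<close>
  define a b where "a i = (if i < n then 0 else y i)" and "b i = (if i < n then y i else 0)" for i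
  define q where "q k = (SOME q. \<forall>t. f k (\<lambda>i. a i + t * b i) = poly q t)" for k
  have q: "f k (\<lambda>i. a i + t * b i) = poly (q k) t" for k t
    using someI_ex[OF polyfun_on_line[OF poly_f[of k], of a b]] unfolding q_def by blast
  have "(\<lambda>i. a i + 1 * b i) = y" by (auto simp: a_def b_def)
  then have q1: "poly (q k) 1 \<noteq> 0" if "k \<in> Z \<times> {..n}" for k
    using q[of k 1] y[OF that] by simp
  define X Y where "X t i = t * y i" and "Y k = y (n + k)" for t i k
  let ?L = "\<lambda>t. L + scaled_pencil n \<alpha> \<beta> 1 (\<lambda>_. X t) (\<lambda>_. Y)"
  have detD: "D \<mu> j (\<lambda>i. a i + t * b i)
      = det (mat n n (\<lambda>(i, k). V \<mu> j $$ (i, k) + ?g \<mu> * [:X t i:] * [:Y k:]))" for \<mu> j t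
    unfolding D_def by (intro arg_cong[of _ _ det] eq_matI) (auto simp: a_def b_def X_def Y_def)
  define p where "p = det (pencil_mat L)"
  define Q where "Q = (\<Sum>i<n. \<Sum>k<n. [:\<alpha>, \<beta>:] * [:y i:] * [:Y k:] * cofactor (pencil_mat L) i k)"
  have p: "p \<noteq> 0" using reg regular_pencil_iff[OF L] by (simp add: p_def)
  have det_t: "det (pencil_mat (?L t)) = p + Polynomial.smult t Q" for t
  proof -
    have "pencil_mat (?L t) = mat n n (\<lambda>(i, k). pencil_mat L $$ (i, k) + ([:\<alpha>, \<beta>:] * [:X t i:]) * [:Y k:])"
      using pencil_mat_chart_scaled[OF L, of "Fin 0" \<alpha> \<beta> 1 "\<lambda>_. X t" "\<lambda>_. Y"]
      by (simp only: chart.simps chart_scalar.simps lessThan_Suc One_nat_def) (simp add: mult.assoc)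
    from this have "det (pencil_mat (?L t))
        = p + (\<Sum>i<n. \<Sum>k<n. ([:\<alpha>, \<beta>:] * [:X t i:]) * [:Y k:] * cofactor (pencil_mat L) i k)"
      by (simp only: det_rank_one_update[OF pencil_mat_carrier[OF L]] p_def)
    also have "(\<Sum>i<n. \<Sum>k<n. ([:\<alpha>, \<beta>:] * [:X t i:]) * [:Y k:] * cofactor (pencil_mat L) i k) = Polynomial.smult t Q"
      unfolding Q_def smult_sum2 by (intro sum.cong refl) (simp add: X_def algebra_simps smult_add_right)
    finally show ?thesis .
  qed
  define B where "B = (\<Union>k\<in>Z \<times> {..n}. {t. poly (q k) t = 0}) \<union>
    {t. p + Polynomial.smult t Q \<noteq> 0 \<and> (\<exists>x. poly p x \<noteq> 0 \<and> Polynomial.order x (p + Polynomial.smult t Q) > 1)}"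
  have "finite B"
    unfolding B_def using Z(1) q1 simple_roots_cofinite[OF p]
    by (intro finite_UnI finite_UN_I poly_roots_finite) force+
  then obtain t where t: "t \<notin> B"
    using infinite_UNIV_char_0[where ?'a = complex] by (metis ex_new_if_finite)
  have tf: "taylor_coeff (chart_point \<mu>) (place_order L \<mu> (Suc j))
      (det (mat n n (\<lambda>(i, k). V \<mu> j $$ (i, k) + ?g \<mu> * [:X t i:] * [:Y k:]))) \<noteq> 0"
    if "\<mu> \<in> Z" "j \<le> n" for \<mu> j
  proof -
    have "poly (q (\<mu>, j)) t \<noteq> 0" using t that unfolding B_def by auto
    then show ?thesis unfolding q[symmetric] by (simp add: f_def detD)
  qed
  \<comment> \<open>Moving the rank \<open>j\<close> part of \<open>V \<mu> j\<close> to the other side shows that it lowers the perturbed pencil.\<close>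
  have attained: "\<exists>X' \<in> carrier_mat n j. \<exists>Y' \<in> carrier_mat j n.
      det (pencil_mat (chart \<mu> (?L t)) + X' * Y') \<noteq> 0 \<and>
      Polynomial.order (chart_point \<mu>) (det (pencil_mat (chart \<mu> (?L t)) + X' * Y')) \<le> place_order L \<mu> (Suc j)"
    if \<mu>: "\<mu> \<in> Z" "j \<le> n" for \<mu> j
  proof -
    obtain X' Y' where XY': "X' \<in> carrier_mat n j" "Y' \<in> carrier_mat j n" "V \<mu> j = ?W \<mu> + X' * Y'"
      using VXY[OF \<mu>(1)] by blast
    have eq: "pencil_mat (chart \<mu> (?L t)) + X' * Y'
        = mat n n (\<lambda>(i, k). V \<mu> j $$ (i, k) + ?g \<mu> * [:X t i:] * [:Y k:])"
      unfolding pencil_mat_chart_scaled[OF L] XY'(3) using XY'(1,2) W[of \<mu>]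
      by (intro eq_matI) (auto simp: mult.assoc)
    show ?thesis
      by (rule bexI[OF _ XY'(1)], rule bexI[OF _ XY'(2)], unfold eq)
        (rule conjI[OF taylor_coeff_nonzero[OF tf[OF \<mu>]]])
  qed
  have Lt: "?L t \<in> carrier_pencil n" by (intro add_carrier_pencil L scaled_pencil_carrier)
  have regt: "regular_pencil (?L t)"
  proof -
    obtain X' Y' where XY': "X' \<in> carrier_mat n 0" "Y' \<in> carrier_mat 0 n"
      and d: "det (pencil_mat (chart Infty (?L t)) + X' * Y') \<noteq> 0"
      using attained[OF Z(2), of 0] by blast
    have "X' * Y' = 0\<^sub>m n n" using XY' by (intro eq_matI) (auto simp: scalar_prod_def)
    then have "det (pencil_mat (chart Infty (?L t))) \<noteq> 0"
      using d pencil_mat_carrier[OF chart_carrier[OF Lt], of Infty] by simp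
    then show ?thesis by (rule regular_pencil_of_chart[OF Lt])
  qed
  show ?thesis
  proof (rule that[OF regt])
    fix \<mu> j assume \<mu>: "\<mu> \<in> Z"
    show "place_order (?L t) \<mu> j = place_order L \<mu> (Suc j)"
    proof (cases "j \<le> n")
      case True
      obtain X' Y' where XY': "X' \<in> carrier_mat n j" "Y' \<in> carrier_mat j n"
        "det (pencil_mat (chart \<mu> (?L t)) + X' * Y') \<noteq> 0"
        "Polynomial.order (chart_point \<mu>) (det (pencil_mat (chart \<mu> (?L t)) + X' * Y')) \<le> place_order L \<mu> (Suc j)"
        using attained[OF \<mu> True] by blast
      have "place_order (?L t) \<mu> j \<le> place_order L \<mu> (Suc j)"
        using rank_order_le[OF pencil_mat_carrier[OF chart_carrier[OF Lt]] XY'(1-3), of "chart_point \<mu>"] XY'(4)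
        unfolding place_order_def by linarith
      then show ?thesis using place_order_Suc_le[OF L regt] by (intro antisym)
    next
      case False
      then show ?thesis using place_order_beyond[OF Lt regt] place_order_beyond[OF L reg] by simp
    qed
  next
    fix z assume "Fin z \<notin> Z"
    then have "poly p z \<noteq> 0" using Z(3) unfolding p_def by blast
    moreover have "p + Polynomial.smult t Q \<noteq> 0" using regt regular_pencil_iff[OF Lt] unfolding det_t by blast
    ultimately show "Polynomial.order z (det (pencil_mat (?L t))) \<le> 1"
      using t unfolding B_def det_t by force
  qed
qed

lemma scaled_pencil_Suc:
  "scaled_pencil n \<alpha> \<beta> (Suc r) (X(r := x)) (Y(r := y))
    = scaled_pencil n \<alpha> \<beta> r X Y + scaled_pencil n \<alpha> \<beta> 1 (\<lambda>_. x) (\<lambda>_. y)"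
proof -
  have "(\<Sum>k<Suc r. (X(r := x)) k i * (Y(r := y)) k j) = (\<Sum>k<r. X k i * Y k j) + x i * y j" for i j
    by simp
  then show ?thesis
    unfolding scaled_pencil_def by (simp add: plus_prod_def) (auto intro!: eq_matI simp: algebra_simps)
qed

lemma place_order_0:
  assumes "L \<in> carrier_pencil n" "regular_pencil L"
  shows "place_order L \<mu> 0 = Polynomial.order (chart_point \<mu>) (det (pencil_mat (chart \<mu> L)))"
  unfolding place_order_def
  by (rule rank_order_0[OF pencil_mat_carrier[OF chart_carrier[OF assms(1)]] det_chart_nonzero[OF assms]])

lemma add_assoc_pencil:
  assumes "L \<in> carrier_pencil n" "E \<in> carrier_pencil n" "F \<in> carrier_pencil n"
  shows "L + E + F = L + (E + F)"
  using assms by (auto simp: carrier_pencil_def plus_prod_def)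

text \<open>One step is made for each unit of rank, always with the factor \<open>x - \<rho>\<close>. The set of controlled points
  includes the eigenvalues that arose in earlier steps. They were simple, and since \<open>place_order\<close>
  decreases in \<open>j\<close>, their multiplicity after the step is still at most \<open>1\<close>.\<close>

theorem exists_generic_scaled_pencil:
  assumes L: "L \<in> carrier_pencil n" and reg: "regular_pencil L" and \<rho>: "det (pencil_at L \<rho>) \<noteq> 0"
  shows "\<exists>X Y. let L' = L + scaled_pencil n (- \<rho>) 1 r X Y in regular_pencil L' \<and>
    (\<forall>\<mu> j. \<mu> = Infty \<or> pencil_eigenvalue L \<mu> \<longrightarrow> place_order L' \<mu> j = place_order L \<mu> (r + j)) \<and>
    (\<forall>z. \<not> pencil_eigenvalue L (Fin z) \<longrightarrow> Polynomial.order z (det (pencil_mat L')) \<le> 1)"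
proof (induction r)
  case 0
  have "L + scaled_pencil n (- \<rho>) 1 0 X Y = L" for X Y
    using L by (cases L) (auto simp: scaled_pencil_def plus_prod_def carrier_pencil_def intro!: eq_matI)
  moreover have "Polynomial.order z (det (pencil_mat L)) = 0" if "\<not> pencil_eigenvalue L (Fin z)" for z
    using that pencil_eigenvalue_Fin_iff[OF L] by (intro order_0I) simp
  ultimately show ?case using reg by simp
next
  case (Suc r)
  then obtain X Y where XY: "regular_pencil (L + scaled_pencil n (- \<rho>) 1 r X Y)"
    "\<And>\<mu> j. \<mu> = Infty \<or> pencil_eigenvalue L \<mu> \<Longrightarrow>
       place_order (L + scaled_pencil n (- \<rho>) 1 r X Y) \<mu> j = place_order L \<mu> (r + j)"
    "\<And>z. \<not> pencil_eigenvalue L (Fin z) \<Longrightarrow>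
       Polynomial.order z (det (pencil_mat (L + scaled_pencil n (- \<rho>) 1 r X Y))) \<le> 1"
    by (auto simp: Let_def)
  define L' where "L' = L + scaled_pencil n (- \<rho>) 1 r X Y"
  note XY = XY[folded L'_def]
  have L': "L' \<in> carrier_pencil n" unfolding L'_def by (intro add_carrier_pencil L scaled_pencil_carrier)
  define Z where "Z = insert Infty (Fin ` ({z. poly (det (pencil_mat L)) z = 0} \<union> {z. poly (det (pencil_mat L')) z = 0}))"
  have eig: "pencil_eigenvalue L \<mu> \<Longrightarrow> \<mu> \<in> Z" for \<mu>
    using pencil_eigenvalue_Fin_iff[OF L] by (cases \<mu>) (auto simp: Z_def)
  have "finite Z"
    using reg XY(1) unfolding Z_def regular_pencil_iff[OF L] regular_pencil_iff[OF L']
    by (intro finite.insertI finite_imageI finite_UnI poly_roots_finite)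
  \<comment> \<open>The perturbation vanishes at \<open>\<rho>\<close>, so \<open>\<rho>\<close> never becomes an eigenvalue.\<close>
  have "pencil_at L' \<rho> = pencil_at L \<rho>"
    using L unfolding L'_def
    by (cases L) (auto simp: scaled_pencil_def plus_prod_def carrier_pencil_def algebra_simps intro!: eq_matI)
  then have "poly (det (pencil_mat L')) \<rho> \<noteq> 0" "poly (det (pencil_mat L)) \<rho> \<noteq> 0"
    using \<rho> by (simp_all add: poly_det_pencil_mat[OF L] poly_det_pencil_mat[OF L'])
  then have c: "poly (chart_scalar (- \<rho>) 1 \<mu>) (chart_point \<mu>) \<noteq> 0" if "\<mu> \<in> Z" for \<mu>
    using that unfolding Z_def by auto
  have roots: "poly (det (pencil_mat L')) z = 0 \<Longrightarrow> Fin z \<in> Z" for z by (simp add: Z_def)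
  obtain X1 Y1 where step: "regular_pencil (L' + scaled_pencil n (- \<rho>) 1 1 X1 Y1)"
    "\<And>\<mu> j. \<mu> \<in> Z \<Longrightarrow> place_order (L' + scaled_pencil n (- \<rho>) 1 1 X1 Y1) \<mu> j = place_order L' \<mu> (Suc j)"
    "\<And>z. Fin z \<notin> Z \<Longrightarrow> Polynomial.order z (det (pencil_mat (L' + scaled_pencil n (- \<rho>) 1 1 X1 Y1))) \<le> 1"
    using rank_one_step[OF L' XY(1) \<open>finite Z\<close> _ roots c] unfolding Z_def by blast
  have "scaled_pencil n (- \<rho>) 1 1 X1 Y1 = scaled_pencil n (- \<rho>) 1 1 (\<lambda>_. X1 0) (\<lambda>_. Y1 0)"
    by (simp add: scaled_pencil_def)
  then have sum: "L' + scaled_pencil n (- \<rho>) 1 1 X1 Y1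
      = L + scaled_pencil n (- \<rho>) 1 (Suc r) (X(r := X1 0)) (Y(r := Y1 0))"
    unfolding scaled_pencil_Suc L'_def
    using add_assoc_pencil[OF L scaled_pencil_carrier scaled_pencil_carrier] by simp
  have L'': "L' + scaled_pencil n (- \<rho>) 1 1 X1 Y1 \<in> carrier_pencil n"
    by (intro add_carrier_pencil L' scaled_pencil_carrier)
  have simple: "Polynomial.order z (det (pencil_mat (L' + scaled_pencil n (- \<rho>) 1 1 X1 Y1))) \<le> 1"
    if z: "\<not> pencil_eigenvalue L (Fin z)" for z
  proof (cases "Fin z \<in> Z")
    case True
    have "place_order L' (Fin z) 0 \<le> 1" using XY(3)[OF z] place_order_0[OF L' XY(1), of "Fin z"] by simp
    moreover have "place_order L' (Fin z) 1 \<le> place_order L' (Fin z) 0"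
      unfolding place_order_def
      by (rule rank_order_antimono[OF pencil_mat_carrier[OF chart_carrier[OF L']] det_chart_nonzero[OF L' XY(1)]]) simp
    ultimately have "place_order L' (Fin z) 1 \<le> 1" by simp
    then show ?thesis using step(2)[OF True, of 0] place_order_0[OF L'' step(1), of "Fin z"] by simp
  qed (rule step(3))
  have "place_order (L' + scaled_pencil n (- \<rho>) 1 1 X1 Y1) \<mu> j = place_order L \<mu> (Suc r + j)"
    if "\<mu> = Infty \<or> pencil_eigenvalue L \<mu>" for \<mu> j
    using that step(2)[of \<mu> j] XY(2)[OF that, of "Suc j"] eig by (auto simp: Z_def)
  then show ?case unfolding Let_def sum[symmetric] using step(1) simple by (metis sum)
qed

section \<open>Complexification of the parametrization\<close>

text \<open>The positions of the real and of the imaginary part of entry \<open>i\<close> of block \<open>b\<close> in \<open>realify\<close>.\<close>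

definition block_pos :: "nat \<Rightarrow> nat \<Rightarrow> nat \<Rightarrow> nat \<Rightarrow> nat \<Rightarrow> nat" where
  "block_pos n r s b i = 2 * (r - 2 * s) + (b * n + i)"

definition block_pos_im :: "nat \<Rightarrow> nat \<Rightarrow> nat \<Rightarrow> nat \<Rightarrow> nat \<Rightarrow> nat" where
  "block_pos_im n r s b i = 2 * (r - 2 * s) + (r + s) * n + (b * n + i)"

text \<open>For real \<open>y\<close>, the entries of the vectors of the parametrization and their complex conjugates. Both are
  linear in \<open>y\<close>, and for complex \<open>y\<close> they are independent of each other.\<close>

definition cblock :: "nat \<Rightarrow> nat \<Rightarrow> nat \<Rightarrow> (nat \<Rightarrow> complex) \<Rightarrow> nat \<Rightarrow> nat \<Rightarrow> complex" where
  "cblock n r s y b i = y (block_pos n r s b i) + \<i> * y (block_pos_im n r s b i)"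

definition cblock_conj :: "nat \<Rightarrow> nat \<Rightarrow> nat \<Rightarrow> (nat \<Rightarrow> complex) \<Rightarrow> nat \<Rightarrow> nat \<Rightarrow> complex" where
  "cblock_conj n r s y b i = y (block_pos n r s b i) - \<i> * y (block_pos_im n r s b i)"

fun ccoeffs :: "pencil_structure \<Rightarrow> complex \<Rightarrow> complex \<Rightarrow> complex \<times> complex" where
  "ccoeffs Skew_Hermitian a b = (\<i> * a, \<i> * b)"
| "ccoeffs Star_Even a b = (a, b * \<i>)"
| "ccoeffs Star_Odd a b = (a * \<i>, b)"
| "ccoeffs Star_Palindromic a b = (a - b * \<i>, a + b * \<i>)"
| "ccoeffs Star_Anti_Palindromic a b = (a + b * \<i>, - a + b * \<i>)"

text \<open>The factor of \<open>v\<^sup>*\<close> in a rank-two term, for \<open>w = (g, d)\<close>: up to sign \<open>w\<close>, \<open>w(-\<lambda>)\<close> or the reversal of \<open>w\<close>.\<close>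

fun partner :: "pencil_structure \<Rightarrow> complex \<times> complex \<Rightarrow> complex \<times> complex" where
  "partner Skew_Hermitian (g, d) = (- g, - d)"
| "partner Star_Even (g, d) = (g, - d)"
| "partner Star_Odd (g, d) = (- g, d)"
| "partner Star_Palindromic (g, d) = (d, g)"
| "partner Star_Anti_Palindromic (g, d) = (- d, - g)"

lemma partner_partner: "partner \<sigma> (partner \<sigma> gd) = gd"
  by (cases \<sigma>; cases gd) auto

lemma rank1_coeffs_eq: "rank1_coeffs \<sigma> a b = ccoeffs \<sigma> (of_real a) (of_real b)"
  by (cases \<sigma>) auto

lemma ccoeffs_surj: "\<exists>a b. ccoeffs \<sigma> a b = (\<alpha>, \<beta>)"
proof -
  have "ccoeffs Skew_Hermitian (- \<i> * \<alpha>) (- \<i> * \<beta>) = (\<alpha>, \<beta>)"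
    "ccoeffs Star_Even \<alpha> (- \<i> * \<beta>) = (\<alpha>, \<beta>)" "ccoeffs Star_Odd (- \<i> * \<alpha>) \<beta> = (\<alpha>, \<beta>)"
    "ccoeffs Star_Palindromic ((\<alpha> + \<beta>) / 2) (\<i> * (\<alpha> - \<beta>) / 2) = (\<alpha>, \<beta>)"
    "ccoeffs Star_Anti_Palindromic ((\<alpha> - \<beta>) / 2) (- \<i> * (\<alpha> + \<beta>) / 2) = (\<alpha>, \<beta>)"
    by (simp_all add: field_simps flip: mult.assoc)
  then show ?thesis by (cases \<sigma>) blast+
qed

text \<open>The entries of the image of \<open>\<Phi>\<close> as polynomials in complex parameters. The selector \<open>\<pi>\<close> picks the coefficient
  of \<open>1\<close> or of \<open>\<lambda>\<close>, and \<open>o2\<close> is the offset of the vectors \<open>\<gamma>\<close> or \<open>\<delta>\<close> accordingly.\<close>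

definition PhiC_entry :: "pencil_structure \<Rightarrow> nat \<Rightarrow> nat \<Rightarrow> nat \<Rightarrow> (nat \<Rightarrow> complex) \<Rightarrow>
    (complex \<times> complex \<Rightarrow> complex) \<Rightarrow> nat \<Rightarrow> nat \<Rightarrow> nat \<Rightarrow> complex" where
  "PhiC_entry \<sigma> n r s y \<pi> o2 p q = (let l = r - 2 * s; u = cblock n r s y; u' = cblock_conj n r s y in
     (\<Sum>i<l. \<pi> (ccoeffs \<sigma> (y (2 * i)) (y (2 * i + 1))) * u i p * u' i q) +
     (\<Sum>j<s. u (l + j) p * u' (l + o2 + j) q +
        \<pi> (partner \<sigma> (u (l + s + j) p, u (l + 2 * s + j) p)) * u' (l + j) q))"

definition PhiC :: "pencil_structure \<Rightarrow> nat \<Rightarrow> nat \<Rightarrow> nat \<Rightarrow> (nat \<Rightarrow> complex) \<Rightarrow> pencil" where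
  "PhiC \<sigma> n r s y = (mat n n (\<lambda>(p, q). PhiC_entry \<sigma> n r s y fst s p q),
     mat n n (\<lambda>(p, q). PhiC_entry \<sigma> n r s y snd (2 * s) p q))"

lemma PhiC_carrier: "PhiC \<sigma> n r s y \<in> carrier_pencil n"
  by (simp add: PhiC_def carrier_pencil_def)

lemma block_index_less:
  assumes "b < m" "i < n"
  shows "b * n + i < m * (n :: nat)"
proof -
  have "b * n + i < Suc b * n" using assms(2) by simp
  also have "\<dots> \<le> m * n" using assms(1) by (intro mult_le_mono1) simp
  finally show ?thesis .
qed

lemma index_append3_vec:
  "k < dim_vec v \<Longrightarrow> (x @\<^sub>v v @\<^sub>v w) $ (dim_vec x + k) = v $ k"
  "k < dim_vec w \<Longrightarrow> (x @\<^sub>v v @\<^sub>v w) $ (dim_vec x + dim_vec v + k) = w $ k"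
  by simp_all

lemma realify_blocks:
  assumes xz: "(x, z) \<in> param_space n r s" and b: "b < r + s" and i: "i < n"
  defines "y \<equiv> \<lambda>i. complex_of_real (realify (x, z) $ i)"
  shows "cblock n r s y b i = vec_block n z b $ i" "cblock_conj n r s y b i = cnj (vec_block n z b $ i)"
proof -
  have dims: "dim_vec x = 2 * (r - 2 * s)" "dim_vec z = (r + s) * n"
    using xz by (auto simp: param_space_def)
  have k: "b * n + i < (r + s) * n" by (rule block_index_less[OF b i])
  have "y (block_pos n r s b i) = of_real (Re (z $ (b * n + i)))"
    using index_append3_vec(1)[of "b * n + i" "map_vec Re z" x "map_vec Im z"] k
    unfolding y_def block_pos_def by (simp add: dims)
  moreover have "y (block_pos_im n r s b i) = of_real (Im (z $ (b * n + i)))"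
    using index_append3_vec(2)[of "b * n + i" "map_vec Im z" x "map_vec Re z"] k
    unfolding y_def block_pos_im_def by (simp add: dims)
  ultimately show "cblock n r s y b i = vec_block n z b $ i" "cblock_conj n r s y b i = cnj (vec_block n z b $ i)"
    unfolding cblock_def cblock_conj_def using i by (auto simp: vec_block_def complex_eq_iff)
qed

lemma Phi_eq_PhiC:
  assumes xz: "(x, z) \<in> param_space n r s" and s: "2 * s \<le> r"
  shows "Phi \<sigma> n r s (x, z) = PhiC \<sigma> n r s (\<lambda>i. complex_of_real (realify (x, z) $ i))"
proof -
  define y where "y = (\<lambda>i. complex_of_real (realify (x, z) $ i))"
  define l where "l = r - 2 * s"
  have dims: "x \<in> carrier_vec (2 * l)" using xz by (auto simp: param_space_def l_def)
  have x: "y (2 * i) = of_real (x $ (2 * i))" "y (2 * i + 1) = of_real (x $ (2 * i + 1))" if "i < l" for i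
    using that dims unfolding y_def by (auto simp: index_append_vec)
  have blk: "vec_block n z b $ i = cblock n r s y b i" "cnj (cblock n r s y b i) = cblock_conj n r s y b i"
    if "b < r + s" "i < n" for b i
    using realify_blocks[OF xz that] unfolding y_def by simp_all
  have dimb: "dim_vec (vec_block n z b) = n" for b by (simp add: vec_block_def)
  have r1: "fst (rank1_term \<sigma> (x $ (2 * i)) (x $ (2 * i + 1)) (vec_block n z i)) $$ (p, q)
        = fst (ccoeffs \<sigma> (y (2 * i)) (y (2 * i + 1))) * cblock n r s y i p * cblock_conj n r s y i q" (is ?A)
    "snd (rank1_term \<sigma> (x $ (2 * i)) (x $ (2 * i + 1)) (vec_block n z i)) $$ (p, q)
        = snd (ccoeffs \<sigma> (y (2 * i)) (y (2 * i + 1))) * cblock n r s y i p * cblock_conj n r s y i q" (is ?B)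
    if "i < l" "p < n" "q < n" for i p q
  proof -
    have "i < r + s" using that s by (simp add: l_def)
    then show ?A ?B
      using that x[OF that(1)]
      by (auto simp: rank1_term_def rank1_coeffs_eq outer_def dimb blk split: prod.splits)
  qed
  have r2: "fst (rank2_term \<sigma> (vec_block n z (l + j)) (vec_block n z (l + s + j), vec_block n z (l + 2 * s + j))) $$ (p, q)
        = cblock n r s y (l + j) p * cblock_conj n r s y (l + s + j) q +
          fst (partner \<sigma> (cblock n r s y (l + s + j) p, cblock n r s y (l + 2 * s + j) p)) * cblock_conj n r s y (l + j) q"
      (is ?A)
    "snd (rank2_term \<sigma> (vec_block n z (l + j)) (vec_block n z (l + s + j), vec_block n z (l + 2 * s + j))) $$ (p, q)
        = cblock n r s y (l + j) p * cblock_conj n r s y (l + 2 * s + j) q +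
          snd (partner \<sigma> (cblock n r s y (l + s + j) p, cblock n r s y (l + 2 * s + j) p)) * cblock_conj n r s y (l + j) q"
      (is ?B)
    if "j < s" "p < n" "q < n" for j p q
  proof -
    have "l + j < r + s" "l + s + j < r + s" "l + 2 * s + j < r + s" using that s by (auto simp: l_def)
    note b = blk[OF this(1)] blk[OF this(2)] blk[OF this(3)]
    show ?A using that by (cases \<sigma>) (auto simp: outer_def dimb b)
    show ?B using that by (cases \<sigma>) (auto simp: outer_def dimb b)
  qed
  have "Phi \<sigma> n r s (x, z) = PhiC \<sigma> n r s y"
    unfolding Phi.simps Let_def l_def[symmetric] PhiC_def pencil_sum_def
    by (auto simp: plus_prod_def PhiC_entry_def l_def[symmetric] Let_def r1[simplified] r2 intro!: eq_matI)
  then show ?thesis unfolding y_def .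
qed

lemma polyfun_pair: "scalar_polyfun m f \<Longrightarrow> scalar_polyfun m g \<Longrightarrow> poly_polyfun m (\<lambda>y. [:f y, g y:])"
proof -
  assume "scalar_polyfun m f" "scalar_polyfun m g"
  then have "poly_polyfun m (\<lambda>y. [:f y:] + [:0, 1:] * [:g y:])"
    by (intro polyfun.add polyfun.mult polyfun.const polyfun_poly_const)
  then show ?thesis by simp
qed

lemma polyfun_PhiC_entry:
  assumes s: "2 * s \<le> r" and pq: "p < n" "q < n" and o2: "o2 = s \<or> o2 = 2 * s" and \<pi>: "\<pi> = fst \<or> \<pi> = snd"
  shows "scalar_polyfun (2 * (r - 2 * s) + 2 * ((r + s) * n)) (\<lambda>y. PhiC_entry \<sigma> n r s y \<pi> o2 p q)"
proof -
  let ?m = "2 * (r - 2 * s) + 2 * ((r + s) * n)"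
  have b: "scalar_polyfun ?m (\<lambda>y. cblock n r s y b i)" "scalar_polyfun ?m (\<lambda>y. cblock_conj n r s y b i)"
    if "b < r + s" "i < n" for b i
    unfolding cblock_def cblock_conj_def using block_index_less[OF that]
    by (auto intro!: polyfun.add polyfun_diff polyfun.mult polyfun.const polyfun.coord
        simp: block_pos_def block_pos_im_def mult.commute)
  have c: "scalar_polyfun ?m (\<lambda>y. \<pi> (ccoeffs \<sigma> (y (2 * i)) (y (2 * i + 1))))" if "i < r - 2 * s" for i
  proof -
    have "scalar_polyfun ?m (\<lambda>y. y (2 * i))" "scalar_polyfun ?m (\<lambda>y. y (2 * i + 1))"
      using that by (auto intro!: polyfun.coord)
    then show ?thesis
      using \<pi> by (cases \<sigma>) (auto intro!: polyfun.add polyfun_diff polyfun_uminus polyfun.mult polyfun.const)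
  qed
  have pt: "scalar_polyfun ?m (\<lambda>y. \<pi> (partner \<sigma> (f y, g y)))"
    if "scalar_polyfun ?m f" "scalar_polyfun ?m g" for f g
    using \<pi> that by (cases \<sigma>) (auto intro!: polyfun_uminus)
  show ?thesis
    unfolding PhiC_entry_def Let_def
    by (intro polyfun.add polyfun_sum polyfun.mult c b pt) (use s pq o2 in auto)
qed

lemma polyfun_PhiC:
  assumes s: "2 * s \<le> r" and ij: "i < n" "j < n"
  shows "poly_polyfun (2 * (r - 2 * s) + 2 * ((r + s) * n)) (\<lambda>y. pencil_mat (chart \<mu> (PhiC \<sigma> n r s y)) $$ (i, j))"
proof -
  have "(\<lambda>y. pencil_mat (chart \<mu> (PhiC \<sigma> n r s y)) $$ (i, j))
      = (case \<mu> of Fin z \<Rightarrow> (\<lambda>y. [:PhiC_entry \<sigma> n r s y fst s i j, PhiC_entry \<sigma> n r s y snd (2 * s) i j:])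
         | Infty \<Rightarrow> (\<lambda>y. [:PhiC_entry \<sigma> n r s y snd (2 * s) i j, PhiC_entry \<sigma> n r s y fst s i j:]))"
    using ij by (cases \<mu>) (auto simp: pencil_mat_def PhiC_def)
  then show ?thesis
    using polyfun_pair[OF polyfun_PhiC_entry polyfun_PhiC_entry] s ij by (cases \<mu>) auto
qed

definition low_rank :: "nat \<Rightarrow> nat \<Rightarrow> complex poly mat \<Rightarrow> bool" where
  "low_rank n r M \<longleftrightarrow> (\<exists>X \<in> carrier_mat n r. \<exists>Y \<in> carrier_mat r n. M = X * Y)"

lemma low_rank_add:
  assumes "low_rank n r M" "low_rank n r' M'"
  shows "low_rank n (r + r') (M + M')"
proof -
  obtain X Y X' Y' where XY: "X \<in> carrier_mat n r" "Y \<in> carrier_mat r n" "M = X * Y"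
    and XY': "X' \<in> carrier_mat n r'" "Y' \<in> carrier_mat r' n" "M' = X' * Y'"
    using assms unfolding low_rank_def by blast
  obtain A B where "A \<in> carrier_mat n (r + r')" "B \<in> carrier_mat (r + r') n" "A * B = M + M'"
    using mult_append_cols_rows[OF XY(1,2) XY'(1,2)] unfolding XY(3) XY'(3) by blast
  then show ?thesis unfolding low_rank_def by metis
qed

lemma low_rank_1: "low_rank n 1 (mat n n (\<lambda>(p, q). f p * g q))"
proof -
  have "mat n n (\<lambda>(p, q). f p * g q) = mat n 1 (\<lambda>(p, _). f p) * mat 1 n (\<lambda>(_, q). g q)"
    by (rule eq_matI) (auto simp: scalar_prod_def)
  then show ?thesis unfolding low_rank_def by (metis mat_carrier)
qed

lemma low_rank_sum:
  assumes "\<And>k. k < K \<Longrightarrow> low_rank n c (mat n n (F k))"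
  shows "low_rank n (K * c) (mat n n (\<lambda>pq. \<Sum>k<K. F k pq))"
  using assms
proof (induction K)
  case 0
  have "mat n n (\<lambda>pq. \<Sum>k<0. F k pq) = 0\<^sub>m n 0 * 0\<^sub>m 0 n" by (rule eq_matI) (auto simp: scalar_prod_def)
  then show ?case unfolding low_rank_def by (metis mult_0 zero_carrier_mat)
next
  case (Suc K)
  have "mat n n (\<lambda>pq. \<Sum>k<Suc K. F k pq) = mat n n (F K) + mat n n (\<lambda>pq. \<Sum>k<K. F k pq)"
    by (rule eq_matI) auto
  then show ?case using low_rank_add[OF Suc.prems[of K] Suc.IH] Suc.prems by simp
qed

text \<open>Over \<open>\<complex>[x]\<close> a term \<open>(a + b x) u u\<^sup>*\<close> has rank one and a rank-two term is a sum of two products of a column and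
  a row; this gives \<open>l + 2 s = r\<close> products.\<close>

lemma low_rank_PhiC:
  assumes s: "2 * s \<le> r"
  shows "low_rank n r (pencil_mat (chart \<mu> (PhiC \<sigma> n r s y)))"
proof -
  define l where "l = r - 2 * s"
  define u u' where "u = cblock n r s y" and "u' = cblock_conj n r s y"
  define sw :: "complex \<Rightarrow> complex \<Rightarrow> complex poly" where
    "sw a b = (if \<mu> = Infty then [:b, a:] else [:a, b:])" for a b
  have sw_add: "sw (a + a') (b + b') = sw a b + sw a' b'" for a b a' b'
    by (simp add: sw_def)
  have sw_sum: "sw (\<Sum>k<K. f k) (\<Sum>k<K. g k) = (\<Sum>k<K. sw (f k) (g k))" for f g and K :: nat
    by (induction K) (auto simp: sw_add, simp add: sw_def)
  have sw_mult: "sw (a * c) (b * c) = sw a b * [:c:]" "sw (c * a) (c * b) = [:c:] * sw a b" for a b c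
    by (auto simp: sw_def)
  let ?c = "\<lambda>i. ccoeffs \<sigma> (y (2 * i)) (y (2 * i + 1))"
  let ?w = "\<lambda>j p. partner \<sigma> (u (l + s + j) p, u (l + 2 * s + j) p)"
  let ?F1 = "\<lambda>i (p, q). (sw (fst (?c i)) (snd (?c i)) * [:u i p:]) * [:u' i q:]"
  let ?F2 = "\<lambda>j (p, q). [:u (l + j) p:] * sw (u' (l + s + j) q) (u' (l + 2 * s + j) q)
      + sw (fst (?w j p)) (snd (?w j p)) * [:u' (l + j) q:]"
  have "pencil_mat (chart \<mu> (PhiC \<sigma> n r s y))
      = mat n n (\<lambda>pq. \<Sum>i<l. ?F1 i pq) + mat n n (\<lambda>pq. \<Sum>j<s. ?F2 j pq)"
  proof (rule eq_matI)
    fix p q assume "p < dim_row (mat n n (\<lambda>pq. \<Sum>i<l. ?F1 i pq) + mat n n (\<lambda>pq. \<Sum>j<s. ?F2 j pq))"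
      "q < dim_col (mat n n (\<lambda>pq. \<Sum>i<l. ?F1 i pq) + mat n n (\<lambda>pq. \<Sum>j<s. ?F2 j pq))"
    then have pq: "p < n" "q < n" by auto
    have "pencil_mat (chart \<mu> (PhiC \<sigma> n r s y)) $$ (p, q)
        = sw (PhiC_entry \<sigma> n r s y fst s p q) (PhiC_entry \<sigma> n r s y snd (2 * s) p q)"
      using pq by (cases \<mu>) (auto simp: pencil_mat_def PhiC_def sw_def)
    also have "\<dots> = (\<Sum>i<l. ?F1 i (p, q)) + (\<Sum>j<s. ?F2 j (p, q))"
      unfolding PhiC_entry_def Let_def l_def[symmetric] u_def[symmetric] u'_def[symmetric] sw_add sw_sum sw_mult prod.case ..
    finally show "pencil_mat (chart \<mu> (PhiC \<sigma> n r s y)) $$ (p, q)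
        = (mat n n (\<lambda>pq. \<Sum>i<l. ?F1 i pq) + mat n n (\<lambda>pq. \<Sum>j<s. ?F2 j pq)) $$ (p, q)"
      using pq by simp
  qed (cases \<mu>; simp add: pencil_mat_def PhiC_def)+
  moreover have 1: "low_rank n (l * 1) (mat n n (\<lambda>pq. \<Sum>i<l. ?F1 i pq))"
    by (rule low_rank_sum) (rule low_rank_1)
  moreover have 2: "low_rank n (s * (1 + 1)) (mat n n (\<lambda>pq. \<Sum>j<s. ?F2 j pq))"
  proof (rule low_rank_sum)
    fix j
    have "low_rank n (1 + 1) (mat n n (\<lambda>(p, q). [:u (l + j) p:] * sw (u' (l + s + j) q) (u' (l + 2 * s + j) q))
        + mat n n (\<lambda>(p, q). sw (fst (?w j p)) (snd (?w j p)) * [:u' (l + j) q:]))"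
      by (intro low_rank_add low_rank_1)
    also have "mat n n (\<lambda>(p, q). [:u (l + j) p:] * sw (u' (l + s + j) q) (u' (l + 2 * s + j) q))
        + mat n n (\<lambda>(p, q). sw (fst (?w j p)) (snd (?w j p)) * [:u' (l + j) q:]) = mat n n (?F2 j)"
      by (rule eq_matI) auto
    finally show "low_rank n (1 + 1) (mat n n (?F2 j))" .
  qed
  ultimately have "low_rank n (l * 1 + s * (1 + 1)) (pencil_mat (chart \<mu> (PhiC \<sigma> n r s y)))"
    using low_rank_add[OF 1 2] by (simp only:)
  moreover have "l * 1 + s * (1 + 1) = r" using s by (simp add: l_def)
  ultimately show ?thesis by simp
qed

lemma sum_split_pairs:
  "(\<Sum>k<l + 2 * s. f k) = (\<Sum>i<l. f i) + (\<Sum>j<s. f (l + 2 * j) + f (Suc (l + 2 * j)) :: 'a :: comm_monoid_add)"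
proof (induction s)
  case (Suc s)
  have "l + 2 * Suc s = Suc (Suc (l + 2 * s))" by simp
  then have "(\<Sum>k<l + 2 * Suc s. f k) = (\<Sum>k<l + 2 * s. f k) + f (l + 2 * s) + f (Suc (l + 2 * s))"
    by (simp only: sum.lessThan_Suc)
  then show ?case using Suc by (simp add: add.assoc)
qed simp

text \<open>For complex parameters \<open>u\<close> and \<open>u\<^sup>*\<close> are unrelated, and so are the four vectors of a rank-two term. Hence
  each rank-one term supplies one arbitrary product of a column and a row, each rank-two term supplies two.\<close>

lemma scaled_pencil_in_range_PhiC:
  assumes s: "2 * s \<le> r"
  shows "\<exists>y. PhiC \<sigma> n r s y = scaled_pencil n \<alpha> \<beta> r X Y"
proof -
  define l where "l = r - 2 * s"
  have r: "r = l + 2 * s" using s by (simp add: l_def)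
  obtain a b where ab: "ccoeffs \<sigma> a b = (\<alpha>, \<beta>)" using ccoeffs_surj by blast
  \<comment> \<open>The wanted blocks: each rank-two term carries two consecutive columns of \<open>X\<close> and rows of \<open>Y\<close>, the
    first through \<open>v w\<^sup>*\<close> and the second through the other summand.\<close>
  define zB where "zB k p = (if k < l then X k p else if k < l + s then X (l + 2 * (k - l)) p
    else if k < l + 2 * s then fst (partner \<sigma> (\<alpha> * X (Suc (l + 2 * (k - l - s))) p, \<beta> * X (Suc (l + 2 * (k - l - s))) p))
    else snd (partner \<sigma> (\<alpha> * X (Suc (l + 2 * (k - l - 2 * s))) p, \<beta> * X (Suc (l + 2 * (k - l - 2 * s))) p)))" for k p
  define wB where "wB k q = (if k < l then Y k q else if k < l + s then Y (Suc (l + 2 * (k - l))) q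
    else if k < l + 2 * s then \<alpha> * Y (l + 2 * (k - l - s)) q
    else \<beta> * Y (l + 2 * (k - l - 2 * s)) q)" for k q
  define N where "N = (r + s) * n"
  define y where "y i = (if i < 2 * l then if even i then a else b
    else if i < 2 * l + N then (zB ((i - 2 * l) div n) ((i - 2 * l) mod n) + wB ((i - 2 * l) div n) ((i - 2 * l) mod n)) / 2
    else (zB ((i - 2 * l - N) div n) ((i - 2 * l - N) mod n) - wB ((i - 2 * l - N) div n) ((i - 2 * l - N) mod n)) / (2 * \<i>))" for i
  have blk: "cblock n r s y k p = zB k p" "cblock_conj n r s y k p = wB k p" if "k < r + s" "p < n" for k p
  proof -
    have pos: "k * n + p < N" unfolding N_def by (rule block_index_less[OF that])
    have dm: "(k * n + p) div n = k" "(k * n + p) mod n = p" using that(2) by auto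
    have re: "y (block_pos n r s k p) = (zB k p + wB k p) / 2"
      unfolding block_pos_def l_def[symmetric] y_def using pos dm by simp
    have im: "y (block_pos_im n r s k p) = (zB k p - wB k p) / (2 * \<i>)"
      unfolding block_pos_im_def l_def[symmetric] N_def[symmetric] y_def using pos dm by simp
    show "cblock n r s y k p = zB k p" "cblock_conj n r s y k p = wB k p"
      unfolding cblock_def cblock_conj_def re im by (simp_all add: field_simps)
  qed
  have coeffs: "ccoeffs \<sigma> (y (2 * i)) (y (2 * i + 1)) = (\<alpha>, \<beta>)" if "i < l" for i
    using that ab by (simp add: y_def)
  have bounds: "k < r + s" if "k < l + 3 * s" for k using that r by simp
  have entry: "PhiC_entry \<sigma> n r s y fst s p q = \<alpha> * (\<Sum>k<r. X k p * Y k q)"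
    "PhiC_entry \<sigma> n r s y snd (2 * s) p q = \<beta> * (\<Sum>k<r. X k p * Y k q)" if pq: "p < n" "q < n" for p q
  proof -
    have 1: "(\<Sum>i<l. \<pi> (ccoeffs \<sigma> (y (2 * i)) (y (2 * i + 1))) * cblock n r s y i p * cblock_conj n r s y i q)
        = (\<Sum>i<l. \<pi> (\<alpha>, \<beta>) * (X i p * Y i q))" for \<pi> :: "complex \<times> complex \<Rightarrow> complex"
    proof (intro sum.cong refl)
      fix i assume "i \<in> {..<l}"
      moreover from this have "i < r + s" using r by simp
      ultimately show "\<pi> (ccoeffs \<sigma> (y (2 * i)) (y (2 * i + 1))) * cblock n r s y i p * cblock_conj n r s y i q
          = \<pi> (\<alpha>, \<beta>) * (X i p * Y i q)"
        using pq coeffs[of i] by (simp add: blk zB_def wB_def)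
    qed
    have 2: "cblock n r s y (l + j) p = X (l + 2 * j) p" "cblock_conj n r s y (l + j) q = Y (Suc (l + 2 * j)) q"
      "cblock_conj n r s y (l + s + j) q = \<alpha> * Y (l + 2 * j) q"
      "cblock_conj n r s y (l + 2 * s + j) q = \<beta> * Y (l + 2 * j) q"
      "partner \<sigma> (cblock n r s y (l + s + j) p, cblock n r s y (l + 2 * s + j) p)
        = (\<alpha> * X (Suc (l + 2 * j)) p, \<beta> * X (Suc (l + 2 * j)) p)" if "j < s" for j
    proof -
      have b: "l + j < r + s" "l + s + j < r + s" "l + 2 * s + j < r + s" using that r by auto
      show "cblock n r s y (l + j) p = X (l + 2 * j) p" "cblock_conj n r s y (l + j) q = Y (Suc (l + 2 * j)) q"
        "cblock_conj n r s y (l + s + j) q = \<alpha> * Y (l + 2 * j) q"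
        "cblock_conj n r s y (l + 2 * s + j) q = \<beta> * Y (l + 2 * j) q"
        using that pq b by (simp_all add: blk zB_def wB_def)
      have "(cblock n r s y (l + s + j) p, cblock n r s y (l + 2 * s + j) p)
          = partner \<sigma> (\<alpha> * X (Suc (l + 2 * j)) p, \<beta> * X (Suc (l + 2 * j)) p)"
        using that pq b by (simp add: blk zB_def)
      then show "partner \<sigma> (cblock n r s y (l + s + j) p, cblock n r s y (l + 2 * s + j) p)
        = (\<alpha> * X (Suc (l + 2 * j)) p, \<beta> * X (Suc (l + 2 * j)) p)"
        by (simp only: partner_partner)
    qed
    have split: "(\<Sum>k<r. X k p * Y k q) = (\<Sum>i<l. X i p * Y i q)
        + (\<Sum>j<s. X (l + 2 * j) p * Y (l + 2 * j) q + X (Suc (l + 2 * j)) p * Y (Suc (l + 2 * j)) q)"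
      unfolding r by (rule sum_split_pairs)
    have "(\<Sum>j<s. cblock n r s y (l + j) p * cblock_conj n r s y (l + s + j) q +
        fst (partner \<sigma> (cblock n r s y (l + s + j) p, cblock n r s y (l + 2 * s + j) p)) * cblock_conj n r s y (l + j) q)
      = (\<Sum>j<s. \<alpha> * (X (l + 2 * j) p * Y (l + 2 * j) q + X (Suc (l + 2 * j)) p * Y (Suc (l + 2 * j)) q))"
      by (intro sum.cong refl, simp only: 2 lessThan_iff fst_conv snd_conv, simp add: algebra_simps)
    then show "PhiC_entry \<sigma> n r s y fst s p q = \<alpha> * (\<Sum>k<r. X k p * Y k q)"
      unfolding PhiC_entry_def Let_def l_def[symmetric] 1 split
      by (simp only: sum_distrib_left distrib_left fst_conv snd_conv)
    have "(\<Sum>j<s. cblock n r s y (l + j) p * cblock_conj n r s y (l + 2 * s + j) q +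
        snd (partner \<sigma> (cblock n r s y (l + s + j) p, cblock n r s y (l + 2 * s + j) p)) * cblock_conj n r s y (l + j) q)
      = (\<Sum>j<s. \<beta> * (X (l + 2 * j) p * Y (l + 2 * j) q + X (Suc (l + 2 * j)) p * Y (Suc (l + 2 * j)) q))"
      by (intro sum.cong refl, simp only: 2 lessThan_iff fst_conv snd_conv, simp add: algebra_simps)
    then show "PhiC_entry \<sigma> n r s y snd (2 * s) p q = \<beta> * (\<Sum>k<r. X k p * Y k q)"
      unfolding PhiC_entry_def Let_def l_def[symmetric] 1 split
      by (simp only: sum_distrib_left distrib_left fst_conv snd_conv)
  qed
  have "PhiC \<sigma> n r s y = scaled_pencil n \<alpha> \<beta> r X Y"
    unfolding PhiC_def scaled_pencil_def using entry by (auto intro!: eq_matI)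
  then show ?thesis by blast
qed

section \<open>Simplicity as a polynomial condition\<close>

text \<open>The determinant is the resultant of \<open>h\<close> and its derivative, which vanishes when they have a common root.\<close>

lemma discriminant_nonzero_iff:
  fixes h :: "complex poly"
  assumes h: "h \<noteq> 0"
  shows "det (sylvester_mat_sub (degree h) (degree h - 1) h (pderiv h)) \<noteq> 0 \<longleftrightarrow>
    (\<forall>x. Polynomial.order x h \<le> 1)"
proof -
  have res: "det (sylvester_mat_sub (degree h) (degree h - 1) h (pderiv h)) = resultant h (pderiv h)"
    by (simp add: resultant_def sylvester_mat_def degree_pderiv)
  have common: "(\<exists>x. \<not> Polynomial.order x h \<le> 1) \<longleftrightarrow> degree (gcd h (pderiv h)) \<noteq> 0"
  proof
    assume "\<exists>x. \<not> Polynomial.order x h \<le> 1"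
    then obtain x where x: "\<not> Polynomial.order x h \<le> 1" ..
    then have root: "poly h x = 0" using order_root[of h x] by simp
    have "poly (pderiv h) x = 0"
      using x order_pderiv[OF h root] order_root[of "pderiv h" x] by auto
    then have "[:- x, 1:] dvd gcd h (pderiv h)" using root by (simp add: poly_eq_0_iff_dvd)
    moreover have "gcd h (pderiv h) \<noteq> 0" using h by simp
    ultimately have "degree [:- x, 1:] \<le> degree (gcd h (pderiv h))" by (rule dvd_imp_degree_le)
    then show "degree (gcd h (pderiv h)) \<noteq> 0" by simp
  next
    assume deg: "degree (gcd h (pderiv h)) \<noteq> 0"
    then have "\<not> constant (poly (gcd h (pderiv h)))" by (simp add: constant_degree)
    then obtain x where "poly (gcd h (pderiv h)) x = 0" using fundamental_theorem_of_algebra by blast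
    then have "[:- x, 1:] dvd gcd h (pderiv h)" by (simp add: poly_eq_0_iff_dvd)
    then have x: "poly h x = 0" "poly (pderiv h) x = 0" by (simp_all add: poly_eq_0_iff_dvd)
    have "pderiv h \<noteq> 0"
    proof
      assume "pderiv h = 0"
      then have "degree h = 0" by (simp add: pderiv_eq_0_iff)
      then show False using deg \<open>pderiv h = 0\<close> by simp
    qed
    then have "Polynomial.order x (pderiv h) \<noteq> 0" using x(2) order_root by blast
    then show "\<exists>x. \<not> Polynomial.order x h \<le> 1" using order_pderiv[OF h x(1)] by (intro exI[of _ x]) simp
  qed
  show ?thesis unfolding res resultant_0_gcd using common by blast
qed

text \<open>Division by a fixed polynomial is linear in the dividend. The degree bound makes the expansion of the
  dividend into monomials uniform in \<open>y\<close>.\<close>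

lemma polyfun_poly_div:
  assumes F: "poly_polyfun m F" and deg: "\<And>y. degree (F y) \<le> N"
  shows "poly_polyfun m (\<lambda>y. F y div g)"
proof -
  have "F y div g = (\<Sum>i\<le>N. [:coeff (F y) i:] * (monom 1 i div g))" for y
  proof -
    have sum: "(\<Sum>i\<in>I. f i) div g = (\<Sum>i\<in>I. f i div g)" if "finite I" for f :: "nat \<Rightarrow> complex poly" and I
      using that by (induction I rule: finite_induct) (auto simp: poly_div_add_left)
    have "F y = (\<Sum>i\<le>N. monom (coeff (F y) i) i)" using deg[of y] by (rule poly_as_sum_of_monoms'[symmetric])
    also have "\<dots> = (\<Sum>i\<le>N. Polynomial.smult (coeff (F y) i) (monom 1 i))" by (simp add: smult_monom)
    finally have "F y div g = (\<Sum>i\<le>N. Polynomial.smult (coeff (F y) i) (monom 1 i)) div g" by simp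
    then show ?thesis by (simp add: sum div_smult_left)
  qed
  then show ?thesis
    by (simp only:) (intro polyfun_sum polyfun.mult polyfun.const polyfun_poly_const polyfun_coeff F)
qed

lemma polyfun_if:
  "polyfun \<iota> m f \<Longrightarrow> polyfun \<iota> m g \<Longrightarrow> polyfun \<iota> m (\<lambda>y. if b then f y else g y)"
  by (cases b) simp_all

lemma order_prod_linear_powers:
  fixes z :: complex
  assumes "finite S"
  shows "Polynomial.order z (\<Prod>w\<in>S. [:- w, 1:] ^ k w) = (if z \<in> S then k z else 0)"
  using assms
proof (induction S rule: finite_induct)
  case (insert w S)
  have "[:- w, 1:] ^ k w * (\<Prod>w\<in>S. [:- w, 1:] ^ k w) \<noteq> 0" using insert.hyps by simp
  moreover have "Polynomial.order z ([:- w, 1:] ^ k w) = (if z = w then k z else 0)"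
  proof (cases "z = w")
    case True
    then show ?thesis by (simp only: order_power_n_n if_True refl)
  next
    case False
    then show ?thesis by (simp add: order_0I)
  qed
  ultimately show ?case using insert by (auto simp: order_mult)
qed simp

lemma prod_linear_powers_dvd:
  fixes f :: "complex poly"
  assumes "finite S" and f: "f \<noteq> 0" and "\<And>z. z \<in> S \<Longrightarrow> k z \<le> Polynomial.order z f"
  shows "(\<Prod>w\<in>S. [:- w, 1:] ^ k w) dvd f"
  using assms(1,3)
proof (induction S rule: finite_induct)
  case (insert w S)
  then obtain q where q: "f = (\<Prod>w\<in>S. [:- w, 1:] ^ k w) * q" by (auto elim: dvdE)
  have nz: "(\<Prod>w\<in>S. [:- w, 1:] ^ k w) * q \<noteq> 0" using f q by simp
  have "Polynomial.order w f = Polynomial.order w q"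
    unfolding q order_mult[OF nz] order_prod_linear_powers[OF insert.hyps(1)] using insert.hyps(2) by simp
  then have "[:- w, 1:] ^ k w dvd q" using insert.prems[of w] unfolding order_divides by simp
  then have "[:- w, 1:] ^ k w * (\<Prod>w\<in>S. [:- w, 1:] ^ k w) dvd q * (\<Prod>w\<in>S. [:- w, 1:] ^ k w)"
    by (rule mult_dvd_mono) simp
  then show ?case using insert.hyps by (simp only: prod.insert[OF insert.hyps] q mult.commute)
qed simp

lemma polyfun_discriminant:
  assumes F: "poly_polyfun m F"
  shows "scalar_polyfun m (\<lambda>y. det (sylvester_mat_sub D D' (F y) (pderiv (F y))))"
proof (rule polyfun_det)
  fix i j assume ij: "i < D + D'" "j < D + D'"
  have c: "scalar_polyfun m (\<lambda>y. coeff (F y) k)" "scalar_polyfun m (\<lambda>y. coeff (pderiv (F y)) k)" for k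
    using polyfun_coeff[OF F] unfolding coeff_pderiv by (auto intro: polyfun.intros)
  show "scalar_polyfun m (\<lambda>y. sylvester_mat_sub D D' (F y) (pderiv (F y)) $$ (i, j))"
    unfolding sylvester_mat_sub_index[OF ij]
    by (intro polyfun_if c polyfun.const)
qed auto

lemma realify_image:
  "realify ` {xz \<in> param_space n r s. P (realify xz)}
    = {v \<in> carrier_vec (2 * (r - 2 * s) + 2 * (r + s) * n). P v}" (is "?A = ?B")
proof
  define l where "l = 2 * (r - 2 * s)"
  define N where "N = (r + s) * n"
  have lN: "2 * (r - 2 * s) + 2 * (r + s) * n = l + (N + N)" by (simp add: l_def N_def mult.assoc)
  have dim: "realify xz \<in> carrier_vec (l + (N + N))" if "xz \<in> param_space n r s" for xz
  proof -
    obtain x z where xz: "xz = (x, z)" by (cases xz)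
    have "dim_vec x = l" "dim_vec z = N"
      using that unfolding xz param_space_def l_def[symmetric] N_def[symmetric] by auto
    then show ?thesis unfolding xz by (intro carrier_vecI) simp
  qed
  then show "?A \<subseteq> ?B" unfolding lN by blast
  show "?B \<subseteq> ?A"
  proof
    fix v assume v: "v \<in> ?B"
    have dv: "dim_vec v = l + (N + N)" using v unfolding lN by auto
    define x where "x = vec l (\<lambda>i. v $ i)"
    define z where "z = vec N (\<lambda>i. Complex (v $ (l + i)) (v $ (l + N + i)))"
    have realify: "realify (x, z) = v"
      by (rule eq_vecI) (auto simp: x_def z_def dv not_less)
    have "(x, z) \<in> param_space n r s"
      unfolding param_space_def l_def[symmetric] N_def[symmetric] by (simp add: x_def z_def)
    then have "(x, z) \<in> {xz \<in> param_space n r s. P (realify xz)}" using v unfolding mem_Collect_eq realify by blast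
    then show "v \<in> ?A" using realify by (metis imageI)
  qed
qed

section \<open>Generic structured perturbations\<close>

theorem theorem22:
  fixes n r :: nat and \<sigma> :: pencil_structure and L :: pencil
  assumes "L \<in> carrier_pencil n"
    and "has_structure \<sigma> L"
    and "regular_pencil L"
    and "r > 0"
  shows "\<forall>s \<le> r div 2. \<exists>G. generic_params n r s G \<and>
    (\<forall>E \<in> Phi \<sigma> n r s ` G.
       regular_pencil (L + E) \<and>
       (\<forall>\<mu>. pencil_eigenvalue L \<mu> \<longrightarrow>
          partial_mults (L + E) \<mu> = drop r (partial_mults L \<mu>) \<and>
          (length (partial_mults L \<mu>) \<le> r \<longrightarrow> \<not> pencil_eigenvalue (L + E) \<mu>)) \<and>
       (\<forall>\<mu>. pencil_eigenvalue (L + E) \<mu> \<and> \<not> pencil_eigenvalue L \<mu> \<longrightarrow>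
          simple_eigenvalue (L + E) \<mu>))"
proof (intro allI impI)
  fix s assume "s \<le> r div 2"
  then have s: "2 * s \<le> r" by simp
  note L = assms(1) and reg = assms(3)
  define m where "m = 2 * (r - 2 * s) + 2 * (r + s) * n"
  have m: "m = 2 * (r - 2 * s) + 2 * ((r + s) * n)" by (simp add: m_def mult.assoc)
  let ?L = "\<lambda>y. L + PhiC \<sigma> n r s y"
  have Ly: "?L y \<in> carrier_pencil n" for y by (intro add_carrier_pencil L PhiC_carrier)
  have PM: "pencil_mat (chart \<mu> (?L y)) \<in> carrier_mat n n" for \<mu> y by (intro pencil_mat_carrier chart_carrier Ly)
  define R where "R = {z. poly (det (pencil_mat L)) z = 0}"
  have finR: "finite R" using reg regular_pencil_iff[OF L] unfolding R_def by (intro poly_roots_finite) blast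
  define P where "P = insert Infty (Fin ` R)"
  have eigP: "\<mu> \<in> P" if "pencil_eigenvalue L \<mu>" for \<mu>
    using that pencil_eigenvalue_Fin_iff[OF L] by (cases \<mu>) (auto simp: P_def R_def)
  have P_char: "\<mu> = Infty \<or> pencil_eigenvalue L \<mu>" if "\<mu> \<in> P" for \<mu>
    using that pencil_eigenvalue_Fin_iff[OF L] unfolding P_def R_def by blast
  \<comment> \<open>Every member of the family is a perturbation of rank at most \<open>r\<close>.\<close>
  have lower: "place_order L \<mu> (r + j) \<le> place_order (?L y) \<mu> j" if "regular_pencil (?L y)" for \<mu> j y
  proof -
    obtain X Y where XY: "X \<in> carrier_mat n r" "Y \<in> carrier_mat r n"
      and E: "pencil_mat (chart \<mu> (PhiC \<sigma> n r s y)) = X * Y"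
      using low_rank_PhiC[OF s] unfolding low_rank_def by blast
    have eq: "pencil_mat (chart \<mu> (?L y)) = pencil_mat (chart \<mu> L) + X * Y"
      unfolding chart_add pencil_mat_add[OF chart_carrier[OF L] chart_carrier[OF PhiC_carrier]] E ..
    show ?thesis
      using rank_order_add[OF pencil_mat_carrier[OF chart_carrier[OF L]] XY, of \<mu> "chart_point \<mu>" j]
        det_chart_nonzero[OF Ly that, of \<mu>] unfolding place_order_def eq by blast
  qed
  \<comment> \<open>At the complex parameter \<open>y0\<close> the perturbed pencil has all the required properties.\<close>
  obtain \<rho> where "det (pencil_at L \<rho>) \<noteq> 0" using reg unfolding regular_pencil_def by blast
  then obtain X Y where XY: "regular_pencil (L + scaled_pencil n (- \<rho>) 1 r X Y)"
    "\<And>\<mu> j. \<mu> = Infty \<or> pencil_eigenvalue L \<mu> \<Longrightarrow>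
       place_order (L + scaled_pencil n (- \<rho>) 1 r X Y) \<mu> j = place_order L \<mu> (r + j)"
    "\<And>z. \<not> pencil_eigenvalue L (Fin z) \<Longrightarrow>
       Polynomial.order z (det (pencil_mat (L + scaled_pencil n (- \<rho>) 1 r X Y))) \<le> 1"
    using exists_generic_scaled_pencil[OF L reg, of \<rho> r] unfolding Let_def by blast
  obtain y0 where "PhiC \<sigma> n r s y0 = scaled_pencil n (- \<rho>) 1 r X Y"
    using scaled_pencil_in_range_PhiC[OF s] by blast
  note y0 = XY[folded this]
  \<comment> \<open>\<open>F \<mu> j\<close> is a perturbation of rank \<open>j\<close> that attains \<open>place_order\<close> for \<open>j\<close> at \<open>y0\<close>. The same matrix is
    used for all parameters \<open>y\<close>, which turns the upper bound \<open>e \<mu> j\<close> for \<open>place_order\<close> into the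
    nonvanishing of one polynomial in \<open>y\<close>.\<close>
  define e where "e \<mu> j = place_order L \<mu> (r + j)" for \<mu> j
  define attains where "attains \<mu> j F \<longleftrightarrow> (\<exists>X \<in> carrier_mat n j. \<exists>Y \<in> carrier_mat j n. F = X * Y) \<and>
      taylor_coeff (chart_point \<mu>) (e \<mu> j) (det (pencil_mat (chart \<mu> (?L y0)) + F)) \<noteq> 0" for \<mu> j F
  define F where "F \<mu> j = (SOME F. attains \<mu> j F)" for \<mu> j
  have F: "attains \<mu> j (F \<mu> j)" if "\<mu> \<in> P" for \<mu> j
    unfolding F_def
  proof (rule someI_ex)
    obtain X Y where XY: "X \<in> carrier_mat n j" "Y \<in> carrier_mat j n" and nz: "det (pencil_mat (chart \<mu> (?L y0)) + X * Y) \<noteq> 0"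
      and "Polynomial.order (chart_point \<mu>) (det (pencil_mat (chart \<mu> (?L y0)) + X * Y)) = place_order (?L y0) \<mu> j"
      using rank_order_attained[OF PM det_chart_nonzero[OF Ly y0(1)]] unfolding place_order_def by metis
    then have "taylor_coeff (chart_point \<mu>) (e \<mu> j) (det (pencil_mat (chart \<mu> (?L y0)) + X * Y)) \<noteq> 0"
      using taylor_coeff_order[OF nz, of "chart_point \<mu>"] y0(2)[OF P_char[OF that], of j] unfolding e_def by simp
    then have "attains \<mu> j (X * Y)" using XY unfolding attains_def by blast
    then show "\<exists>F. attains \<mu> j F" by blast
  qed
  have Fc: "F \<mu> j \<in> carrier_mat n n" if "\<mu> \<in> P" for \<mu> j using F[OF that, of j] unfolding attains_def by auto
  define g where "g = (\<Prod>z\<in>R. [:- z, 1:] ^ e (Fin z) 0)"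
  define h where "h y = det (pencil_mat (?L y)) div g" for y
  define D where "D = degree (h y0)"
  define cond where "cond k y = (case k of
      Some (\<mu>, j) \<Rightarrow> taylor_coeff (chart_point \<mu>) (e \<mu> j) (det (pencil_mat (chart \<mu> (?L y)) + F \<mu> j))
    | None \<Rightarrow> det (sylvester_mat_sub D (D - 1) (h y) (pderiv (h y))))" for k y
  define K where "K = insert None (Some ` (P \<times> {..n}))"
  have finK: "finite K" unfolding K_def P_def using finR by simp
  have polydet: "poly_polyfun m (\<lambda>y. det (pencil_mat (chart \<mu> (?L y)) + M))" if "M \<in> carrier_mat n n" for \<mu> M
  proof (rule polyfun_det)
    show "pencil_mat (chart \<mu> (?L y)) + M \<in> carrier_mat n n" for y using that by simp
    fix i j assume ij: "i < n" "j < n"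
    have "(\<lambda>y. (pencil_mat (chart \<mu> (?L y)) + M) $$ (i, j))
        = (\<lambda>y. (pencil_mat (chart \<mu> L) $$ (i, j) + pencil_mat (chart \<mu> (PhiC \<sigma> n r s y)) $$ (i, j)) + M $$ (i, j))"
      using ij that pencil_mat_carrier[OF chart_carrier[OF PhiC_carrier], of \<mu> \<sigma> n r s]
      unfolding chart_add pencil_mat_add[OF chart_carrier[OF L] chart_carrier[OF PhiC_carrier]]
      by (auto simp: pencil_mat_carrier[OF chart_carrier[OF PhiC_carrier], THEN carrier_matD(1)]
          pencil_mat_carrier[OF chart_carrier[OF PhiC_carrier], THEN carrier_matD(2)])
    then show "poly_polyfun m (\<lambda>y. (pencil_mat (chart \<mu> (?L y)) + M) $$ (i, j))"
      unfolding m by (simp only:) (intro polyfun.add polyfun.const polyfun_PhiC s ij)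
  qed
  have polyh: "poly_polyfun m h"
    unfolding h_def
  proof (rule polyfun_poly_div)
    have "pencil_mat (?L y) + 0\<^sub>m n n = pencil_mat (?L y)" for y using PM[of "Fin 0" y] by simp
    then show "poly_polyfun m (\<lambda>y. det (pencil_mat (?L y)))" using polydet[of "0\<^sub>m n n" "Fin 0"] by simp
    show "degree (det (pencil_mat (?L y))) \<le> n" for y
      using degree_det_le[of n "pencil_mat (?L y)" 1] PM[of "Fin 0" y] by (simp add: pencil_mat_index[OF Ly])
  qed
  have poly_cond: "scalar_polyfun m (cond k)" if "k \<in> K" for k
  proof (cases k)
    case None
    then show ?thesis unfolding cond_def by (simp add: polyfun_discriminant[OF polyh])
  next
    case (Some \<mu>j)
    then obtain \<mu> j where k: "k = Some (\<mu>, j)" by (cases \<mu>j) auto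
    then have "\<mu> \<in> P" using that by (auto simp: K_def)
    then show ?thesis unfolding cond_def k by (simp add: polyfun_coeff polyfun_pcompose polydet[OF Fc])
  qed
  \<comment> \<open>For \<open>j = 0\<close> the matrix \<open>F \<mu> j\<close> is zero, so the condition at \<open>\<infinity>\<close> alone forces regularity.\<close>
  have reg_cond: "regular_pencil (?L y)" if y: "\<forall>k\<in>Some ` (P \<times> {..n}). cond k y \<noteq> 0" for y
  proof -
    have "Infty \<in> P" by (simp add: P_def)
    then have "taylor_coeff 0 (e Infty 0) (det (pencil_mat (chart Infty (?L y)) + F Infty 0)) \<noteq> 0"
      using bspec[OF y, of "Some (Infty, 0)"] by (auto simp: cond_def)
    moreover have "F Infty 0 = 0\<^sub>m n n"
      using F[OF \<open>Infty \<in> P\<close>, of 0] unfolding attains_def by (auto simp: scalar_prod_def intro!: eq_matI)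
    ultimately have "det (pencil_mat (chart Infty (?L y))) \<noteq> 0"
      using taylor_coeff_nonzero(1) PM[of Infty y] by fastforce
    then show ?thesis by (rule regular_pencil_of_chart[OF Ly])
  qed
  have exact: "place_order (?L y) \<mu> j = e \<mu> j"
    if y: "\<forall>k\<in>Some ` (P \<times> {..n}). cond k y \<noteq> 0" and \<mu>: "\<mu> \<in> P" for y \<mu> j
  proof (cases "j \<le> n")
    case True
    have "taylor_coeff (chart_point \<mu>) (e \<mu> j) (det (pencil_mat (chart \<mu> (?L y)) + F \<mu> j)) \<noteq> 0"
      using bspec[OF y, of "Some (\<mu>, j)"] \<mu> True by (auto simp: cond_def)
    note nz = taylor_coeff_nonzero[OF this]
    obtain X Y where XY: "X \<in> carrier_mat n j" "Y \<in> carrier_mat j n" "F \<mu> j = X * Y"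
      using F[OF \<mu>, of j] unfolding attains_def by blast
    have "place_order (?L y) \<mu> j \<le> e \<mu> j"
      using rank_order_le[OF PM XY(1,2) nz(1)[unfolded XY(3)], of "chart_point \<mu>"] nz(2)
      unfolding place_order_def XY(3) by linarith
    then show ?thesis using lower[OF reg_cond[OF y], of \<mu> j] unfolding e_def by simp
  next
    case False
    then show ?thesis
      using place_order_beyond[OF Ly reg_cond[OF y]] place_order_beyond[OF L reg] unfolding e_def by simp
  qed
  have g0: "g \<noteq> 0" unfolding g_def using finR by simp
  \<comment> \<open>\<open>g\<close> collects the roots at the old eigenvalues, so the roots of \<open>h y\<close> are the new eigenvalues. The
    condition at \<open>\<infinity>\<close> fixes the degree of the determinant, hence \<open>degree (h y) = D\<close>; this makes the
    Sylvester matrix of fixed size compute the discriminant of \<open>h y\<close>.\<close>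
  have factor: "det (pencil_mat (?L y)) = h y * g" "h y \<noteq> 0"
    "degree (h y) = n - e Infty 0 - degree g"
    "\<And>z. z \<in> R \<Longrightarrow> poly (h y) z \<noteq> 0"
    "\<And>z. z \<notin> R \<Longrightarrow> Polynomial.order z (h y) = Polynomial.order z (det (pencil_mat (?L y)))"
    if y: "\<forall>k\<in>Some ` (P \<times> {..n}). cond k y \<noteq> 0" for y
  proof -
    note regy = reg_cond[OF y]
    have det: "det (pencil_mat (?L y)) \<noteq> 0" using regy regular_pencil_iff[OF Ly] by blast
    have ordR: "Polynomial.order z (det (pencil_mat (?L y))) = e (Fin z) 0" if "z \<in> R" for z
      using exact[OF y, of "Fin z" 0] place_order_0[OF Ly regy, of "Fin z"] that by (simp add: P_def)
    have "g dvd det (pencil_mat (?L y))"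
      unfolding g_def by (rule prod_linear_powers_dvd[OF finR det]) (simp add: ordR)
    then show fac: "det (pencil_mat (?L y)) = h y * g" by (simp add: h_def)
    then show h0: "h y \<noteq> 0" using det by auto
    have deg_le: "degree (det (pencil_mat (?L y))) \<le> n" by (rule det_rev_pencil(1)[OF Ly det])
    have "n - degree (det (pencil_mat (?L y))) = e Infty 0"
      using order_0_det_rev_pencil(2)[OF Ly det] exact[OF y, of Infty 0] place_order_0[OF Ly regy, of Infty]
      by (simp add: P_def)
    then have "degree (det (pencil_mat (?L y))) = n - e Infty 0" using deg_le by simp
    then show "degree (h y) = n - e Infty 0 - degree g"
      using degree_mult_eq[OF h0 g0] unfolding fac by simp
    have ord: "Polynomial.order z (det (pencil_mat (?L y))) = Polynomial.order z (h y) + (if z \<in> R then e (Fin z) 0 else 0)" for z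
      using h0 g0 order_prod_linear_powers[OF finR, of z "\<lambda>z. e (Fin z) 0"] unfolding fac g_def[symmetric]
      by (simp add: order_mult)
    show "poly (h y) z \<noteq> 0" if "z \<in> R" for z
      using ord[of z] ordR[OF that] that h0 order_root[of "h y" z] by simp
    show "Polynomial.order z (h y) = Polynomial.order z (det (pencil_mat (?L y)))" if "z \<notin> R" for z
      using ord[of z] that by simp
  qed
  have y0_cond: "cond k y0 \<noteq> 0" if "k \<in> K" for k
  proof -
    have some: "\<forall>k\<in>Some ` (P \<times> {..n}). cond k y0 \<noteq> 0"
      using F unfolding attains_def by (auto simp: cond_def)
    have "Polynomial.order x (h y0) \<le> 1" for x
    proof (cases "x \<in> R")
      case True
      then show ?thesis using factor(4)[OF some] by (simp add: order_0I)
    next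
      case False
      then show ?thesis using factor(5)[OF some False] y0(3)[of x] pencil_eigenvalue_Fin_iff[OF L]
        by (simp add: R_def)
    qed
    then have "cond None y0 \<noteq> 0"
      using discriminant_nonzero_iff[OF factor(2)[OF some]] by (simp add: cond_def D_def)
    then show ?thesis using some that unfolding K_def by blast
  qed
  have D: "D = n - e Infty 0 - degree g"
    unfolding D_def by (rule factor(3)) (use y0_cond in \<open>auto simp: K_def\<close>)
  define G where "G = {xz \<in> param_space n r s. \<forall>k\<in>K. cond k (\<lambda>i. complex_of_real (realify xz $ i)) \<noteq> 0}"
  have "generic_params n r s G"
    unfolding generic_params_def
  proof
    show "G \<subseteq> param_space n r s" unfolding G_def by blast
    have "generic_in m {x \<in> carrier_vec m. \<forall>k\<in>K. cond k (\<lambda>i. complex_of_real (x $ i)) \<noteq> 0}"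
      using generic_in_polyfun[OF finK] poly_cond y0_cond by blast
    then show "generic_in (2 * (r - 2 * s) + 2 * (r + s) * n) (realify ` G)"
      unfolding G_def m_def
        realify_image[where P = "\<lambda>v. \<forall>k\<in>K. cond k (\<lambda>i. complex_of_real (v $ i)) \<noteq> 0"] .
  qed
  moreover have "regular_pencil (L + E) \<and>
       (\<forall>\<mu>. pencil_eigenvalue L \<mu> \<longrightarrow>
          partial_mults (L + E) \<mu> = drop r (partial_mults L \<mu>) \<and>
          (length (partial_mults L \<mu>) \<le> r \<longrightarrow> \<not> pencil_eigenvalue (L + E) \<mu>)) \<and>
       (\<forall>\<mu>. pencil_eigenvalue (L + E) \<mu> \<and> \<not> pencil_eigenvalue L \<mu> \<longrightarrow>
          simple_eigenvalue (L + E) \<mu>)" if E_in: "E \<in> Phi \<sigma> n r s ` G" for E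
  proof -
    obtain xz where "xz \<in> G" "E = Phi \<sigma> n r s xz" using E_in by (rule imageE)
    then obtain x z where xz: "(x, z) \<in> G" "E = Phi \<sigma> n r s (x, z)" by (cases xz) blast
    define y where "y = (\<lambda>i. complex_of_real (realify (x, z) $ i))"
    have E: "E = PhiC \<sigma> n r s y"
      unfolding xz(2) y_def by (rule Phi_eq_PhiC[OF _ s]) (use xz in \<open>auto simp: G_def\<close>)
    have yK: "cond k y \<noteq> 0" if "k \<in> K" for k using xz(1) that unfolding G_def y_def by blast
    then have y: "\<forall>k\<in>Some ` (P \<times> {..n}). cond k y \<noteq> 0" by (simp add: K_def)
    note regy = reg_cond[OF y]
    have not_eig: "\<not> pencil_eigenvalue (?L y) \<mu>" if "place_order (?L y) \<mu> 0 = 0" for \<mu>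
    proof -
      have "poly (det (pencil_mat (chart \<mu> (?L y)))) (chart_point \<mu>) \<noteq> 0"
        using that[unfolded place_order_0[OF Ly regy]] det_chart_nonzero[OF Ly regy, of \<mu>]
          order_root[of "det (pencil_mat (chart \<mu> (?L y)))" "chart_point \<mu>"] by simp
      then show ?thesis unfolding pencil_eigenvalue_chart[OF Ly] .
    qed
    have mults: "partial_mults (?L y) \<mu> = drop r (partial_mults L \<mu>)" if "pencil_eigenvalue L \<mu>" for \<mu>
    proof (rule tail_sums_eq_imp_eq)
      show "0 \<notin> set (partial_mults (?L y) \<mu>)" by (rule partial_mults_tail_sums(1)[OF Ly regy])
      show "0 \<notin> set (drop r (partial_mults L \<mu>))"
        using partial_mults_tail_sums(1)[OF L reg, of \<mu>] by (auto dest: in_set_dropD)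
      show "sum_list (drop j (partial_mults (?L y) \<mu>)) = sum_list (drop j (drop r (partial_mults L \<mu>)))" for j
        using exact[OF y eigP[OF that], of j]
        unfolding drop_drop partial_mults_tail_sums(2)[OF Ly regy] partial_mults_tail_sums(2)[OF L reg]
          place_order_def[symmetric] e_def by (simp add: add.commute)
    qed
    have gone: "\<not> pencil_eigenvalue (?L y) \<mu>" if "pencil_eigenvalue L \<mu>" "length (partial_mults L \<mu>) \<le> r" for \<mu>
    proof (rule not_eig)
      have "sum_list (drop 0 (partial_mults (?L y) \<mu>)) = 0" using mults[OF that(1)] that(2) by simp
      then show "place_order (?L y) \<mu> 0 = 0"
        unfolding partial_mults_tail_sums(2)[OF Ly regy] place_order_def .
    qed
    have simple: "simple_eigenvalue (?L y) \<mu>" if new: "pencil_eigenvalue (?L y) \<mu>" "\<not> pencil_eigenvalue L \<mu>" for \<mu>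
    proof (cases \<mu>)
      case (Fin z)
      then have zR: "z \<notin> R" using new(2) pencil_eigenvalue_Fin_iff[OF L] by (simp add: R_def)
      have "cond None y \<noteq> 0" by (rule yK) (simp add: K_def)
      then have "Polynomial.order z (h y) \<le> 1"
        using discriminant_nonzero_iff[OF factor(2)[OF y]] factor(3)[OF y] D by (simp add: cond_def)
      then have "place_order (?L y) \<mu> 0 \<le> 1"
        using factor(5)[OF y zR] place_order_0[OF Ly regy, of \<mu>] Fin by simp
      moreover have "place_order (?L y) \<mu> 0 \<noteq> 0" using not_eig new(1) by blast
      moreover have "alg_mult (?L y) \<mu> = place_order (?L y) \<mu> 0"
        using partial_mults_tail_sums(2)[OF Ly regy, of 0 \<mu>] unfolding alg_mult_def place_order_def by simp
      ultimately show ?thesis using new(1) unfolding simple_eigenvalue_def by simp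
    next
      case Infty
      have "place_order L \<mu> 0 = 0"
        using new(2) unfolding place_order_0[OF L reg] pencil_eigenvalue_chart[OF L] by (rule order_0I)
      moreover have "place_order L \<mu> (r + 0) \<le> place_order L \<mu> 0"
        unfolding place_order_def
        by (rule rank_order_antimono[OF pencil_mat_carrier[OF chart_carrier[OF L]] det_chart_nonzero[OF L reg]]) simp
      ultimately have "place_order (?L y) \<mu> 0 = 0"
        using exact[OF y, of \<mu> 0] Infty by (simp add: P_def e_def)
      then show ?thesis using not_eig new(1) by blast
    qed
    show ?thesis unfolding E using regy mults gone simple by blast
  qed
  ultimately show "\<exists>G. generic_params n r s G \<and>
    (\<forall>E \<in> Phi \<sigma> n r s ` G.
       regular_pencil (L + E) \<and>
       (\<forall>\<mu>. pencil_eigenvalue L \<mu> \<longrightarrow>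
          partial_mults (L + E) \<mu> = drop r (partial_mults L \<mu>) \<and>
          (length (partial_mults L \<mu>) \<le> r \<longrightarrow> \<not> pencil_eigenvalue (L + E) \<mu>)) \<and>
       (\<forall>\<mu>. pencil_eigenvalue (L + E) \<mu> \<and> \<not> pencil_eigenvalue L \<mu> \<longrightarrow>
          simple_eigenvalue (L + E) \<mu>))" by blast
qed

end
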